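(* Let $\Gamma\subset\mathrm{Nil}$ be a lattice, and equip $M=\Gamma\backslash\mathrm{Nil}$ with the metric $g$ induced by the standard $\mathrm{Nil}$ metric. Then $$\mathrm{CS}(M,g)\equiv-\frac1{16\pi^2}\mathrm{Vol}(M,g)\pmod{\mathbb Z}.$$
   Context: $\mathrm{Nil}=\mathbb R^3$ is the Heisenberg group, $(x,y,z)$ corresponding to the matrix $\begin{pmatrix}1&x&z\\0&1&y\\0&0&1\end{pmatrix}$ under matrix multiplication, with left-invariant frame $X=\partial_x$, $Y=\partial_y+x\partial_z$, $Z=\partial_z$. The standard metric $dx^2+dy^2+(dz-x\,dy)^2$ is the left-invariant metric making $X,Y,Z$ orthonormal; $\mathrm{Nil}$ is oriented so that $(X,Y,Z)$ is positive, and $M$ carries the induced orientation. A lattice is a discrete cocompact subgroup, acting by left translations. For a closed oriented Riemannian $3$-manifold $(M,g)$ with oriented orthonormal frame bundle $F(M,g)$ (a trivial $\mathrm{SO}(3)$-bundle), Levi-Civita connection form $\omega_{\mathrm{LC}}$ ($\mathfrak{so}(3)$-valued) and any section $s$ of $F(M,g)$, $$\mathrm{CS}(M,g)=-\frac1{16\pi^2}\int_Ms^*\mathrm{Tr}\Big(\omega_{\mathrm{LC}}\wedge d\omega_{\mathrm{LC}}+\frac23\omega_{\mathrm{LC}}\wedge\omega_{\mathrm{LC}}\wedge\omega_{\mathrm{LC}}\Big)\bmod\mathbb Z,$$ independent of $s$. $\mathrm{Vol}(M,g)$ is the Riemannian volume. *)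

theory Defs
  imports "HOL-Analysis.Analysis" "HOL-Algebra.Group" "HOL-Library.Real_Mod"
begin

text \<open>
  Closed oriented Riemannian 3-manifolds are presented as \<open>M = G\R\<^sup>3\<close>, where \<open>G\<close> is a group of
  diffeomorphisms of \<open>R\<^sup>3\<close> acting freely, properly discontinuously and cocompactly, by
  orientation-preserving isometries of a Riemannian metric \<open>g\<close> on \<open>R\<^sup>3\<close>. The quotient map is a
  covering and a local isometry, so tensor fields, differential forms and oriented orthonormal
  frames on \<open>M\<close> are the \<open>G\<close>-invariant ones on \<open>R\<^sup>3\<close>. The orientation of \<open>M\<close> is the one induced by
  the standard orientation of \<open>R\<^sup>3\<close>. The constants below are meaningful under these conditions.
\<close>

primrec Ck :: "nat \<Rightarrow> ('a::euclidean_space \<Rightarrow> 'b::real_normed_vector) \<Rightarrow> bool" where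
  "Ck 0 f \<longleftrightarrow> continuous_on UNIV f"
| "Ck (Suc k) f \<longleftrightarrow> (\<forall>x. f differentiable (at x)) \<and>
     (\<forall>v. Ck k (\<lambda>x. frechet_derivative f (at x) v))"

definition smooth :: "('a::euclidean_space \<Rightarrow> 'b::real_normed_vector) \<Rightarrow> bool" where
  "smooth f \<longleftrightarrow> (\<forall>k. Ck k f)"


subsection \<open>The quotient and integration over it\<close>

definition orbit :: "('a \<Rightarrow> 'a) set \<Rightarrow> 'a \<Rightarrow> 'a set" where
  "orbit G p = (\<lambda>\<phi>. \<phi> p) ` G"

text \<open>The points of the quotient are the orbits; it carries the quotient topology.\<close>

definition quotient_space :: "('a::topological_space \<Rightarrow> 'a) set \<Rightarrow> 'a set topology" where
  "quotient_space G = topology (\<lambda>U. U \<subseteq> range (orbit G) \<and> open {p. orbit G p \<in> U})"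

lemma openin_quotient_space:
  "openin (quotient_space G) U \<longleftrightarrow> U \<subseteq> range (orbit G) \<and> open {p. orbit G p \<in> U}"
proof -
  have *: "{p. orbit G p \<in> S \<inter> T} = {p. orbit G p \<in> S} \<inter> {p. orbit G p \<in> T}" for S T
    by auto
  have **: "{p. orbit G p \<in> \<Union>K} = (\<Union>S\<in>K. {p. orbit G p \<in> S})" for K
    by auto
  have "istopology (\<lambda>U. U \<subseteq> range (orbit G) \<and> open {p. orbit G p \<in> U})"
    unfolding istopology_def * ** by blast
  then show ?thesis
    by (simp add: quotient_space_def)
qed

text \<open>A strict fundamental domain: a Borel set meeting every orbit in exactly one point.\<close>

definition fundamental_domain :: "(real^3 \<Rightarrow> real^3) set \<Rightarrow> (real^3) set \<Rightarrow> bool" where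
  "fundamental_domain G D \<longleftrightarrow> D \<in> sets borel \<and> (\<forall>p. \<exists>!q. q \<in> D \<and> q \<in> orbit G p)"

text \<open>A 3-form \<open>\<Omega>\<close> takes a point and three tangent vectors. For \<open>G\<close>-invariant \<open>\<Omega>\<close> the integral does
  not depend on the chosen fundamental domain.\<close>

definition quotient_integral ::
  "(real^3 \<Rightarrow> real^3) set \<Rightarrow> (real^3 \<Rightarrow> real^3 \<Rightarrow> real^3 \<Rightarrow> real^3 \<Rightarrow> real) \<Rightarrow> real" where
  "quotient_integral G \<Omega> =
     (LINT p:(SOME D. fundamental_domain G D)|lborel. \<Omega> p (axis 1 1) (axis 2 1) (axis 3 1))"


subsection \<open>Riemannian metrics on \<open>R\<^sup>3\<close> and the Levi-Civita connection\<close>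

text \<open>\<open>g p u v\<close> is the inner product of the tangent vectors \<open>u\<close> and \<open>v\<close> at \<open>p\<close>.\<close>

type_synonym metric3 = "real^3 \<Rightarrow> real^3 \<Rightarrow> real^3 \<Rightarrow> real"

definition gram :: "metric3 \<Rightarrow> real^3 \<Rightarrow> real^3^3" where
  "gram g p = (\<chi> i j. g p (axis i 1) (axis j 1))"

text \<open>The Riemannian volume form \<open>sqrt (det g) dx \<and> dy \<and> dz\<close>; \<open>u\<close>, \<open>v\<close>, \<open>w\<close> are the rows of the
  second determinant.\<close>

definition volume_form :: "metric3 \<Rightarrow> real^3 \<Rightarrow> real^3 \<Rightarrow> real^3 \<Rightarrow> real^3 \<Rightarrow> real" where
  "volume_form g p u v w = sqrt (det (gram g p)) * det (vector [u, v, w] :: real^3^3)"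

definition riemannian_volume :: "(real^3 \<Rightarrow> real^3) set \<Rightarrow> metric3 \<Rightarrow> real" where
  "riemannian_volume G g = quotient_integral G (volume_form g)"

definition partial :: "3 \<Rightarrow> (real^3 \<Rightarrow> real) \<Rightarrow> real^3 \<Rightarrow> real" where
  "partial i f p = frechet_derivative f (at p) (axis i 1)"

text \<open>\<open>christoffel g p k i j\<close> is the Christoffel symbol with upper index \<open>k\<close> and lower indices
  \<open>i\<close>, \<open>j\<close> of the Levi-Civita connection of \<open>g\<close>.\<close>

definition christoffel :: "metric3 \<Rightarrow> real^3 \<Rightarrow> 3 \<Rightarrow> 3 \<Rightarrow> 3 \<Rightarrow> real" where
  "christoffel g p k i j =
     (1/2) * (\<Sum>l\<in>UNIV. matrix_inv (gram g p) $ k $ l *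
        (partial i (\<lambda>q. gram g q $ j $ l) p + partial j (\<lambda>q. gram g q $ i $ l) p
          - partial l (\<lambda>q. gram g q $ i $ j) p))"

definition covariant_deriv :: "metric3 \<Rightarrow> real^3 \<Rightarrow> (real^3 \<Rightarrow> real^3) \<Rightarrow> real^3 \<Rightarrow> real^3" where
  "covariant_deriv g v W p = frechet_derivative W (at p) v +
     (\<chi> k. \<Sum>i\<in>UNIV. \<Sum>j\<in>UNIV. christoffel g p k i j * v $ i * W p $ j)"

text \<open>Sections of \<open>F(M,g)\<close>: a frame at \<open>p\<close> is a matrix whose columns are the frame vectors.\<close>

definition frame_section ::
  "(real^3 \<Rightarrow> real^3) set \<Rightarrow> metric3 \<Rightarrow> (real^3 \<Rightarrow> real^3^3) \<Rightarrow> bool" where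
  "frame_section G g s \<longleftrightarrow>
     smooth s \<and>
     (\<forall>p i j. g p (column i (s p)) (column j (s p)) = (if i = j then 1 else 0)) \<and>
     (\<forall>p. det (s p) > 0) \<and>
     (\<forall>\<phi>\<in>G. \<forall>p i. column i (s (\<phi> p)) = frechet_derivative \<phi> (at p) (column i (s p)))"

text \<open>The pullback along \<open>s = (e\<^sub>1, e\<^sub>2, e\<^sub>3)\<close> of the Levi-Civita connection form is the matrix \<open>\<theta>\<close> of
  1-forms with \<open>\<nabla>\<^sub>v e\<^sub>j = (\<Sum>i. \<theta>\<^sub>i\<^sub>j(v) e\<^sub>i)\<close>.\<close>

definition connection_form ::
  "metric3 \<Rightarrow> (real^3 \<Rightarrow> real^3^3) \<Rightarrow> real^3 \<Rightarrow> real^3 \<Rightarrow> real^3^3" where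
  "connection_form g s p v =
     (\<chi> i j. g p (column i (s p)) (covariant_deriv g v (\<lambda>q. column j (s q)) p))"


subsection \<open>Matrix-valued differential forms and the Chern-Simons invariant\<close>

text \<open>Normalisation of wedge product and exterior derivative: \<open>(dx \<and> dy \<and> dz)(\<partial>\<^sub>x, \<partial>\<^sub>y, \<partial>\<^sub>z) = 1\<close> and
  \<open>d\<alpha>(u,v) = u(\<alpha>(v)) - v(\<alpha>(u))\<close> for constant \<open>u\<close> and \<open>v\<close>. Coefficients multiply as matrices.\<close>

definition ext_deriv ::
  "(real^3 \<Rightarrow> real^3 \<Rightarrow> real^3^3) \<Rightarrow> real^3 \<Rightarrow> real^3 \<Rightarrow> real^3 \<Rightarrow> real^3^3" where
  "ext_deriv \<alpha> p u v =
     frechet_derivative (\<lambda>q. \<alpha> q v) (at p) u - frechet_derivative (\<lambda>q. \<alpha> q u) (at p) v"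

definition wedge11 ::
  "(real^3 \<Rightarrow> real^3 \<Rightarrow> real^3^3) \<Rightarrow> (real^3 \<Rightarrow> real^3 \<Rightarrow> real^3^3) \<Rightarrow>
   real^3 \<Rightarrow> real^3 \<Rightarrow> real^3 \<Rightarrow> real^3^3" where
  "wedge11 \<alpha> \<beta> p u v = \<alpha> p u ** \<beta> p v - \<alpha> p v ** \<beta> p u"

definition wedge12 ::
  "(real^3 \<Rightarrow> real^3 \<Rightarrow> real^3^3) \<Rightarrow> (real^3 \<Rightarrow> real^3 \<Rightarrow> real^3 \<Rightarrow> real^3^3) \<Rightarrow>
   real^3 \<Rightarrow> real^3 \<Rightarrow> real^3 \<Rightarrow> real^3 \<Rightarrow> real^3^3" where
  "wedge12 \<alpha> \<beta> p u v w = \<alpha> p u ** \<beta> p v w - \<alpha> p v ** \<beta> p u w + \<alpha> p w ** \<beta> p u v"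

definition chern_simons_form ::
  "metric3 \<Rightarrow> (real^3 \<Rightarrow> real^3^3) \<Rightarrow> real^3 \<Rightarrow> real^3 \<Rightarrow> real^3 \<Rightarrow> real^3 \<Rightarrow> real" where
  "chern_simons_form g s p u v w =
     (let \<theta> = connection_form g s in
      trace (wedge12 \<theta> (ext_deriv \<theta>) p u v w
             + (2/3) *\<^sub>R wedge12 \<theta> (wedge11 \<theta> \<theta>) p u v w))"

text \<open>An element of \<open>R/Z\<close> is a coset of \<open>Z\<close> in \<open>R\<close>. The union of the cosets given by all
  sections is a single coset precisely because the value modulo \<open>Z\<close> is independent of the section.\<close>

definition mod_Z :: "real \<Rightarrow> real set" where
  "mod_Z a = {c. [c = a] (rmod 1)}"

definition chern_simons :: "(real^3 \<Rightarrow> real^3) set \<Rightarrow> metric3 \<Rightarrow> real set" where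
  "chern_simons G g =
     (\<Union>s\<in>{s. frame_section G g s}.
        mod_Z (- (1 / (16 * pi\<^sup>2)) * quotient_integral G (chern_simons_form g s)))"


subsection \<open>Nil\<close>

definition nil_matrix :: "real^3 \<Rightarrow> real^3^3" where
  "nil_matrix p = vector [vector [1, p$1, p$3], vector [0, 1, p$2], vector [0, 0, 1]]"

definition nil_mult :: "real^3 \<Rightarrow> real^3 \<Rightarrow> real^3" where
  "nil_mult p q = vector [p$1 + q$1, p$2 + q$2, p$3 + q$3 + p$1 * q$2]"

lemma nil_matrix_mult: "nil_matrix (nil_mult p q) = nil_matrix p ** nil_matrix q"
  by (simp add: nil_matrix_def nil_mult_def matrix_matrix_mult_def vec_eq_iff forall_3 sum_3)

definition Nil_group :: "(real^3) monoid" where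
  "Nil_group = \<lparr>carrier = UNIV, mult = nil_mult, one = 0\<rparr>"

lemma group_Nil_group: "group Nil_group"
proof (rule groupI)
  fix p assume "p \<in> carrier Nil_group"
  have "nil_mult (vector [- p$1, - p$2, p$1 * p$2 - p$3]) p = 0"
    by (simp add: nil_mult_def vec_eq_iff forall_3)
  then show "\<exists>q\<in>carrier Nil_group. q \<otimes>\<^bsub>Nil_group\<^esub> p = \<one>\<^bsub>Nil_group\<^esub>"
    by (auto simp: Nil_group_def)
qed (auto simp: Nil_group_def nil_mult_def vec_eq_iff forall_3 algebra_simps)

text \<open>The metric \<open>dx\<^sup>2 + dy\<^sup>2 + (dz - x dy)\<^sup>2\<close>.\<close>

definition nil_metric :: metric3 where
  "nil_metric p u v = u$1 * v$1 + u$2 * v$2 + (u$3 - p$1 * u$2) * (v$3 - p$1 * v$2)"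

text \<open>The columns of \<open>nil_frame p\<close> are \<open>X = \<partial>\<^sub>x\<close>, \<open>Y = \<partial>\<^sub>y + x \<partial>\<^sub>z\<close>, \<open>Z = \<partial>\<^sub>z\<close> at \<open>p\<close>. The lemmas say
  that \<open>nil_metric\<close> makes them orthonormal and that the orientation for which they are positive is
  the standard one of \<open>R\<^sup>3\<close>.\<close>

definition nil_frame :: "real^3 \<Rightarrow> real^3^3" where
  "nil_frame p = vector [vector [1, 0, 0], vector [0, 1, 0], vector [0, p$1, 1]]"

lemma nil_frame_orthonormal:
  "nil_metric p (column i (nil_frame p)) (column j (nil_frame p)) = (if i = j then 1 else 0)"
  using exhaust_3[of i] exhaust_3[of j]
  by (auto simp: nil_metric_def nil_frame_def column_def)

lemma det_nil_frame: "det (nil_frame p) = 1"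
  by (simp add: nil_frame_def det_3)

lemma nil_metric_left_invariant:
  "nil_metric (nil_mult a p) (frechet_derivative (nil_mult a) (at p) u)
     (frechet_derivative (nil_mult a) (at p) v) = nil_metric p u v"
proof -
  let ?L = "\<lambda>w. vector [w$1, w$2, w$3 + a$1 * w$2] :: real^3"
  have lin: "linear ?L"
    by (rule linearI) (simp_all add: vec_eq_iff forall_3 algebra_simps)
  have "(nil_mult a has_derivative ?L) (at p)"
  proof -
    have "nil_mult a = (\<lambda>q. a + ?L q)"
      by (auto simp: fun_eq_iff nil_mult_def vec_eq_iff forall_3)
    moreover have "((\<lambda>q. a + ?L q) has_derivative ?L) (at p)"
      using linear_imp_has_derivative[OF lin, of "at p"] has_derivative_add_const
      by (simp add: add.commute has_derivative_add_const)
    ultimately show ?thesis by simp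
  qed
  then have "frechet_derivative (nil_mult a) (at p) = ?L"
    by (rule frechet_derivative_at[symmetric])
  then show ?thesis
    by (simp add: nil_metric_def nil_mult_def algebra_simps)
qed

definition left_translations :: "(real^3) set \<Rightarrow> (real^3 \<Rightarrow> real^3) set" where
  "left_translations \<Gamma> = nil_mult ` \<Gamma>"

definition nil_lattice :: "(real^3) set \<Rightarrow> bool" where
  "nil_lattice \<Gamma> \<longleftrightarrow> subgroup \<Gamma> Nil_group \<and> discrete \<Gamma> \<and>
     compact_space (quotient_space (left_translations \<Gamma>))"

end

theory Submission
  imports Defs "HOL-Real_Asymp.Real_Asymp"
begin

text \<open>Write a frame as \<open>s = (X, Y, Z) h\<close> with \<open>h : M \<rightarrow> SO(3)\<close>. The Chern-Simons form of \<open>s\<close> is that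
  of \<open>(X, Y, Z)\<close>, which equals the volume form, plus twice the volume form of the triple
  \<open>t = h\<^sup>-\<^sup>1 dh\<close>, plus an exact form. Exact forms integrate to zero because \<open>X, Y, Z\<close> generate right
  translations, which map fundamental domains of \<open>\<Gamma>\<close> to fundamental domains and preserve Lebesgue
  measure. The integral of the volume of \<open>t\<close> is \<open>8 \<pi>\<^sup>2\<close> times the degree of \<open>h\<close>. To see that this
  degree is an integer, compose \<open>h\<close> with the Cayley chart \<open>a : SO(3) \<rightarrow> R\<^sup>3\<close>, which omits only the
  half turns: by Stokes' theorem the signed measure \<open>(a \<circ> h)\<^sub>* det D(a \<circ> h)\<close> is a constant multiple
  of Lebesgue measure, and by the area formula its density counts preimages with sign.\<close>


subsection \<open>Calculus on open sets\<close>

text \<open>The constants fit because the trace form on so(3) is -2 times the dot product of axial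
  vectors: the frame X, Y, Z contributes 1/2 through the bracket [X, Y] = Z in the exterior
  derivative and 1/2 through the cubic term. SO(3) has volume 8 pi^2 for the form measured by t, so
  the degree term integrates to 16 pi^2 times an integer, and the normalisation 1/(16 pi^2) makes it
  an integer. The main obstacle is that the integral runs over an arbitrarily chosen Borel
  fundamental domain, which may be unbounded and has no usable boundary. So no boundary terms are
  ever formed, and its finite volume comes from unfolding against a large ball. The half turns are
  harmless for two reasons. The chart blows up there, so pull-backs of compactly supported forms
  vanish near them. Where t is nondegenerate they form a null set, and elsewhere the integrand is
  zero. Critical points of the chart map carry no signed mass, so preimages are counted only where
  the Jacobian is nonzero.\<close>

abbreviation dd :: "('a::euclidean_space \<Rightarrow> 'b::real_normed_vector) \<Rightarrow> 'a \<Rightarrow> 'a \<Rightarrow> 'b" where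
  "dd f x \<equiv> frechet_derivative f (at x)"

lemma dd_eqI: "(f has_derivative f') (at x) \<Longrightarrow> dd f x v = f' v"
  by (metis frechet_derivative_at)

lemma has_derivative_dd: "f differentiable at x \<Longrightarrow> (f has_derivative dd f x) (at x)"
  using frechet_derivative_works by blast

lemma dd_const [simp]: "dd (\<lambda>x. c) x v = 0"
  by (rule dd_eqI) (auto intro!: derivative_eq_intros)

lemma dd_add: "f differentiable at x \<Longrightarrow> g differentiable at x \<Longrightarrow>
    dd (\<lambda>x. f x + g x) x v = dd f x v + dd g x v"
  by (rule dd_eqI) (auto intro!: derivative_eq_intros has_derivative_dd)

lemma dd_diff: "f differentiable at x \<Longrightarrow> g differentiable at x \<Longrightarrow>
    dd (\<lambda>x. f x - g x) x v = dd f x v - dd g x v"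
  by (rule dd_eqI) (auto intro!: derivative_eq_intros has_derivative_dd)

lemma dd_minus: "f differentiable at x \<Longrightarrow> dd (\<lambda>x. - f x) x v = - dd f x v"
  by (rule dd_eqI) (auto intro!: derivative_eq_intros has_derivative_dd)

lemma dd_mult:
  fixes f g :: "'a::euclidean_space \<Rightarrow> real"
  shows "f differentiable at x \<Longrightarrow> g differentiable at x \<Longrightarrow>
    dd (\<lambda>x. f x * g x) x v = f x * dd g x v + dd f x v * g x"
  by (rule dd_eqI) (auto intro!: derivative_eq_intros has_derivative_dd)

lemma dd_divide:
  fixes f g :: "'a::euclidean_space \<Rightarrow> real"
  assumes "f differentiable at x" "g differentiable at x" "g x \<noteq> 0"
  shows "dd (\<lambda>x. f x / g x) x v = (dd f x v * g x - f x * dd g x v) / (g x * g x)"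
proof (rule dd_eqI)
  show "((\<lambda>x. f x / g x) has_derivative (\<lambda>v. (dd f x v * g x - f x * dd g x v) / (g x * g x))) (at x)"
    by (rule has_derivative_divide'[OF has_derivative_dd has_derivative_dd]) (use assms in auto)
qed

lemma dd_compose_real:
  fixes f :: "'a::euclidean_space \<Rightarrow> real"
  assumes "f differentiable at x" "(\<phi> has_real_derivative c) (at (f x))"
  shows "dd (\<lambda>x. \<phi> (f x)) x v = c * dd f x v"
    and "(\<lambda>x. \<phi> (f x)) differentiable at x"
proof -
  have "((\<lambda>x. \<phi> (f x)) has_derivative (\<lambda>v. c * dd f x v)) (at x)"
    using has_derivative_compose[OF has_derivative_dd[OF assms(1)], of \<phi> "(*) c"] assms(2)
    by (simp add: has_field_derivative_def)
  then show "dd (\<lambda>x. \<phi> (f x)) x v = c * dd f x v" "(\<lambda>x. \<phi> (f x)) differentiable at x"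
    by (auto intro: dd_eqI differentiableI)
qed

lemma dd_nth: "dd (\<lambda>p::real^'n. p $ i) x v = v $ i"
  by (rule dd_eqI) (rule bounded_linear_imp_has_derivative, rule bounded_linear_vec_nth)

lemma dd_cong:
  assumes "open S" "x \<in> S" "\<And>y. y \<in> S \<Longrightarrow> f y = g y"
  shows "dd f x = dd g x"
proof -
  have "(f has_derivative f') (at x) \<longleftrightarrow> (g has_derivative f') (at x)" for f'
    using has_derivative_transform_within_open[of f f' x UNIV S g]
      has_derivative_transform_within_open[of g f' x UNIV S f] assms by auto
  then show ?thesis by (simp add: frechet_derivative_def)
qed

lemma differentiable_cong_open:
  fixes f g :: "'a::euclidean_space \<Rightarrow> 'b::real_normed_vector"
  assumes "open S" "x \<in> S" "\<And>y. y \<in> S \<Longrightarrow> f y = g y" "f differentiable at x"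
  shows "g differentiable at x"
proof -
  have "(g has_derivative dd f x) (at x)"
    by (rule has_derivative_transform_within_open[OF has_derivative_dd[OF assms(4)] assms(1,2)])
       (use assms in auto)
  then show ?thesis by (rule differentiableI)
qed

lemma dd_linear: "f differentiable at x \<Longrightarrow> linear (dd f x)"
  by (rule linear_frechet_derivative)

text \<open>Relative to a set because chart coordinates make sense only off the half turns.
  Continuity of the derivative is required direction by direction, as in \<open>Ck\<close>.\<close>

definition C1 :: "'a::euclidean_space set \<Rightarrow> ('a \<Rightarrow> real) \<Rightarrow> bool" where
  "C1 S f \<longleftrightarrow> (\<forall>x\<in>S. f differentiable at x) \<and> (\<forall>v. continuous_on S (\<lambda>x. dd f x v))"

text \<open>Two derivatives are the regularity that the symmetry of second derivatives, and hence
  the bracket relations, call for.\<close>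

definition C2 :: "'a::euclidean_space set \<Rightarrow> ('a \<Rightarrow> real) \<Rightarrow> bool" where
  "C2 S f \<longleftrightarrow> C1 S f \<and> (\<forall>v. C1 S (\<lambda>x. dd f x v))"

lemma C1_diffD: "C1 S f \<Longrightarrow> x \<in> S \<Longrightarrow> f differentiable at x"
  by (simp add: C1_def)

lemma C1_contD: "C1 S f \<Longrightarrow> continuous_on S f"
  by (meson C1_def continuous_at_imp_continuous_on differentiable_imp_continuous_within)

lemma C1_dd_contD: "C1 S f \<Longrightarrow> continuous_on S (\<lambda>x. dd f x v)"
  by (simp add: C1_def)

lemma C2_C1: "C2 S f \<Longrightarrow> C1 S f"
  by (simp add: C2_def)

lemma C2_dd: "C2 S f \<Longrightarrow> C1 S (\<lambda>x. dd f x v)"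
  by (simp add: C2_def)

lemma C1_subset: "C1 S f \<Longrightarrow> T \<subseteq> S \<Longrightarrow> C1 T f"
  unfolding C1_def by (meson continuous_on_subset subsetD)

lemma C2_subset: "C2 S f \<Longrightarrow> T \<subseteq> S \<Longrightarrow> C2 T f"
  unfolding C2_def by (meson C1_subset)

lemma C1_cong:
  assumes "open S" "\<And>x. x \<in> S \<Longrightarrow> f x = g x" "C1 S f"
  shows "C1 S g"
  unfolding C1_def
proof (intro conjI ballI allI)
  show "g differentiable at x" if "x \<in> S" for x
    by (rule differentiable_cong_open[OF assms(1) that assms(2) C1_diffD[OF assms(3) that]])
  show "continuous_on S (\<lambda>x. dd g x v)" for v
    using C1_dd_contD[OF assms(3), of v]
    by (rule continuous_on_eq) (use dd_cong[OF assms(1) _ assms(2)] in force)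
qed

text \<open>Glues a form on the chart domain to its extension by zero.\<close>

lemma C1_Un: "C1 S f \<Longrightarrow> C1 T f \<Longrightarrow> open S \<Longrightarrow> open T \<Longrightarrow> C1 (S \<union> T) f"
  unfolding C1_def by (auto intro: continuous_on_open_Un)

lemma C1_const [intro]: "C1 S (\<lambda>x. c)"
  by (simp add: C1_def)

lemma C1_nth [intro]: "C1 S (\<lambda>p::real^'n. p $ i)"
  unfolding C1_def using bounded_linear_imp_differentiable[OF bounded_linear_vec_nth]
  by (auto simp: dd_nth)

lemma C1_add [intro]:
  assumes "C1 S f" "C1 S g" shows "C1 S (\<lambda>x. f x + g x)"
proof -
  have f: "\<And>x. x \<in> S \<Longrightarrow> f differentiable at x" and g: "\<And>x. x \<in> S \<Longrightarrow> g differentiable at x"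
    using assms by (auto intro: C1_diffD)
  note cont = C1_contD[OF assms(1)] C1_contD[OF assms(2)] C1_dd_contD[OF assms(1)] C1_dd_contD[OF assms(2)]
  have "continuous_on S (\<lambda>x. dd (\<lambda>x. f x + g x) x v)" for v
  proof (rule continuous_on_eq)
    show "continuous_on S (\<lambda>x. dd f x v + dd g x v)"
      using assms by (auto intro!: continuous_intros cont)
  qed (use f g assms in \<open>simp add: dd_add\<close>)
  moreover have "(\<lambda>x. f x + g x) differentiable at x" if "x \<in> S" for x
    using that assms by (intro differentiable_add f g) auto
  ultimately show ?thesis by (simp add: C1_def)
qed

lemma C1_diff [intro]:
  assumes "C1 S f" "C1 S g" shows "C1 S (\<lambda>x. f x - g x)"
proof -
  have f: "\<And>x. x \<in> S \<Longrightarrow> f differentiable at x" and g: "\<And>x. x \<in> S \<Longrightarrow> g differentiable at x"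
    using assms by (auto intro: C1_diffD)
  note cont = C1_contD[OF assms(1)] C1_contD[OF assms(2)] C1_dd_contD[OF assms(1)] C1_dd_contD[OF assms(2)]
  have "continuous_on S (\<lambda>x. dd (\<lambda>x. f x - g x) x v)" for v
  proof (rule continuous_on_eq)
    show "continuous_on S (\<lambda>x. dd f x v - dd g x v)"
      using assms by (auto intro!: continuous_intros cont)
  qed (use f g assms in \<open>simp add: dd_diff\<close>)
  moreover have "(\<lambda>x. f x - g x) differentiable at x" if "x \<in> S" for x
    using that assms by (intro differentiable_diff f g) auto
  ultimately show ?thesis by (simp add: C1_def)
qed

lemma C1_mult [intro]:
  assumes "C1 S f" "C1 S g" shows "C1 S (\<lambda>x. f x * g x)"
proof -
  have f: "\<And>x. x \<in> S \<Longrightarrow> f differentiable at x" and g: "\<And>x. x \<in> S \<Longrightarrow> g differentiable at x"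
    using assms by (auto intro: C1_diffD)
  note cont = C1_contD[OF assms(1)] C1_contD[OF assms(2)] C1_dd_contD[OF assms(1)] C1_dd_contD[OF assms(2)]
  have "continuous_on S (\<lambda>x. dd (\<lambda>x. f x * g x) x v)" for v
  proof (rule continuous_on_eq)
    show "continuous_on S (\<lambda>x. f x * dd g x v + dd f x v * g x)"
      using assms by (auto intro!: continuous_intros cont)
  qed (use f g assms in \<open>simp add: dd_mult\<close>)
  moreover have "(\<lambda>x. f x * g x) differentiable at x" if "x \<in> S" for x
    using that assms by (intro differentiable_mult f g) auto
  ultimately show ?thesis by (simp add: C1_def)
qed

lemma C1_sum [intro]: "(\<And>i. i \<in> I \<Longrightarrow> C1 S (f i)) \<Longrightarrow> C1 S (\<lambda>x. \<Sum>i\<in>I. f i x)"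
  by (induction I rule: infinite_finite_induct) auto

lemma C1_divide [intro]:
  assumes "C1 S f" "C1 S g" "\<And>x. x \<in> S \<Longrightarrow> g x \<noteq> 0" shows "C1 S (\<lambda>x. f x / g x)"
proof -
  have f: "\<And>x. x \<in> S \<Longrightarrow> f differentiable at x" and g: "\<And>x. x \<in> S \<Longrightarrow> g differentiable at x"
    using assms by (auto intro: C1_diffD)
  note cont = C1_contD[OF assms(1)] C1_contD[OF assms(2)] C1_dd_contD[OF assms(1)] C1_dd_contD[OF assms(2)]
  have "continuous_on S (\<lambda>x. dd (\<lambda>x. f x / g x) x v)" for v
  proof (rule continuous_on_eq)
    show "continuous_on S (\<lambda>x. (dd f x v * g x - f x * dd g x v) / (g x * g x))"
      using assms by (auto intro!: continuous_intros cont)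
  qed (use f g assms in \<open>simp add: dd_divide\<close>)
  moreover have "(\<lambda>x. f x / g x) differentiable at x" if "x \<in> S" for x
    using that assms by (intro differentiable_divide f g) auto
  ultimately show ?thesis by (simp add: C1_def)
qed

lemma C1_compose_real:
  assumes "C1 S f" and \<phi>: "\<And>y. (\<phi> has_real_derivative \<phi>' y) (at y)" and "continuous_on UNIV \<phi>'"
  shows "C1 S (\<lambda>x. \<phi> (f x))"
  unfolding C1_def
proof (intro conjI ballI allI)
  show "(\<lambda>x. \<phi> (f x)) differentiable at x" if "x \<in> S" for x
    using dd_compose_real(2)[OF C1_diffD[OF assms(1) that] \<phi>] .
  show "continuous_on S (\<lambda>x. dd (\<lambda>x. \<phi> (f x)) x v)" for v
  proof (rule continuous_on_eq[where f="\<lambda>x. \<phi>' (f x) * dd f x v"])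
    show "continuous_on S (\<lambda>x. \<phi>' (f x) * dd f x v)"
      using continuous_on_compose2[OF assms(3) C1_contD[OF assms(1)]] C1_dd_contD[OF assms(1)]
      by (intro continuous_intros) auto
  qed (use dd_compose_real(1)[OF C1_diffD[OF assms(1)] \<phi>] in auto)
qed

lemma C2_const [intro]: "C2 S (\<lambda>x. c)"
  by (auto simp: C2_def)

lemma C2_nth [intro]: "C2 S (\<lambda>p::real^'n. p $ i)"
  by (auto simp: C2_def dd_nth)

lemma C2_add [intro]:
  assumes "open S" "C2 S f" "C2 S g" shows "C2 S (\<lambda>x. f x + g x)"
proof -
  have f: "\<And>x. x \<in> S \<Longrightarrow> f differentiable at x" and g: "\<And>x. x \<in> S \<Longrightarrow> g differentiable at x"
    using assms by (auto intro: C1_diffD C2_C1)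
  have "C1 S (\<lambda>x. dd (\<lambda>x. f x + g x) x v)" for v
  proof (rule C1_cong[OF assms(1)])
    show "C1 S (\<lambda>x. dd f x v + dd g x v)"
      using assms by (intro C1_add C1_diff C1_mult C1_divide C2_dd C2_C1) auto
  qed (use f g assms in \<open>simp add: dd_add\<close>)
  moreover have "C1 S (\<lambda>x. f x + g x)"
    using assms by (intro C1_add C2_C1)
  ultimately show ?thesis by (simp add: C2_def)
qed

lemma C2_diff [intro]:
  assumes "open S" "C2 S f" "C2 S g" shows "C2 S (\<lambda>x. f x - g x)"
proof -
  have f: "\<And>x. x \<in> S \<Longrightarrow> f differentiable at x" and g: "\<And>x. x \<in> S \<Longrightarrow> g differentiable at x"
    using assms by (auto intro: C1_diffD C2_C1)
  have "C1 S (\<lambda>x. dd (\<lambda>x. f x - g x) x v)" for v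
  proof (rule C1_cong[OF assms(1)])
    show "C1 S (\<lambda>x. dd f x v - dd g x v)"
      using assms by (intro C1_add C1_diff C1_mult C1_divide C2_dd C2_C1) auto
  qed (use f g assms in \<open>simp add: dd_diff\<close>)
  moreover have "C1 S (\<lambda>x. f x - g x)"
    using assms by (intro C1_diff C2_C1)
  ultimately show ?thesis by (simp add: C2_def)
qed

lemma C2_mult [intro]:
  assumes "open S" "C2 S f" "C2 S g" shows "C2 S (\<lambda>x. f x * g x)"
proof -
  have f: "\<And>x. x \<in> S \<Longrightarrow> f differentiable at x" and g: "\<And>x. x \<in> S \<Longrightarrow> g differentiable at x"
    using assms by (auto intro: C1_diffD C2_C1)
  have "C1 S (\<lambda>x. dd (\<lambda>x. f x * g x) x v)" for v
  proof (rule C1_cong[OF assms(1)])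
    show "C1 S (\<lambda>x. f x * dd g x v + dd f x v * g x)"
      using assms by (intro C1_add C1_diff C1_mult C1_divide C2_dd C2_C1) auto
  qed (use f g assms in \<open>simp add: dd_mult\<close>)
  moreover have "C1 S (\<lambda>x. f x * g x)"
    using assms by (intro C1_mult C2_C1)
  ultimately show ?thesis by (simp add: C2_def)
qed

lemma C2_divide [intro]:
  assumes "open S" "C2 S f" "C2 S g" "\<And>x. x \<in> S \<Longrightarrow> g x \<noteq> 0" shows "C2 S (\<lambda>x. f x / g x)"
proof -
  have f: "\<And>x. x \<in> S \<Longrightarrow> f differentiable at x" and g: "\<And>x. x \<in> S \<Longrightarrow> g differentiable at x"
    using assms by (auto intro: C1_diffD C2_C1)
  have "C1 S (\<lambda>x. dd (\<lambda>x. f x / g x) x v)" for v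
  proof (rule C1_cong[OF assms(1)])
    show "C1 S (\<lambda>x. (dd f x v * g x - f x * dd g x v) / (g x * g x))"
      using assms by (intro C1_add C1_diff C1_mult C1_divide C2_dd C2_C1) auto
  qed (use f g assms in \<open>simp add: dd_divide\<close>)
  moreover have "C1 S (\<lambda>x. f x / g x)"
    using assms by (intro C1_divide C2_C1)
  ultimately show ?thesis by (simp add: C2_def)
qed

lemma dd_line:
  fixes f :: "'a::euclidean_space \<Rightarrow> real"
  assumes "f differentiable at (q + s *\<^sub>R u)"
  shows "((\<lambda>s. f (q + s *\<^sub>R u)) has_real_derivative dd f (q + s *\<^sub>R u) u) (at s)"
proof -
  have "((\<lambda>s. f (q + s *\<^sub>R u)) has_derivative (\<lambda>t. dd f (q + s *\<^sub>R u) (t *\<^sub>R u))) (at s)"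
    by (rule has_derivative_compose[where f="\<lambda>s. q + s *\<^sub>R u" and g=f])
       (use has_derivative_dd[OF assms] in \<open>auto intro!: derivative_eq_intros\<close>)
  moreover have "(\<lambda>t. dd f (q + s *\<^sub>R u) (t *\<^sub>R u)) = (*) (dd f (q + s *\<^sub>R u) u)"
    using dd_linear[OF assms] by (auto simp: linear_scale)
  ultimately show ?thesis by (simp add: has_field_derivative_def)
qed

text \<open>Mean value theorem twice: along \<open>u\<close> for the difference of \<open>f\<close>
  between two parallel sides, then along \<open>v\<close> for the resulting difference of
  \<open>u\<close>-derivatives.\<close>

lemma double_difference_mvt:
  fixes f :: "'a::euclidean_space \<Rightarrow> real"
  assumes f: "C2 S f" and h: "h > 0"
    and S: "\<And>s t. 0 \<le> s \<Longrightarrow> s \<le> h \<Longrightarrow> 0 \<le> t \<Longrightarrow> t \<le> h \<Longrightarrow> p + s *\<^sub>R u + t *\<^sub>R v \<in> S"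
  shows "\<exists>s t. 0 < s \<and> s < h \<and> 0 < t \<and> t < h \<and>
    f (p + h *\<^sub>R u + h *\<^sub>R v) - f (p + h *\<^sub>R u) - f (p + h *\<^sub>R v) + f p =
      h * h * dd (\<lambda>q. dd f q u) (p + s *\<^sub>R u + t *\<^sub>R v) v"
proof -
  have d1: "f differentiable at (p + s *\<^sub>R u + t *\<^sub>R v)" if "0 \<le> s" "s \<le> h" "0 \<le> t" "t \<le> h" for s t
    using S[OF that] C1_diffD[OF C2_C1[OF f]] by blast
  have d2: "(\<lambda>q. dd f q u) differentiable at (p + s *\<^sub>R u + t *\<^sub>R v)"
    if "0 \<le> s" "s \<le> h" "0 \<le> t" "t \<le> h" for s t
    using S[OF that] C1_diffD[OF C2_dd[OF f]] by blast
  have comm: "p + s *\<^sub>R u + t *\<^sub>R v = (p + t *\<^sub>R v) + s *\<^sub>R u" for s t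
    by (simp add: algebra_simps)
  define \<phi> where "\<phi> s = f ((p + h *\<^sub>R v) + s *\<^sub>R u) - f (p + s *\<^sub>R u)" for s
  have "\<exists>z>0. z < h \<and> \<phi> h - \<phi> 0 = (h - 0) * (dd f ((p + h *\<^sub>R v) + z *\<^sub>R u) u - dd f (p + z *\<^sub>R u) u)"
  proof (rule MVT2[OF h])
    fix s assume s: "0 \<le> s" "s \<le> h"
    show "(\<phi> has_real_derivative dd f (p + h *\<^sub>R v + s *\<^sub>R u) u - dd f (p + s *\<^sub>R u) u) (at s)"
      unfolding \<phi>_def
      using d1[of s h] d1[of s 0] h s unfolding comm
      by (intro DERIV_diff dd_line) auto
  qed
  then obtain s where s: "0 < s" "s < h"
    "\<phi> h - \<phi> 0 = h * (dd f (p + s *\<^sub>R u + h *\<^sub>R v) u - dd f (p + s *\<^sub>R u) u)"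
    by (auto simp: comm)
  have "\<exists>t>0. t < h \<and> dd f (p + s *\<^sub>R u + h *\<^sub>R v) u - dd f (p + s *\<^sub>R u + 0 *\<^sub>R v) u =
      (h - 0) * dd (\<lambda>q. dd f q u) (p + s *\<^sub>R u + t *\<^sub>R v) v"
    by (rule MVT2[OF h]) (use s d2 in \<open>auto intro!: dd_line\<close>)
  then obtain t where "0 < t" "t < h" "dd f (p + s *\<^sub>R u + h *\<^sub>R v) u - dd f (p + s *\<^sub>R u) u =
      h * dd (\<lambda>q. dd f q u) (p + s *\<^sub>R u + t *\<^sub>R v) v"
    by auto
  with s show ?thesis
    unfolding \<phi>_def by (intro exI[of _ s] exI[of _ t]) (simp add: algebra_simps)
qed

text \<open>The double difference over a small parallelogram is symmetric in \<open>u\<close> and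
  \<open>v\<close>, so it equals both mixed derivatives, each at some point near \<open>p\<close>;
  continuity carries this to \<open>p\<close>.\<close>

lemma dd_commute:
  fixes f :: "'a::euclidean_space \<Rightarrow> real"
  assumes f: "C2 S f" and S: "open S" "p \<in> S"
  shows "dd (\<lambda>q. dd f q u) p v = dd (\<lambda>q. dd f q v) p u"
proof -
  define A where "A = (\<lambda>q. dd (\<lambda>q. dd f q u) q v)"
  define B where "B = (\<lambda>q. dd (\<lambda>q. dd f q v) q u)"
  have cA: "isCont A p" and cB: "isCont B p"
    using C1_dd_contD[OF C2_dd[OF f]] S continuous_on_eq_continuous_at unfolding A_def B_def by blast+
  have "\<bar>A p - B p\<bar> < 2 * e" if e: "e > 0" for e
  proof -
    obtain d1 where d1: "d1 > 0" "\<And>x. dist x p < d1 \<Longrightarrow> dist (A x) (A p) < e"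
      using cA e unfolding continuous_at_eps_delta dist_norm by blast
    obtain d2 where d2: "d2 > 0" "\<And>x. dist x p < d2 \<Longrightarrow> dist (B x) (B p) < e"
      using cB e unfolding continuous_at_eps_delta dist_norm by blast
    obtain d3 where d3: "d3 > 0" "ball p d3 \<subseteq> S"
      using S open_contains_ball by blast
    define d where "d = min d1 (min d2 d3)"
    \<comment> \<open>This scale keeps the whole parallelogram within \<open>d / 2\<close> of
      \<open>p\<close>; the summand 1 covers the case that both vectors vanish.\<close>
    define h where "h = d / (2 * (norm u + norm v + 1))"
    have d: "d > 0" using d1 d2 d3 by (simp add: d_def)
    have h: "h > 0" unfolding h_def using d by (intro divide_pos_pos) (auto intro: add_nonneg_pos)
    have half: "d / (2 * k) * k = d / 2" if "k > 0" for k :: real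
      using that by simp
    have near: "dist (p + s *\<^sub>R u + t *\<^sub>R v) p < d" if "0 \<le> s" "s \<le> h" "0 \<le> t" "t \<le> h" for s t
    proof -
      have "dist (p + s *\<^sub>R u + t *\<^sub>R v) p \<le> norm (s *\<^sub>R u) + norm (t *\<^sub>R v)"
        using norm_triangle_ineq[of "s *\<^sub>R u" "t *\<^sub>R v"] by (simp add: dist_norm add.assoc)
      also have "\<dots> \<le> h * norm u + h * norm v"
        using that by (intro add_mono) (auto intro: mult_right_mono)
      also have "\<dots> \<le> h * (norm u + norm v + 1)" using h by (simp add: algebra_simps)
      also have "\<dots> = d / 2"
        unfolding h_def by (rule half) (use norm_ge_zero[of u] norm_ge_zero[of v] in linarith)
      finally show ?thesis using d by simp
    qed
    have inS: "p + s *\<^sub>R u + t *\<^sub>R v \<in> S" if "0 \<le> s" "s \<le> h" "0 \<le> t" "t \<le> h" for s t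
      using near[OF that] d3 by (auto simp: d_def dist_commute)
    have comm: "p + s *\<^sub>R u + t *\<^sub>R v = p + t *\<^sub>R v + s *\<^sub>R u" for s t
      by (simp add: algebra_simps)
    obtain s t where st: "0 < s" "s < h" "0 < t" "t < h"
      "f (p + h *\<^sub>R u + h *\<^sub>R v) - f (p + h *\<^sub>R u) - f (p + h *\<^sub>R v) + f p = h * h * A (p + s *\<^sub>R u + t *\<^sub>R v)"
      using double_difference_mvt[OF f h inS] unfolding A_def by blast
    have "\<exists>s t. 0 < s \<and> s < h \<and> 0 < t \<and> t < h \<and>
      f (p + h *\<^sub>R v + h *\<^sub>R u) - f (p + h *\<^sub>R v) - f (p + h *\<^sub>R u) + f p = h * h * B (p + s *\<^sub>R v + t *\<^sub>R u)"
      unfolding B_def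
      by (rule double_difference_mvt[OF f h]) (use inS comm in metis)
    then obtain s' t' where st': "0 < s'" "s' < h" "0 < t'" "t' < h"
      "f (p + h *\<^sub>R v + h *\<^sub>R u) - f (p + h *\<^sub>R v) - f (p + h *\<^sub>R u) + f p = h * h * B (p + s' *\<^sub>R v + t' *\<^sub>R u)"
      by blast
    have "h * h * A (p + s *\<^sub>R u + t *\<^sub>R v) = h * h * B (p + t' *\<^sub>R u + s' *\<^sub>R v)"
      unfolding comm[of t' s'] using st(5) st'(5) unfolding comm[of h h] by linarith
    then have "A (p + s *\<^sub>R u + t *\<^sub>R v) = B (p + t' *\<^sub>R u + s' *\<^sub>R v)"
      using h by simp
    moreover have "dist (A (p + s *\<^sub>R u + t *\<^sub>R v)) (A p) < e"
      using near[of s t] st by (intro d1) (auto simp: d_def)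
    moreover have "dist (B (p + t' *\<^sub>R u + s' *\<^sub>R v)) (B p) < e"
      using near[of t' s'] st' by (intro d2) (auto simp: d_def)
    ultimately show ?thesis by (auto simp: dist_real_def)
  qed
  \<comment> \<open>If the values differed, half their distance would be an admissible
    \<open>e\<close>, giving a number smaller than itself.\<close>
  from this[of "\<bar>A p - B p\<bar> / 2"] have "A p = B p" by force
  then show ?thesis by (simp add: A_def B_def)
qed


subsection \<open>The group law and Haar measure of Nil\<close>

text \<open>Choosing for each point a basic open set that isolates it is injective into a countable
  basis. Countability lets sums over the lattice be exchanged with integrals.\<close>

lemma countable_discrete:
  fixes S :: "'a::second_countable_topology set"
  assumes "discrete S"
  shows "countable S"
proof -
  obtain B :: "'a set set" where "countable B \<and> topological_basis B"
    using ex_countable_basis by (rule exE)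
  then have B: "countable B" "topological_basis B"
    by simp_all
  have "\<exists>b\<in>B. b \<inter> S = {x}" if x: "x \<in> S" for x
  proof -
    have "x isolated_in S"
      using assms x by (simp add: discrete_def)
    then obtain T where T: "open T" "T \<inter> S = {x}"
      by (rule isolated_inE)
    have "x \<in> T" using T(2) by auto
    then obtain b where b: "b \<in> B" "x \<in> b" "b \<subseteq> T"
      by (rule topological_basisE[OF B(2) T(1)])
    have "b \<inter> S = {x}" using b(2,3) x T(2) by auto
    then show ?thesis using b(1) ..
  qed
  then obtain f where f: "\<And>x. x \<in> S \<Longrightarrow> f x \<in> B \<and> f x \<inter> S = {x}"
    by metis
  have "inj_on f S"
    by (rule inj_onI) (metis f singleton_inject)
  moreover have "countable (f ` S)"
    using B(1) f by (meson countable_subset image_subsetI)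
  ultimately show ?thesis by (metis countable_image_inj_on)
qed

lemma vector_3_axis:
  "(vector [a, b, c] :: real^3) = a *\<^sub>R axis 1 1 + b *\<^sub>R axis 2 1 + c *\<^sub>R axis 3 1"
  by (simp add: vec_eq_iff forall_3 axis_def)

lemma continuous_on_vector_3 [continuous_intros]:
  assumes "continuous_on S f" "continuous_on S g" "continuous_on S h"
  shows "continuous_on S (\<lambda>x. vector [f x, g x, h x] :: real^3)"
  unfolding vector_3_axis by (intro continuous_intros assms)

lemma measurable_vector_3 [measurable (raw)]:
  assumes "f \<in> borel_measurable M" "g \<in> borel_measurable M" "h \<in> borel_measurable M"
  shows "(\<lambda>x. vector [f x, g x, h x] :: real^3) \<in> borel_measurable M"
  unfolding vector_3_axis using assms by measurable

definition nil_inv :: "real^3 \<Rightarrow> real^3" where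
  "nil_inv p = vector [- p$1, - p$2, p$1 * p$2 - p$3]"

lemma nil_mult_nth [simp]:
  "nil_mult p q $ 1 = p$1 + q$1" "nil_mult p q $ 2 = p$2 + q$2"
  "nil_mult p q $ 3 = p$3 + q$3 + p$1 * q$2"
  by (simp_all add: nil_mult_def)

lemma nil_inv_nth [simp]:
  "nil_inv p $ 1 = - p$1" "nil_inv p $ 2 = - p$2" "nil_inv p $ 3 = p$1 * p$2 - p$3"
  by (simp_all add: nil_inv_def)

lemma nil_mult_assoc: "nil_mult (nil_mult p q) r = nil_mult p (nil_mult q r)"
  by (simp add: vec_eq_iff forall_3 algebra_simps)

lemma nil_mult_inv [simp]:
  "nil_mult (nil_inv p) p = 0" "nil_mult p (nil_inv p) = 0"
  "nil_mult (nil_inv p) (nil_mult p q) = q" "nil_mult p (nil_mult (nil_inv p) q) = q"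
  "nil_mult (nil_mult q p) (nil_inv p) = q" "nil_mult (nil_mult q (nil_inv p)) p = q"
  "nil_mult 0 p = p" "nil_mult p 0 = p" "nil_inv (nil_inv p) = p"
  by (simp_all add: vec_eq_iff forall_3 algebra_simps)

lemma nil_inv_Nil_group: "inv\<^bsub>Nil_group\<^esub> p = nil_inv p"
  by (rule group.inv_equality[OF group_Nil_group]) (simp_all add: Nil_group_def)

lemma continuous_on_nil_mult [continuous_intros]:
  assumes "continuous_on S f" "continuous_on S g"
  shows "continuous_on S (\<lambda>x. nil_mult (f x) (g x))"
  unfolding nil_mult_def by (intro continuous_intros assms)

lemma continuous_on_nil_inv [continuous_intros]:
  assumes "continuous_on S f"
  shows "continuous_on S (\<lambda>x. nil_inv (f x))"
  unfolding nil_inv_def by (intro continuous_intros assms)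

lemma measurable_nil_mult [measurable]:
  "nil_mult a \<in> borel_measurable borel" "(\<lambda>p. nil_mult p b) \<in> borel_measurable borel"
  by (intro borel_measurable_continuous_onI continuous_intros)+

text \<open>The linear part is unipotent, so it has determinant 1. Left and right translations are
  both of this shape, which makes Lebesgue measure a two-sided Haar measure.\<close>

lemma distr_lborel_shear:
  fixes a b c \<alpha> \<beta> :: real
  defines "T \<equiv> \<lambda>p::real^3. (vector [p$1 + a, p$2 + b, p$3 + c + \<alpha> * p$1 + \<beta> * p$2] :: real^3)"
  shows "distr lborel borel T = lborel"
proof (rule lborel_eqI[symmetric])
  have T[measurable]: "T \<in> borel_measurable borel"
    unfolding T_def by (intro borel_measurable_continuous_onI continuous_intros)
  fix l u :: "real^3"
  assume lu: "\<And>b. b \<in> Basis \<Longrightarrow> l \<bullet> b \<le> u \<bullet> b"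
  \<comment> \<open>The inverse of \<open>T\<close> is \<open>q \<mapsto> v + L q\<close>, so
    preimages of boxes are translated linear images.\<close>
  define L where "L p = (vector [p$1, p$2, p$3 - \<alpha> * p$1 - \<beta> * p$2] :: real^3)" for p :: "real^3"
  define v where "v = (vector [-a, -b, -c + \<alpha> * a + \<beta> * b] :: real^3)"
  have lin: "linear L"
    by (rule linearI) (simp_all add: L_def vec_eq_iff forall_3 algebra_simps)
  have det: "det (matrix L) = 1"
    by (simp add: det_3 matrix_def L_def axis_def)
  have TL: "T (v + L q) = q" "v + L (T p) = p" for p q
    by (simp_all add: T_def v_def L_def vec_eq_iff forall_3 algebra_simps)
  have eq: "T -` box l u = (+) v ` (L ` box l u)"
  proof (intro equalityI subsetI)
    fix p assume "p \<in> T -` box l u"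
    then have "v + L (T p) \<in> (+) v ` (L ` box l u)" by blast
    then show "p \<in> (+) v ` (L ` box l u)" unfolding TL .
  qed (use TL(1) in auto)
  have m: "L ` box l u \<in> lmeasurable" "measure lebesgue (L ` box l u) = measure lebesgue (box l u)"
    using measurable_linear_image[OF lin, of "box l u"] measure_linear_image[OF lin, of "box l u"] det
    by auto
  have "emeasure (distr lborel borel T) (box l u) = emeasure lebesgue (T -` box l u)"
    using measurable_sets_borel[OF T, of "box l u"] by (subst emeasure_distr) auto
  also have "\<dots> = ennreal (measure lebesgue (T -` box l u))"
    unfolding eq using measurable_translation[OF m(1), of v] by (simp add: emeasure_eq_measure2 fmeasurableD2)
  also have "measure lebesgue (T -` box l u) = measure lebesgue (box l u)"
    unfolding eq using m by (simp add: measure_translation)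
  also have "ennreal \<dots> = emeasure lborel (box l u)"
    using emeasure_eq_measure2[of "box l u" lebesgue] emeasure_completion[of "box l u" "lborel :: (real^3) measure"]
    by simp
  also have "\<dots> = (\<Prod>b\<in>Basis. (u - l) \<bullet> b)"
    using lu by (subst emeasure_lborel_box) auto
  finally show "emeasure (distr lborel borel T) (box l u) = (\<Prod>b\<in>Basis. (u - l) \<bullet> b)" .
qed simp

lemma distr_lborel_nil_left: "distr lborel borel (nil_mult a) = lborel"
proof -
  have "nil_mult a = (\<lambda>p. vector [p$1 + a$1, p$2 + a$2, p$3 + a$3 + 0 * p$1 + a$1 * p$2])"
    by (auto simp: fun_eq_iff vec_eq_iff forall_3)
  then show ?thesis by (simp only: distr_lborel_shear)
qed

lemma distr_lborel_nil_right: "distr lborel borel (\<lambda>p. nil_mult p b) = lborel"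
proof -
  have "(\<lambda>p. nil_mult p b) = (\<lambda>p. vector [p$1 + b$1, p$2 + b$2, p$3 + b$3 + b$2 * p$1 + 0 * p$2])"
    by (auto simp: fun_eq_iff vec_eq_iff forall_3)
  then show ?thesis by (simp only: distr_lborel_shear)
qed

lemma nn_integral_nil_left:
  "f \<in> borel_measurable borel \<Longrightarrow> (\<integral>\<^sup>+p. f (nil_mult a p) \<partial>lborel) = (\<integral>\<^sup>+p. f p \<partial>lborel)"
  by (subst (2) distr_lborel_nil_left[of a, symmetric]) (simp add: nn_integral_distr)

lemma integral_nil_right:
  fixes f :: "real^3 \<Rightarrow> real"
  assumes [measurable]: "f \<in> borel_measurable borel"
  shows "(\<integral>p. f (nil_mult p b) \<partial>lborel) = (\<integral>p. f p \<partial>lborel)"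
  by (subst (2) distr_lborel_nil_right[of b, symmetric]) (simp add: integral_distr)

subsection \<open>Derivatives along the left-invariant frame\<close>

abbreviation nil_vec :: "3 \<Rightarrow> real^3 \<Rightarrow> real^3" where
  "nil_vec i p \<equiv> column i (nil_frame p)"

text \<open>Application of the left-invariant fields X, Y, Z. Unlike the coordinate partials they
  commute with left translations, so they act on functions on the quotient.\<close>

definition fr :: "3 \<Rightarrow> (real^3 \<Rightarrow> real) \<Rightarrow> real^3 \<Rightarrow> real" where
  "fr i f p = dd f p (nil_vec i p)"

lemma nil_vec_axis:
  "nil_vec 1 p = axis 1 1" "nil_vec 2 p = axis 2 1 + p$1 *\<^sub>R axis 3 1" "nil_vec 3 p = axis 3 1"
  by (simp_all add: column_def nil_frame_def vec_eq_iff forall_3 axis_def)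

text \<open>In these coordinates the flows of X, Y, Z are straight lines, and each flow is right
  multiplication by a one-parameter subgroup.\<close>

lemma nil_mult_right_axis: "nil_mult p (t *\<^sub>R axis i 1) = p + t *\<^sub>R nil_vec i p"
  using exhaust_3[of i] by (auto simp: vec_eq_iff forall_3 axis_def column_def nil_frame_def)

lemma nil_vec_flow: "nil_vec i (p + t *\<^sub>R nil_vec i p) = nil_vec i p"
  using exhaust_3[of i] by (auto simp: vec_eq_iff forall_3 axis_def column_def nil_frame_def)

lemma DERIV_flow:
  assumes "f differentiable at (p + t *\<^sub>R nil_vec i p)"
  shows "((\<lambda>t. f (p + t *\<^sub>R nil_vec i p)) has_real_derivative fr i f (p + t *\<^sub>R nil_vec i p)) (at t)"
  using dd_line[OF assms] by (simp add: fr_def nil_vec_flow)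

lemma fr_axis:
  assumes "f differentiable at p"
  shows "fr 1 f p = dd f p (axis 1 1)" "fr 3 f p = dd f p (axis 3 1)"
    "fr 2 f p = dd f p (axis 2 1) + p$1 * dd f p (axis 3 1)"
  using dd_linear[OF assms] by (simp_all add: fr_def nil_vec_axis linear_add linear_scale)

lemma fr_cong:
  assumes "open S" "p \<in> S" "\<And>y. y \<in> S \<Longrightarrow> f y = g y"
  shows "fr i f p = fr i g p"
  using dd_cong[OF assms] by (simp add: fr_def)

lemma fr_const [simp]: "fr i (\<lambda>x. c) p = 0"
  by (simp add: fr_def)

lemma fr_add: "f differentiable at x \<Longrightarrow> g differentiable at x \<Longrightarrow>
    fr i (\<lambda>x. f x + g x) x = fr i f x + fr i g x"
  by (simp add: fr_def dd_add)

lemma fr_diff: "f differentiable at x \<Longrightarrow> g differentiable at x \<Longrightarrow>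
    fr i (\<lambda>x. f x - g x) x = fr i f x - fr i g x"
  by (simp add: fr_def dd_diff)

lemma fr_mult: "f differentiable at x \<Longrightarrow> g differentiable at x \<Longrightarrow>
    fr i (\<lambda>x. f x * g x) x = f x * fr i g x + fr i f x * g x"
  by (simp add: fr_def dd_mult)

lemma fr_divide: "f differentiable at x \<Longrightarrow> g differentiable at x \<Longrightarrow> g x \<noteq> 0 \<Longrightarrow>
    fr i (\<lambda>x. f x / g x) x = (fr i f x * g x - f x * fr i g x) / (g x * g x)"
  by (simp add: fr_def dd_divide)

lemma fr_compose_real:
  "f differentiable at x \<Longrightarrow> (\<phi> has_real_derivative c) (at (f x)) \<Longrightarrow>
    fr i (\<lambda>x. \<phi> (f x)) x = c * fr i f x"
  by (simp add: fr_def dd_compose_real)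

lemma C1_fr_cont: "C1 S f \<Longrightarrow> continuous_on S (fr i f)"
proof -
  assume f: "C1 S f"
  note d = fr_axis[OF C1_diffD[OF f]]
  have "continuous_on S (fr 1 f)" "continuous_on S (fr 3 f)"
    by (rule continuous_on_eq[OF C1_dd_contD[OF f]], simp add: d)+
  moreover have "continuous_on S (fr 2 f)"
    by (rule continuous_on_eq[where f="\<lambda>p. dd f p (axis 2 1) + p$1 * dd f p (axis 3 1)"])
       (auto intro!: continuous_intros C1_dd_contD f simp: d)
  ultimately show ?thesis using exhaust_3[of i] by auto
qed

lemma C2_fr: 
  assumes S: "open S" and f: "C2 S f"
  shows "C1 S (fr i f)"
proof -
  note d = fr_axis[OF C1_diffD[OF C2_C1[OF f]]]
  have "C1 S (fr 1 f)" "C1 S (fr 3 f)"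
    by (rule C1_cong[OF S _ C2_dd[OF f]], simp add: d)+
  moreover have "C1 S (fr 2 f)"
    by (rule C1_cong[OF S, where f="\<lambda>p. dd f p (axis 2 1) + p$1 * dd f p (axis 3 1)"])
       (auto intro!: C1_add C1_mult C1_nth C2_dd f simp: d)
  ultimately show ?thesis using exhaust_3[of i] by auto
qed

text \<open>Second derivatives cancel by \<open>dd_commute\<close>. The only remainder arises when X
  differentiates the coefficient x of Y, which is the bracket [X, Y] = Z.\<close>

lemma fr_bracket:
  assumes S: "open S" "p \<in> S" and f: "C2 S f"
  shows "fr 1 (fr 2 f) p = fr 2 (fr 1 f) p + fr 3 f p"
    "fr 1 (fr 3 f) p = fr 3 (fr 1 f) p" "fr 2 (fr 3 f) p = fr 3 (fr 2 f) p"
proof -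
  note d = fr_axis[OF C1_diffD[OF C2_C1[OF f]]]
  note d1 = C1_diffD[OF C2_dd[OF f] S(2)]
  have e1: "dd (fr 1 f) p = dd (\<lambda>q. dd f q (axis 1 1)) p"
    "dd (fr 3 f) p = dd (\<lambda>q. dd f q (axis 3 1)) p"
    by (rule dd_cong[OF S], simp add: d)+
  have ax: "(axis 1 1 :: real^3) $ 1 = 1" "(axis 2 1 :: real^3) $ 1 = 0" "(axis 3 1 :: real^3) $ 1 = 0"
    by (simp_all add: axis_def)
  have [simp]: "(\<lambda>p::real^3. p $ 1) differentiable at p"
    using C1_diffD[OF C1_nth[of UNIV]] by simp
  have e2: "dd (fr 2 f) p v = dd (\<lambda>q. dd f q (axis 2 1)) p v + p$1 * dd (\<lambda>q. dd f q (axis 3 1)) p v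
      + v$1 * dd f p (axis 3 1)" for v
  proof -
    have "dd (fr 2 f) p = dd (\<lambda>p. dd f p (axis 2 1) + p$1 * dd f p (axis 3 1)) p"
      by (rule dd_cong[OF S], simp add: d)
    then show ?thesis by (simp add: dd_add dd_mult d1 dd_nth)
  qed
  have dif: "fr i f differentiable at p" for i
    using C1_diffD[OF C2_fr[OF S(1) f] S(2)] .
  note com = dd_commute[OF f S]
  have f1: "fr 1 (fr i f) p = dd (fr i f) p (axis 1 1)" "fr 3 (fr i f) p = dd (fr i f) p (axis 3 1)"
    "fr 2 (fr i f) p = dd (fr i f) p (axis 2 1) + p$1 * dd (fr i f) p (axis 3 1)" for i
    using fr_axis[OF dif] by blast+
  show "fr 1 (fr 2 f) p = fr 2 (fr 1 f) p + fr 3 f p"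
    unfolding f1 e2 e1 d(2)[OF S(2)]
    by (simp only: com[of "axis 2 1" "axis 1 1"] com[of "axis 3 1" "axis 1 1"] ax mult_1)
  show "fr 1 (fr 3 f) p = fr 3 (fr 1 f) p"
    unfolding f1 e1 by (rule com)
  show "fr 2 (fr 3 f) p = fr 3 (fr 2 f) p"
    unfolding f1 e2 e1
    by (simp only: com[of "axis 3 1" "axis 2 1"] ax mult_zero_left add_0_right)
qed


subsection \<open>Nil-manifolds: fundamental domains and Stokes' theorem\<close>

lemma fundamental_domain_ex1:
  "fundamental_domain G D \<Longrightarrow> \<exists>!q. q \<in> D \<and> q \<in> orbit G p"
  by (simp add: fundamental_domain_def)

locale nil_quotient =
  fixes \<Gamma> :: "(real^3) set"
  assumes lattice: "nil_lattice \<Gamma>"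
begin

lemma zero_in: "0 \<in> \<Gamma>"
  using lattice subgroup.one_closed[of \<Gamma> Nil_group] by (simp add: nil_lattice_def Nil_group_def)

lemma mult_in: "a \<in> \<Gamma> \<Longrightarrow> b \<in> \<Gamma> \<Longrightarrow> nil_mult a b \<in> \<Gamma>"
  using lattice subgroup.m_closed[of \<Gamma> Nil_group a b] by (simp add: nil_lattice_def Nil_group_def)

lemma inv_in: "a \<in> \<Gamma> \<Longrightarrow> nil_inv a \<in> \<Gamma>"
  using lattice subgroup.m_inv_closed[of \<Gamma> Nil_group a] by (simp add: nil_lattice_def nil_inv_Nil_group)

lemma countable_lattice: "countable \<Gamma>"
  using lattice by (simp add: nil_lattice_def countable_discrete)

lemma orbit_iff: "q \<in> orbit (left_translations \<Gamma>) p \<longleftrightarrow> (\<exists>\<gamma>\<in>\<Gamma>. q = nil_mult \<gamma> p)"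
  by (auto simp: orbit_def left_translations_def)

text \<open>The group element is recovered continuously from \<open>u\<close> and its translate;
  near the diagonal point \<open>(p, p)\<close> it lies close to 0, where discreteness leaves only
  0. So the action is free and properly discontinuous.\<close>

lemma inj_nbhd: "\<exists>U. open U \<and> p \<in> U \<and> (\<forall>u\<in>U. \<forall>\<gamma>\<in>\<Gamma>. nil_mult \<gamma> u \<in> U \<longrightarrow> \<gamma> = 0)"
proof -
  have "0 isolated_in \<Gamma>"
    using lattice zero_in by (simp add: nil_lattice_def discrete_def)
  then obtain T where T: "open T" "T \<inter> \<Gamma> = {0}"
    by (rule isolated_inE)
  define W where "W = (\<lambda>z. nil_mult (snd z) (nil_inv (fst z))) -` T"
  have "open W"
    unfolding W_def
    by (rule open_vimage[OF T(1)]) (intro continuous_intros)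
  moreover have "(p, p) \<in> W" using T(2) by (auto simp: W_def)
  ultimately obtain A B where AB: "open A" "open B" "p \<in> A" "p \<in> B" "A \<times> B \<subseteq> W"
    by (auto elim: open_prod_elim)
  have "\<gamma> = 0" if "u \<in> A \<inter> B" "\<gamma> \<in> \<Gamma>" "nil_mult \<gamma> u \<in> A \<inter> B" for u \<gamma>
  proof -
    have "(u, nil_mult \<gamma> u) \<in> W" using AB(5) that by blast
    then have "\<gamma> \<in> T" by (simp add: W_def)
    then show ?thesis using T(2) that(2) by blast
  qed
  then show ?thesis
    using AB by (intro exI[of _ "A \<inter> B"]) auto
qed

text \<open>Countably many open sets that inject into the quotient cover the space. From each, keep
  the points whose orbit misses all earlier sets: an orbit is then represented exactly once, in the
  first set that it meets. Without such a set the choice in \<open>quotient_integral\<close> would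
  be arbitrary.\<close>

lemma ex_fundamental_domain: "\<exists>D. fundamental_domain (left_translations \<Gamma>) D"
proof -
  define \<F> where "\<F> = {U. open U \<and> (\<forall>u\<in>U. \<forall>\<gamma>\<in>\<Gamma>. nil_mult \<gamma> u \<in> U \<longrightarrow> \<gamma> = 0)}"
  have "\<And>S. S \<in> \<F> \<Longrightarrow> open S" by (simp add: \<F>_def)
  then obtain \<F>' where \<F>': "\<F>' \<subseteq> \<F>" "countable \<F>'" "\<Union>\<F>' = \<Union>\<F>"
    by (rule Lindelof)
  have "\<Union>\<F> = UNIV" using inj_nbhd unfolding \<F>_def by blast
  then have cover: "\<Union>\<F>' = UNIV" using \<F>'(3) by simp
  then have "\<F>' \<noteq> {}" by auto
  define F where "F = from_nat_into \<F>'"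
  have F: "F n \<in> \<F>" for n
    using from_nat_into[OF \<open>\<F>' \<noteq> {}\<close>] \<F>'(1) by (auto simp: F_def)
  have cov: "\<exists>n. p \<in> F n" for p
  proof -
    obtain U where "U \<in> \<F>'" "p \<in> U" using cover by blast
    then show ?thesis
      unfolding F_def using from_nat_into_surj[OF \<F>'(2)] by metis
  qed
  define sat where "sat V = (\<Union>\<gamma>\<in>\<Gamma>. nil_mult \<gamma> -` V)" for V :: "(real^3) set"
  have sat: "p \<in> sat V \<longleftrightarrow> (\<exists>\<gamma>\<in>\<Gamma>. nil_mult \<gamma> p \<in> V)" for p V
    by (auto simp: sat_def)
  have open_sat: "open (sat V)" if "open V" for V
    unfolding sat_def
    by (intro open_UN ballI open_vimage[OF that] continuous_intros)
  have openF: "open (F n)" for n using F by (simp add: \<F>_def)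
  define D where "D = (\<Union>n. F n - (\<Union>m<n. sat (F m)))"
  have sat_move: "nil_mult \<gamma> p \<in> sat V \<longleftrightarrow> p \<in> sat V" if "\<gamma> \<in> \<Gamma>" for \<gamma> p V
  proof
    assume "nil_mult \<gamma> p \<in> sat V"
    then obtain \<delta> where "\<delta> \<in> \<Gamma>" "nil_mult \<delta> (nil_mult \<gamma> p) \<in> V" by (auto simp: sat)
    then show "p \<in> sat V" using mult_in that by (auto simp: sat nil_mult_assoc[symmetric])
  next
    assume "p \<in> sat V"
    then obtain \<delta> where "\<delta> \<in> \<Gamma>" "nil_mult \<delta> p \<in> V" by (auto simp: sat)
    then have "nil_mult (nil_mult \<delta> (nil_inv \<gamma>)) (nil_mult \<gamma> p) \<in> V"
      by (simp add: nil_mult_assoc)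
    then show "nil_mult \<gamma> p \<in> sat V"
      using \<open>\<delta> \<in> \<Gamma>\<close> that mult_in inv_in unfolding sat by blast
  qed
  have "fundamental_domain (left_translations \<Gamma>) D"
    unfolding fundamental_domain_def
  proof (intro conjI allI)
    show "D \<in> sets borel"
      unfolding D_def using openF open_sat by (intro sets.countable_UN' sets.Diff) auto
    fix p
    obtain k where "p \<in> F k" using cov by blast
    then have "p \<in> sat (F k)" using zero_in unfolding sat by (intro bexI[of _ 0]) auto
    define n where "n = (LEAST n. p \<in> sat (F n))"
    have n: "p \<in> sat (F n)" and min: "\<And>m. m < n \<Longrightarrow> p \<notin> sat (F m)"
      unfolding n_def using LeastI[of "\<lambda>n. p \<in> sat (F n)", OF \<open>p \<in> sat (F k)\<close>]
      by (auto dest: not_less_Least)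
    obtain \<gamma> where \<gamma>: "\<gamma> \<in> \<Gamma>" "nil_mult \<gamma> p \<in> F n" using n by (auto simp: sat)
    \<comment> \<open>Both \<open>p\<close> and \<open>q\<close> lie in the same saturations, so
      \<open>q\<close> was kept at the same index \<open>n\<close>; injectivity of
      \<open>F n\<close> then identifies it with the chosen representative.\<close>
    have orb: "q = nil_mult \<gamma> p" if q: "q \<in> D" "\<delta> \<in> \<Gamma>" "q = nil_mult \<delta> p" for q \<delta>
    proof -
      obtain k where k: "q \<in> F k" "\<And>m. m < k \<Longrightarrow> q \<notin> sat (F m)" using q(1) by (auto simp: D_def)
      have "q \<in> sat (F k)" using k(1) zero_in unfolding sat by (intro bexI[of _ 0]) auto
      then have "p \<in> sat (F k)" using sat_move q by blast
      then have "\<not> k < n" using min by blast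
      moreover have "q \<in> sat (F n)" using sat_move q n by blast
      then have "\<not> n < k" using k(2) by blast
      ultimately have "k = n" by simp
      have e: "nil_mult (nil_mult \<gamma> (nil_inv \<delta>)) q = nil_mult \<gamma> p"
        by (simp add: q(3) nil_mult_assoc)
      have "nil_mult \<gamma> (nil_inv \<delta>) \<in> \<Gamma>" using mult_in inv_in \<gamma> q by blast
      moreover have "nil_mult (nil_mult \<gamma> (nil_inv \<delta>)) q \<in> F n" unfolding e by (rule \<gamma>)
      moreover have "q \<in> F n" using k(1) \<open>k = n\<close> by simp
      moreover have "\<forall>u\<in>F n. \<forall>\<gamma>\<in>\<Gamma>. nil_mult \<gamma> u \<in> F n \<longrightarrow> \<gamma> = 0"
        using F[of n] by (simp add: \<F>_def)
      ultimately have "nil_mult \<gamma> (nil_inv \<delta>) = 0" by blast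
      then show ?thesis using e by simp
    qed
    have "nil_mult \<gamma> p \<notin> sat (F m)" if "m < n" for m
      using min[OF that] sat_move[OF \<gamma>(1)] by blast
    then have "nil_mult \<gamma> p \<in> F n - (\<Union>m<n. sat (F m))"
      using \<gamma>(2) by simp
    then have "nil_mult \<gamma> p \<in> D"
      unfolding D_def by (rule UN_I[OF UNIV_I])
    then show "\<exists>!q. q \<in> D \<and> q \<in> orbit (left_translations \<Gamma>) p"
      unfolding orbit_iff using orb \<gamma>(1) by (intro ex1I[of _ "nil_mult \<gamma> p"] conjI bexI[of _ \<gamma>] refl; blast)
  qed
  then show ?thesis ..
qed

definition fdom :: "(real^3) set" where
  "fdom = (SOME D. fundamental_domain (left_translations \<Gamma>) D)"

lemma fundamental_domain_fdom: "fundamental_domain (left_translations \<Gamma>) fdom"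
  unfolding fdom_def using ex_fundamental_domain by (rule someI_ex)

lemma fdom_borel [measurable]: "fdom \<in> sets borel"
  using fundamental_domain_fdom by (simp add: fundamental_domain_def)

text \<open>The orbit meets \<open>D\<close> once, and right cancellation shows that only one group
  element carries \<open>p\<close> there.\<close>

lemma nn_integral_orbit_indicator:
  assumes "fundamental_domain (left_translations \<Gamma>) D"
  shows "(\<integral>\<^sup>+\<gamma>. indicator D (nil_mult \<gamma> p) \<partial>count_space \<Gamma>) = (1::ennreal)"
proof -
  obtain q where q': "q \<in> D \<and> q \<in> orbit (left_translations \<Gamma>) p"
      and q'': "\<forall>r. r \<in> D \<and> r \<in> orbit (left_translations \<Gamma>) p \<longrightarrow> r = q"
    using fundamental_domain_ex1[OF assms] by (rule ex1E)
  have q: "q \<in> D" "q \<in> orbit (left_translations \<Gamma>) p"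
    using q' by simp_all
  have uniq: "r = q" if "r \<in> D" "r \<in> orbit (left_translations \<Gamma>) p" for r
    using q'' that by blast
  obtain \<gamma>0 where g0: "\<gamma>0 \<in> \<Gamma>" "q = nil_mult \<gamma>0 p"
    using q(2) unfolding orbit_iff by (elim bexE)
  have "indicator D (nil_mult \<gamma> p) = (indicator {\<gamma>0} \<gamma> :: ennreal)" if "\<gamma> \<in> \<Gamma>" for \<gamma>
  proof -
    have "\<gamma> = \<gamma>0" if "nil_mult \<gamma> p \<in> D"
    proof -
      have "nil_mult \<gamma> p = nil_mult \<gamma>0 p"
        using uniq[OF that] \<open>\<gamma> \<in> \<Gamma>\<close> g0 by (auto simp: orbit_iff)
      then have "nil_mult (nil_mult \<gamma> p) (nil_inv p) = nil_mult (nil_mult \<gamma>0 p) (nil_inv p)"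
        by simp
      then show ?thesis by simp
    qed
    then have "nil_mult \<gamma> p \<in> D \<longleftrightarrow> \<gamma> \<in> {\<gamma>0}"
      using q(1) unfolding g0(2) by blast
    then show ?thesis by (simp only: indicator_def)
  qed
  then have "(\<integral>\<^sup>+\<gamma>. indicator D (nil_mult \<gamma> p) \<partial>count_space \<Gamma>) =
      (\<integral>\<^sup>+\<gamma>. indicator {\<gamma>0} \<gamma> \<partial>count_space \<Gamma>)"
    by (intro nn_integral_cong) simp
  also have "\<dots> = 1"
    using g0 by (subst nn_integral_indicator) (auto simp: emeasure_count_space_finite)
  finally show ?thesis .
qed

definition invariant :: "(real^3 \<Rightarrow> 'b) \<Rightarrow> bool" where
  "invariant f \<longleftrightarrow> (\<forall>\<gamma>\<in>\<Gamma>. \<forall>p. f (nil_mult \<gamma> p) = f p)"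

lemma invariantD: "invariant f \<Longrightarrow> \<gamma> \<in> \<Gamma> \<Longrightarrow> f (nil_mult \<gamma> p) = f p"
  by (simp add: invariant_def)

text \<open>The unfolding trick: insert the constant 1 as a sum of indicators of translates of
  \<open>D\<close>, exchange sum and integral, and translate back. Used with \<open>A\<close>
  another fundamental domain and with \<open>A\<close> a ball.\<close>

lemma nn_integral_unfold:
  fixes f :: "real^3 \<Rightarrow> ennreal"
  assumes D: "fundamental_domain (left_translations \<Gamma>) D" and f: "invariant f"
    and [measurable]: "f \<in> borel_measurable borel" "A \<in> sets borel"
  shows "(\<integral>\<^sup>+p. indicator A p * f p \<partial>lborel) =
    (\<integral>\<^sup>+p. indicator D p * f p * (\<integral>\<^sup>+\<gamma>. indicator A (nil_mult \<gamma> p) \<partial>count_space \<Gamma>) \<partial>lborel)"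
proof -
  have [measurable]: "D \<in> sets borel" using D by (simp add: fundamental_domain_def)
  have inv: "(\<integral>\<^sup>+\<gamma>. indicator D (nil_mult (nil_inv \<gamma>) p) \<partial>count_space \<Gamma>) =
      (\<integral>\<^sup>+\<gamma>. indicator D (nil_mult \<gamma> p) \<partial>count_space \<Gamma> :: ennreal)" for p
    by (rule nn_integral_bij_count_space[where g="nil_inv"])
       (auto intro!: bij_betwI[where g="nil_inv"] inv_in)
  have "(\<integral>\<^sup>+p. indicator D p * f p * (\<integral>\<^sup>+\<gamma>. indicator A (nil_mult \<gamma> p) \<partial>count_space \<Gamma>) \<partial>lborel) =
      (\<integral>\<^sup>+p. (\<integral>\<^sup>+\<gamma>. indicator D p * f p * indicator A (nil_mult \<gamma> p) \<partial>count_space \<Gamma>) \<partial>lborel)"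
    by (simp add: nn_integral_cmult)
  also have "\<dots> = (\<integral>\<^sup>+\<gamma>. (\<integral>\<^sup>+p. indicator D p * f p * indicator A (nil_mult \<gamma> p) \<partial>lborel) \<partial>count_space \<Gamma>)"
    by (intro nn_integral_count_space_nn_integral countable_lattice) simp
  also have "\<dots> = (\<integral>\<^sup>+\<gamma>. (\<integral>\<^sup>+p. indicator D (nil_mult (nil_inv \<gamma>) p) * f p * indicator A p \<partial>lborel) \<partial>count_space \<Gamma>)"
  proof (rule nn_integral_cong)
    fix \<gamma> assume "\<gamma> \<in> space (count_space \<Gamma>)"
    then have \<gamma>: "\<gamma> \<in> \<Gamma>" by simp
    have "(\<integral>\<^sup>+p. indicator D p * f p * indicator A (nil_mult \<gamma> p) \<partial>lborel) =
        (\<integral>\<^sup>+p. (\<lambda>q. indicator D (nil_mult (nil_inv \<gamma>) q) * f q * indicator A q) (nil_mult \<gamma> p) \<partial>lborel)"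
      by (simp add: invariantD[OF f \<gamma>])
    also have "\<dots> = (\<integral>\<^sup>+q. indicator D (nil_mult (nil_inv \<gamma>) q) * f q * indicator A q \<partial>lborel)"
      by (rule nn_integral_nil_left) simp
    finally show "(\<integral>\<^sup>+p. indicator D p * f p * indicator A (nil_mult \<gamma> p) \<partial>lborel) =
        (\<integral>\<^sup>+q. indicator D (nil_mult (nil_inv \<gamma>) q) * f q * indicator A q \<partial>lborel)" .
  qed
  also have "\<dots> = (\<integral>\<^sup>+p. (\<integral>\<^sup>+\<gamma>. indicator D (nil_mult (nil_inv \<gamma>) p) * f p * indicator A p \<partial>count_space \<Gamma>) \<partial>lborel)"
    by (intro nn_integral_count_space_nn_integral[symmetric] countable_lattice) simp
  also have "\<dots> = (\<integral>\<^sup>+p. indicator A p * f p \<partial>lborel)"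
  proof (rule nn_integral_cong)
    fix p
    have "(\<integral>\<^sup>+\<gamma>. indicator D (nil_mult (nil_inv \<gamma>) p) * f p * indicator A p \<partial>count_space \<Gamma>) =
        (\<integral>\<^sup>+\<gamma>. (f p * indicator A p) * indicator D (nil_mult (nil_inv \<gamma>) p) \<partial>count_space \<Gamma>)"
      by (rule nn_integral_cong) (simp only: mult_ac)
    also have "\<dots> = f p * indicator A p"
      by (subst nn_integral_cmult) (simp_all add: inv nn_integral_orbit_indicator[OF D])
    finally show "(\<integral>\<^sup>+\<gamma>. indicator D (nil_mult (nil_inv \<gamma>) p) * f p * indicator A p \<partial>count_space \<Gamma>) =
        indicator A p * f p" by (simp only: mult.commute)
  qed
  finally show ?thesis by simp
qed

lemma nn_integral_domain_indep:
  fixes f :: "real^3 \<Rightarrow> ennreal"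
  assumes D: "fundamental_domain (left_translations \<Gamma>) D" "fundamental_domain (left_translations \<Gamma>) D'"
    and f: "invariant f" "f \<in> borel_measurable borel"
  shows "(\<integral>\<^sup>+p. indicator D' p * f p \<partial>lborel) = (\<integral>\<^sup>+p. indicator D p * f p \<partial>lborel)"
proof -
  have "D' \<in> sets borel" using D(2) by (simp add: fundamental_domain_def)
  then show ?thesis
    by (subst nn_integral_unfold[OF D(1) f]) (simp_all add: nn_integral_orbit_indicator[OF D(2)])
qed

text \<open>The images of the balls about 0 form an increasing open cover of the compact quotient,
  so one of them suffices.\<close>

lemma ex_compact_cover: "\<exists>r. \<forall>p. \<exists>\<gamma>\<in>\<Gamma>. nil_mult \<gamma> p \<in> cball 0 r"
proof -
  let ?G = "left_translations \<Gamma>"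
  define U where "U n = orbit ?G ` ball 0 (real n)" for n
  have self: "p \<in> orbit ?G p" for p
    unfolding orbit_iff using zero_in by (intro bexI[of _ 0]) simp_all
  have orbit_eq: "orbit ?G p = orbit ?G q \<longleftrightarrow> (\<exists>\<gamma>\<in>\<Gamma>. q = nil_mult \<gamma> p)" for p q
  proof
    assume "orbit ?G p = orbit ?G q"
    then show "\<exists>\<gamma>\<in>\<Gamma>. q = nil_mult \<gamma> p" using self[of q] orbit_iff by blast
  next
    assume "\<exists>\<gamma>\<in>\<Gamma>. q = nil_mult \<gamma> p"
    then obtain \<gamma> where \<gamma>: "\<gamma> \<in> \<Gamma>" "q = nil_mult \<gamma> p" by blast
    have "nil_mult \<delta> p = nil_mult (nil_mult \<delta> (nil_inv \<gamma>)) q" for \<delta>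
      by (simp add: \<gamma> nil_mult_assoc)
    moreover have "nil_mult \<delta> q = nil_mult (nil_mult \<delta> \<gamma>) p" for \<delta>
      by (simp add: \<gamma> nil_mult_assoc)
    ultimately have "r \<in> orbit ?G p \<longleftrightarrow> r \<in> orbit ?G q" for r
      unfolding orbit_iff using mult_in inv_in \<gamma>(1) by metis
    then show "orbit ?G p = orbit ?G q" by blast
  qed
  have pre: "{p. orbit ?G p \<in> U n} = (\<Union>\<gamma>\<in>\<Gamma>. nil_mult \<gamma> -` ball 0 (real n))" for n
    unfolding U_def image_iff orbit_eq by (auto simp: Bex_def)
  have "openin (quotient_space ?G) (U n)" for n
    unfolding openin_quotient_space pre
    by (auto simp: U_def intro!: open_UN open_vimage continuous_intros)
  moreover have top: "topspace (quotient_space ?G) = range (orbit ?G)"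
    unfolding topspace_def openin_quotient_space
    by (auto intro!: exI[of _ "range (orbit ?G)"])
  moreover have "\<Union>(range U) = range (orbit ?G)"
  proof -
    have "orbit ?G p \<in> \<Union>(range U)" for p
    proof -
      obtain n where "norm p < real n" using reals_Archimedean2 by blast
      then have "orbit ?G p \<in> U n" by (auto simp: U_def)
      then show ?thesis by blast
    qed
    then show ?thesis by (auto simp: U_def)
  qed
  ultimately obtain \<F> where \<F>: "finite \<F>" "\<F> \<subseteq> range U" "\<Union>\<F> = range (orbit ?G)"
    using lattice unfolding nil_lattice_def compact_space by (metis (no_types, lifting) rangeE)
  then obtain N where N: "finite N" "\<F> = U ` N"
    by (meson finite_subset_image subset_UNIV)
  define n where "n = Max (insert 0 N)"
  have le: "k \<le> n" if "k \<in> N" for k unfolding n_def using N that by simp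
  have "\<exists>\<gamma>\<in>\<Gamma>. nil_mult \<gamma> p \<in> cball 0 (real n)" for p
  proof -
    obtain k where k: "k \<in> N" "orbit ?G p \<in> U k" using \<F>(3) N by blast
    then obtain \<gamma> where "\<gamma> \<in> \<Gamma>" "nil_mult \<gamma> p \<in> ball 0 (real k)" using pre[of k] by blast
    then show ?thesis using le[OF k(1)] by (intro bexI[of _ \<gamma>]) auto
  qed
  then show ?thesis by blast
qed

lemma bounded_invariant:
  fixes f :: "real^3 \<Rightarrow> real"
  assumes "invariant f" "continuous_on UNIV f"
  obtains M where "\<And>p. \<bar>f p\<bar> \<le> M"
proof -
  obtain r where r: "\<And>p. \<exists>\<gamma>\<in>\<Gamma>. nil_mult \<gamma> p \<in> cball 0 r" using ex_compact_cover by blast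
  have "compact (f ` cball 0 r)"
    by (intro compact_continuous_image continuous_on_subset[OF assms(2)]) auto
  then obtain M where M: "\<And>y. y \<in> f ` cball 0 r \<Longrightarrow> norm y \<le> M"
    using compact_imp_bounded bounded_iff by metis
  have "\<bar>f p\<bar> \<le> M" for p
  proof -
    obtain \<gamma> where "\<gamma> \<in> \<Gamma>" "nil_mult \<gamma> p \<in> cball 0 r" using r by blast
    then show ?thesis using M[of "f (nil_mult \<gamma> p)"] invariantD[OF assms(1), of \<gamma> p] imageI by (metis real_norm_def)
  qed
  then show ?thesis by (rule that)
qed

text \<open>Every orbit enters a fixed ball at least once, so unfolding bounds the volume of
  \<open>fdom\<close> by that of the ball even if \<open>fdom\<close> itself is unbounded.\<close>

lemma finite_fdom: "emeasure lborel fdom < \<infinity>"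
proof -
  obtain r where r: "\<And>p. \<exists>\<gamma>\<in>\<Gamma>. nil_mult \<gamma> p \<in> cball 0 r" using ex_compact_cover by blast
  have one: "1 \<le> (\<integral>\<^sup>+\<gamma>. indicator (cball 0 r) (nil_mult \<gamma> p) \<partial>count_space \<Gamma> :: ennreal)" for p
  proof -
    obtain \<gamma> where \<gamma>: "\<gamma> \<in> \<Gamma>" "nil_mult \<gamma> p \<in> cball 0 r" using r by blast
    have "(1::ennreal) = (\<integral>\<^sup>+\<delta>. indicator {\<gamma>} \<delta> \<partial>count_space \<Gamma>)"
      using \<gamma>(1) by (subst nn_integral_indicator) (auto simp: emeasure_count_space_finite)
    also have "\<dots> \<le> (\<integral>\<^sup>+\<gamma>. indicator (cball 0 r) (nil_mult \<gamma> p) \<partial>count_space \<Gamma>)"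
      using \<gamma>(2) by (intro nn_integral_mono) (auto simp: indicator_def)
    finally show ?thesis .
  qed
  have "emeasure lborel fdom = (\<integral>\<^sup>+p. indicator fdom p * 1 \<partial>lborel)"
    by simp
  also have "\<dots> \<le> (\<integral>\<^sup>+p. indicator fdom p * 1 *
      (\<integral>\<^sup>+\<gamma>. indicator (cball 0 r) (nil_mult \<gamma> p) \<partial>count_space \<Gamma>) \<partial>lborel)"
    using one by (intro nn_integral_mono) (auto simp: indicator_def)
  also have "\<dots> = (\<integral>\<^sup>+p. indicator (cball (0::real^3) r) p * 1 \<partial>lborel)"
    by (rule nn_integral_unfold[OF fundamental_domain_fdom, where f="\<lambda>_. 1", symmetric])
       (auto simp: invariant_def)
  also have "\<dots> = emeasure lborel (cball (0::real^3) r)" by simp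
  also have "\<dots> < \<infinity>" using emeasure_bounded_finite bounded_cball by blast
  finally show ?thesis .
qed

lemma integrable_fdom:
  fixes f :: "real^3 \<Rightarrow> real"
  assumes [measurable]: "f \<in> borel_measurable borel" and M: "\<And>p. \<bar>f p\<bar> \<le> M"
  shows "integrable lborel (\<lambda>p. indicator fdom p * f p)"
proof (rule Bochner_Integration.integrable_bound)
  show "integrable lborel (\<lambda>p. M * indicator fdom p)"
    using finite_fdom by (intro integrable_mult_right integrable_real_indicator) auto
  show "AE p in lborel. norm (indicator fdom p * f p) \<le> norm (M * indicator fdom p)"
    using M order_trans[OF M abs_ge_self[of M]] by (auto simp: indicator_def abs_mult)
qed simp

text \<open>Positive part, negative part and absolute value are each covered by the nonnegative
  case; the last supplies integrability over \<open>D\<close>. It is applied to right translates of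
  \<open>fdom\<close>.\<close>

lemma integral_domain_indep:
  fixes f :: "real^3 \<Rightarrow> real"
  assumes D: "fundamental_domain (left_translations \<Gamma>) D"
    and f: "invariant f" and [measurable]: "f \<in> borel_measurable borel" and M: "\<And>p. \<bar>f p\<bar> \<le> M"
  shows "(\<integral>p. indicator D p * f p \<partial>lborel) = (\<integral>p. indicator fdom p * f p \<partial>lborel)"
proof -
  have [measurable]: "D \<in> sets borel" using D by (simp add: fundamental_domain_def)
  have eq: "(\<integral>\<^sup>+p. ennreal (indicator D p * g p) \<partial>lborel) = (\<integral>\<^sup>+p. ennreal (indicator fdom p * g p) \<partial>lborel)"
    if "invariant g" and [measurable]: "g \<in> borel_measurable borel" for g :: "real^3 \<Rightarrow> real"
  proof -
    have "ennreal (indicator A p * g p) = indicator A p * ennreal (g p)" for A p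
      by (auto simp: indicator_def)
    moreover have "invariant (\<lambda>p. ennreal (g p))" using that by (simp add: invariant_def)
    ultimately show ?thesis using nn_integral_domain_indep[OF fundamental_domain_fdom D, of "\<lambda>p. ennreal (g p)"]
      by simp
  qed
  note int = integrable_fdom[OF assms(3) M]
  have "invariant (\<lambda>p. - f p)" "invariant (\<lambda>p. \<bar>f p\<bar>)" using f by (auto simp: invariant_def)
  note eqs = eq[OF f] eq[OF this(1)] eq[OF this(2)]
  have "(\<integral>\<^sup>+p. ennreal (norm (indicator D p * f p)) \<partial>lborel) < \<infinity>"
    using int eqs(3) by (simp add: integrable_iff_bounded abs_mult)
  then have int': "integrable lborel (\<lambda>p. indicator D p * f p)"
    by (simp add: integrable_iff_bounded)
  show ?thesis
    unfolding real_lebesgue_integral_def[OF int] real_lebesgue_integral_def[OF int']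
    using eqs by simp
qed

text \<open>Right multiplication commutes with the left action, so it permutes orbits.\<close>

lemma fundamental_domain_right:
  assumes "fundamental_domain (left_translations \<Gamma>) D"
  shows "fundamental_domain (left_translations \<Gamma>) {q. nil_mult q b \<in> D}"
  unfolding fundamental_domain_def
proof (intro conjI allI)
  have [measurable]: "D \<in> sets borel" using assms by (simp add: fundamental_domain_def)
  show "{q. nil_mult q b \<in> D} \<in> sets borel" by measurable
  fix p
  obtain r where r': "r \<in> D \<and> r \<in> orbit (left_translations \<Gamma>) (nil_mult p b)"
      and r'': "\<forall>q. q \<in> D \<and> q \<in> orbit (left_translations \<Gamma>) (nil_mult p b) \<longrightarrow> q = r"
    using fundamental_domain_ex1[OF assms] by (rule ex1E)
  have r: "r \<in> D" "r \<in> orbit (left_translations \<Gamma>) (nil_mult p b)"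
    using r' by simp_all
  have u: "q = r" if "q \<in> D" "q \<in> orbit (left_translations \<Gamma>) (nil_mult p b)" for q
    using r'' that by blast
  show "\<exists>!q. q \<in> {q. nil_mult q b \<in> D} \<and> q \<in> orbit (left_translations \<Gamma>) p"
  proof (rule ex1I[of _ "nil_mult r (nil_inv b)"])
    show "nil_mult r (nil_inv b) \<in> {q. nil_mult q b \<in> D} \<and> nil_mult r (nil_inv b) \<in> orbit (left_translations \<Gamma>) p"
      using r by (auto simp: orbit_iff nil_mult_assoc)
    fix q assume "q \<in> {q. nil_mult q b \<in> D} \<and> q \<in> orbit (left_translations \<Gamma>) p"
    then have "nil_mult q b = r"
      by (intro u) (auto simp: orbit_iff nil_mult_assoc)
    then show "q = nil_mult r (nil_inv b)" by auto
  qed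
qed

lemma integral_dom_right:
  fixes f :: "real^3 \<Rightarrow> real"
  assumes f: "invariant f" and [measurable]: "f \<in> borel_measurable borel" and M: "\<And>p. \<bar>f p\<bar> \<le> M"
  shows "(\<integral>p. indicator fdom p * f (nil_mult p b) \<partial>lborel) = (\<integral>p. indicator fdom p * f p \<partial>lborel)"
proof -
  let ?D = "{q. nil_mult q (nil_inv b) \<in> fdom}"
  have "(\<integral>p. indicator fdom p * f (nil_mult p b) \<partial>lborel) =
      (\<integral>p. (\<lambda>q. indicator ?D q * f q) (nil_mult p b) \<partial>lborel)"
    by (simp add: indicator_def)
  also have "\<dots> = (\<integral>p. indicator ?D p * f p \<partial>lborel)"
    by (rule integral_nil_right) simp
  also have "\<dots> = (\<integral>p. indicator fdom p * f p \<partial>lborel)"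
    by (rule integral_domain_indep[OF fundamental_domain_right[OF fundamental_domain_fdom] f _ M]) simp
  finally show ?thesis .
qed

text \<open>The flow acts on the right, so difference quotients along it do not see a left
  translation. Differentiability is assumed only at the two points, so that chart coordinates are
  covered.\<close>

lemma fr_translate:
  assumes f: "invariant f" and \<gamma>: "\<gamma> \<in> \<Gamma>"
    and d: "f differentiable at p" "f differentiable at (nil_mult \<gamma> p)"
  shows "fr i f (nil_mult \<gamma> p) = fr i f p"
proof -
  have "((\<lambda>t. f (nil_mult \<gamma> p + t *\<^sub>R nil_vec i (nil_mult \<gamma> p))) has_real_derivative fr i f (nil_mult \<gamma> p)) (at 0)"
    using DERIV_flow[of f "nil_mult \<gamma> p" 0 i] d(2) by simp
  moreover have "f (nil_mult \<gamma> p + t *\<^sub>R nil_vec i (nil_mult \<gamma> p)) = f (p + t *\<^sub>R nil_vec i p)" for t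
    by (simp add: nil_mult_right_axis[symmetric] nil_mult_assoc invariantD[OF f \<gamma>])
  ultimately have "((\<lambda>t. f (p + t *\<^sub>R nil_vec i p)) has_real_derivative fr i f (nil_mult \<gamma> p)) (at 0)"
    by simp
  moreover have "((\<lambda>t. f (p + t *\<^sub>R nil_vec i p)) has_real_derivative fr i f p) (at 0)"
    using DERIV_flow[of f p 0 i] d(1) by simp
  ultimately show ?thesis by (rule DERIV_unique)
qed

lemma invariant_fr: "invariant f \<Longrightarrow> (\<And>p. f differentiable at p) \<Longrightarrow> invariant (fr i f)"
  unfolding invariant_def[of "fr i f"] using fr_translate by blast

text \<open>Stokes' theorem without a boundary: the integral of \<open>f\<close> is unchanged by the
  flow, which is right translation, so the integrated difference quotients are all 0. Dominated
  convergence passes this to the derivative.\<close>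

lemma integral_fr_eq_0:
  assumes f: "invariant f" and C1: "C1 UNIV f"
  shows "(\<integral>p. indicator fdom p * fr i f p \<partial>lborel) = 0"
proof -
  have dif: "f differentiable at p" for p using C1_diffD[OF C1] by simp
  have cont: "continuous_on UNIV f" "continuous_on UNIV (fr i f)"
    using C1_contD[OF C1] C1_fr_cont[OF C1] by auto
  then have [measurable]: "f \<in> borel_measurable borel" "fr i f \<in> borel_measurable borel"
    by (auto intro: borel_measurable_continuous_onI)
  obtain M where M: "\<And>p. \<bar>fr i f p\<bar> \<le> M"
    using bounded_invariant[OF invariant_fr[OF f dif] cont(2)] by blast
  obtain M0 where M0: "\<And>p. \<bar>f p\<bar> \<le> M0"
    using bounded_invariant[OF f cont(1)] by blast
  define h where "h n = 1 / real (Suc n)" for n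
  have h: "h n > 0" for n by (simp add: h_def)
  have h0: "h \<longlonglongrightarrow> 0" unfolding h_def by (rule LIMSEQ_Suc[OF lim_1_over_n])
  define R where "R n p = nil_mult p (h n *\<^sub>R axis i 1)" for n p
  have [measurable]: "R n \<in> borel_measurable borel" for n unfolding R_def by simp
  define g where "g n p = indicator fdom p * ((f (R n p) - f p) / h n)" for n p
  have R: "R n p = p + h n *\<^sub>R nil_vec i p" for n p
    by (simp add: R_def nil_mult_right_axis)
  have g0: "(\<integral>p. g n p \<partial>lborel) = 0" for n
  proof -
    have "g n = (\<lambda>p. (indicator fdom p * f (R n p) - indicator fdom p * f p) / h n)"
      by (auto simp: g_def fun_eq_iff algebra_simps diff_divide_distrib)
    moreover have "integrable lborel (\<lambda>p. indicator fdom p * f (R n p))"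
      by (rule integrable_fdom[OF _ M0]) simp
    moreover have "integrable lborel (\<lambda>p. indicator fdom p * f p)"
      by (rule integrable_fdom[OF _ M0]) simp
    moreover have "(\<integral>p. indicator fdom p * f (R n p) \<partial>lborel) = (\<integral>p. indicator fdom p * f p \<partial>lborel)"
      unfolding R_def by (rule integral_dom_right[OF f _ M0]) simp
    ultimately show ?thesis by simp
  qed
  have "(\<lambda>n. \<integral>p. g n p \<partial>lborel) \<longlonglongrightarrow> (\<integral>p. indicator fdom p * fr i f p \<partial>lborel)"
  proof (rule integral_dominated_convergence)
    show "integrable lborel (\<lambda>p. indicator fdom p * M :: real)"
      by (rule integrable_fdom) auto
    show "AE p in lborel. (\<lambda>n. g n p) \<longlonglongrightarrow> indicator fdom p * fr i f p"
    proof (rule AE_I2)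
      fix p
      have "((\<lambda>t. f (p + t *\<^sub>R nil_vec i p)) has_real_derivative fr i f p) (at 0)"
        using DERIV_flow[OF dif, of p i 0] by simp
      then have "((\<lambda>t. (f (p + t *\<^sub>R nil_vec i p) - f p) / t) \<longlongrightarrow> fr i f p) (at 0)"
        by (simp add: DERIV_def)
      moreover have "filterlim h (at 0) sequentially"
        using h0 h by (auto simp: filterlim_at intro!: always_eventually) (metis less_irrefl)
      ultimately have "(\<lambda>n. (f (p + h n *\<^sub>R nil_vec i p) - f p) / h n) \<longlonglongrightarrow> fr i f p"
        by (rule filterlim_compose)
      then show "(\<lambda>n. g n p) \<longlonglongrightarrow> indicator fdom p * fr i f p"
        unfolding g_def R by (intro tendsto_intros)
    qed
    show "AE p in lborel. norm (g n p) \<le> indicator fdom p * M" for n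
    proof (rule AE_I2)
      fix p
      \<comment> \<open>The mean value theorem bounds every difference quotient by the supremum
        \<open>M\<close> of the derivative, which is the dominating function.\<close>
      have "\<exists>z>0. z < h n \<and> f (p + h n *\<^sub>R nil_vec i p) - f (p + 0 *\<^sub>R nil_vec i p) =
          (h n - 0) * fr i f (p + z *\<^sub>R nil_vec i p)"
        by (rule MVT2[OF h]) (rule DERIV_flow[OF dif])
      then obtain z where "f (R n p) - f p = h n * fr i f (p + z *\<^sub>R nil_vec i p)"
        by (auto simp: R)
      then have "(f (R n p) - f p) / h n = fr i f (p + z *\<^sub>R nil_vec i p)"
        using h[of n] by simp
      then show "norm (g n p) \<le> indicator fdom p * M"
        using M by (auto simp: g_def indicator_def)
    qed
  qed (auto simp: g_def)
  then show ?thesis unfolding g0 by (metis LIMSEQ_const_iff)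
qed

end


subsection \<open>The area formula\<close>

text \<open>The map is total but constrained only on \<open>U\<close>: outside its domain
  \<open>chart\<close> is the result of a division by zero.\<close>

locale C1_map =
  fixes U :: "(real^'n::{finite,wellorder}) set" and a :: "real^'n::_ \<Rightarrow> real^'n::_"
    and a' :: "real^'n::_ \<Rightarrow> real^'n::_ \<Rightarrow> real^'n::_"
  assumes open_U: "open U"
    and deriv: "\<And>x. x \<in> U \<Longrightarrow> (a has_derivative a' x) (at x)"
    and cont_deriv: "\<And>v. continuous_on U (\<lambda>x. a' x v)"
begin

definition J :: "real^'n::_ \<Rightarrow> real" where
  "J x = det (matrix (a' x))"

lemma cont_J: "continuous_on U J"
  unfolding J_def det_def matrix_def
  by (auto intro!: continuous_intros cont_deriv)

lemma cont_a: "continuous_on U a"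
  using deriv by (meson continuous_at_imp_continuous_on has_derivative_continuous)

text \<open>The inverse function theorem; boundedness of the neighbourhood and of the Jacobian is
  added so that the integrals over pieces are finite.\<close>

lemma locally_injective:
  assumes x: "x \<in> U" and J: "J x \<noteq> 0"
  shows "\<exists>V. open V \<and> x \<in> V \<and> V \<subseteq> U \<and> bounded V \<and> inj_on a V \<and> (\<exists>M. \<forall>y\<in>V. \<bar>J y\<bar> \<le> M)"
proof -
  have lin: "linear (a' y)" if "y \<in> U" for y
    using deriv[OF that] has_derivative_linear by blast
  have "inj (a' x)"
    using J lin[OF x] by (simp add: J_def det_nz_iff_inj)
  then obtain g where g: "linear g" "g \<circ> a' x = id"
    using linear_injective_left_inverse[OF lin[OF x]] by blast
  obtain r where r: "r > 0" "ball x r \<subseteq> U" "inj_on a (ball x r)"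
  proof (rule has_derivative_locally_injective[OF x open_U _ g(2) deriv])
    show "bounded_linear g" using g(1) by (simp add: linear_conv_bounded_linear)
    fix e :: real assume e: "e > 0"
    \<comment> \<open>Summing over basis vectors dominates the operator norm, which upgrades
      directionwise continuity of the derivative to the continuity in norm that local injectivity
      requires.\<close>
    define \<delta> where "\<delta> y = (\<Sum>i\<in>Basis. norm (a' y i - a' x i))" for y
    have "continuous_on U \<delta>"
      unfolding \<delta>_def by (intro continuous_intros cont_deriv)
    then have "isCont \<delta> x" using x open_U continuous_on_eq_continuous_at by blast
    then obtain d where d: "d > 0" "\<And>y. dist y x < d \<Longrightarrow> \<bar>\<delta> y - \<delta> x\<bar> < e"
      using e unfolding continuous_at_eps_delta dist_norm real_norm_def by blast
    obtain d' where d': "d' > 0" "ball x d' \<subseteq> U" using open_U x open_contains_ball by blast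
    have "onorm (\<lambda>v. a' y v - a' x v) < e" if "dist x y < min d d'" for y
    proof -
      have "y \<in> U" using d' that by auto
      then have "bounded_linear (\<lambda>v. a' y v - a' x v)"
        using lin x by (intro bounded_linear_sub) (auto simp: linear_conv_bounded_linear)
      then have "onorm (\<lambda>v. a' y v - a' x v) \<le> \<delta> y"
        unfolding \<delta>_def by (rule onorm_componentwise)
      also have "\<delta> y < e" using d(2)[of y] that by (simp add: \<delta>_def dist_commute)
      finally show ?thesis .
    qed
    then show "\<exists>d>0. \<forall>y. dist x y < d \<longrightarrow> onorm (\<lambda>v. a' y v - a' x v) < e"
      using d(1) d'(1) by (intro exI[of _ "min d d'"]) auto
  qed blast
  \<comment> \<open>Half the radius, so that the closed ball is compact inside \<open>U\<close> and
    bounds the Jacobian.\<close>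
  define s where "s = r / 2"
  have s: "s > 0" "cball x s \<subseteq> ball x r" using r(1) by (auto simp: s_def)
  have "compact (J ` cball x s)"
    using s r(2) by (intro compact_continuous_image continuous_on_subset[OF cont_J]) auto
  then obtain M where M: "\<And>y. y \<in> J ` cball x s \<Longrightarrow> norm y \<le> M"
    using compact_imp_bounded bounded_iff by metis
  have "\<bar>J y\<bar> \<le> M" if "y \<in> ball x s" for y using M[of "J y"] that by auto
  then have "\<exists>M. \<forall>y\<in>ball x s. \<bar>J y\<bar> \<le> M" by blast
  moreover have "ball x s \<subseteq> ball x r" using s by force
  ultimately show ?thesis
    using s(1) r(2) inj_on_subset[OF r(3)]
    by (intro exI[of _ "ball x s"]) auto
qed

lemma borel_measurable_J:
  assumes "S \<in> sets borel" "S \<subseteq> U"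
  shows "(\<lambda>x. indicator S x * \<bar>J x\<bar>) \<in> borel_measurable borel"
proof -
  have "continuous_on S (\<lambda>x. \<bar>J x\<bar>)"
    using assms(2) by (intro continuous_intros continuous_on_subset[OF cont_J])
  from borel_measurable_continuous_on_indicator[OF assms(1) this] show ?thesis
    by simp
qed

lemma borel_measurable_J_ennreal:
  assumes "S \<in> sets borel" "S \<subseteq> U"
  shows "(\<lambda>x. indicator S x * ennreal \<bar>J x\<bar>) \<in> borel_measurable borel"
proof -
  have "(\<lambda>x. indicator S x * ennreal \<bar>J x\<bar>) = (\<lambda>x. ennreal (indicator S x * \<bar>J x\<bar>))"
    by (auto simp: indicator_def fun_eq_iff)
  then show ?thesis using borel_measurable_J[OF assms] by simp
qed

text \<open>By invariance of domain the injective piece has an open image and a continuous inverse,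
  so images of Borel sets are Borel. The bounds make the Jacobian integrable, and then the change of
  variables formula applies.\<close>

lemma emeasure_image:
  assumes V: "open V" "V \<subseteq> U" "bounded V" "inj_on a V" and M: "\<And>y. y \<in> V \<Longrightarrow> \<bar>J y\<bar> \<le> M"
    and E: "E \<in> sets borel" "E \<subseteq> V"
  shows "a ` E \<in> sets borel"
    and "emeasure lborel (a ` E) = (\<integral>\<^sup>+x. indicator E x * ennreal \<bar>J x\<bar> \<partial>lborel)"
proof -
  define g where "g = inv_into V a"
  have cont: "continuous_on V a" using cont_a V(2) continuous_on_subset by blast
  have ga: "g (a x) = x" if "x \<in> V" for x using V(4) that by (simp add: g_def)
  have "continuous_on (a ` V) g"
    by (rule continuous_on_inverse_open[OF V(1) cont]) (auto simp: ga)
  then have "g \<in> borel_measurable (restrict_space borel (a ` V))"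
    by (rule borel_measurable_continuous_on_restrict)
  from measurable_sets[OF this E(1)] have "g -` E \<inter> a ` V \<in> sets (restrict_space borel (a ` V))"
    by (simp add: space_restrict_space)
  moreover have "a ` V \<in> sets borel"
    using invariance_of_domain_gen[OF V(1) cont V(4)] by simp
  ultimately have "g -` E \<inter> a ` V \<in> sets borel"
    by (simp add: sets_restrict_space_iff)
  moreover have "g -` E \<inter> a ` V = a ` E" using E(2) ga by auto
  ultimately show borel: "a ` E \<in> sets borel" by simp
  have EU: "E \<subseteq> U" using E V by blast
  define f where "f x = indicator E x * \<bar>J x\<bar>" for x
  have [measurable]: "f \<in> borel_measurable borel"
    unfolding f_def using borel_measurable_J[OF E(1) EU] .
  have fM: "f x \<le> M * indicator E x" for x using M[of x] E(2) by (auto simp: f_def indicator_def)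
  have "emeasure lborel E < \<infinity>"
    using E(2) V(3) bounded_subset emeasure_bounded_finite by blast
  then have i1: "integrable lborel (\<lambda>x. M * indicator E x)"
    using E(1) by (intro integrable_mult_right integrable_real_indicator) auto
  have f0: "0 \<le> f x" for x by (simp add: f_def)
  have nb: "norm (f x) \<le> norm (M * indicator E x)" for x
    using fM[of x] f0[of x] abs_ge_self[of "M * indicator E x"] unfolding real_norm_def by linarith
  have int: "integrable lborel f"
    by (rule Bochner_Integration.integrable_bound[OF i1 _ AE_I2]) (simp, rule nb)
  have "(f has_integral (integral\<^sup>L lborel f)) UNIV"
    by (rule has_integral_integral_lborel[OF int])
  moreover have "f = (\<lambda>x. if x \<in> E then \<bar>J x\<bar> else 0)" by (auto simp: f_def indicator_def)
  ultimately have int_det: "((\<lambda>x. \<bar>det (matrix (a' x))\<bar>) has_integral (integral\<^sup>L lborel f)) E"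
    by (simp add: has_integral_restrict_UNIV J_def)
  have leb: "E \<in> sets lebesgue" using E(1) by simp
  have der: "(a has_derivative a' x) (at x within E)" if "x \<in> E" for x
    using deriv EU that has_derivative_at_withinI by blast
  have m: "a ` E \<in> lmeasurable \<and> measure lebesgue (a ` E) = integral\<^sup>L lborel f"
    using has_measure_differentiable_image[OF leb der inj_on_subset[OF V(4) E(2)]] int_det by (rule iffD2)
  have "emeasure lborel (a ` E) = emeasure lebesgue (a ` E)"
    using borel by simp
  also have "\<dots> = ennreal (integral\<^sup>L lborel f)"
    using m by (simp add: emeasure_eq_measure2)
  also have "\<dots> = (\<integral>\<^sup>+x. ennreal (f x) \<partial>lborel)"
    by (rule nn_integral_eq_integral[symmetric, OF int]) (simp add: f0)
  also have "\<dots> = (\<integral>\<^sup>+x. indicator E x * ennreal \<bar>J x\<bar> \<partial>lborel)"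
    by (intro nn_integral_cong) (simp add: f_def indicator_def)
  finally show "emeasure lborel (a ` E) = (\<integral>\<^sup>+x. indicator E x * ennreal \<bar>J x\<bar> \<partial>lborel)" .
qed

text \<open>Cut \<open>S\<close> into countably many disjoint Borel pieces on which \<open>a\<close>
  is injective. Summing the images gives a density that counts preimages, hence takes only natural
  or infinite values.\<close>

lemma area_formula:
  assumes S: "S \<in> sets borel" "S \<subseteq> U" and J: "\<And>x. x \<in> S \<Longrightarrow> J x \<noteq> 0"
    and a[measurable]: "a \<in> borel_measurable borel"
  obtains N where "N \<in> borel_measurable borel" "\<And>y. N y = \<infinity> \<or> (\<exists>k::nat. N y = of_nat k)"
    "distr (density lborel (\<lambda>x. indicator S x * ennreal \<bar>J x\<bar>)) borel a = density lborel N"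
proof -
  define \<F> where "\<F> = {V. open V \<and> V \<subseteq> U \<and> bounded V \<and> inj_on a V \<and> (\<exists>M. \<forall>y\<in>V. \<bar>J y\<bar> \<le> M)}"
  have "\<And>V. V \<in> \<F> \<Longrightarrow> open V" by (simp add: \<F>_def)
  then obtain \<F>' where \<F>': "\<F>' \<subseteq> \<F>" "countable \<F>'" "\<Union>\<F>' = \<Union>\<F>"
    by (rule Lindelof)
  have cov: "S \<subseteq> \<Union>\<F>"
  proof
    fix x assume "x \<in> S"
    then show "x \<in> \<Union>\<F>" using locally_injective[of x] S(2) J unfolding \<F>_def by blast
  qed
  have empty: "{} \<in> \<F>" by (simp add: \<F>_def)
  \<comment> \<open>Adding the empty set makes the family nonempty, so that it can be enumerated
    even when \<open>S\<close> is empty.\<close>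
  define F where "F = from_nat_into (insert {} \<F>')"
  have F: "F n \<in> \<F>" for n
  proof -
    have "F n \<in> insert {} \<F>'" unfolding F_def by (rule from_nat_into) simp
    moreover have "insert {} \<F>' \<subseteq> \<F>" using \<F>'(1) empty by simp
    ultimately show ?thesis by (rule rev_subsetD)
  qed
  have cov': "\<exists>n. x \<in> F n" if "x \<in> S" for x
  proof -
    have "x \<in> \<Union>\<F>'" unfolding \<F>'(3) using cov that by (rule subsetD)
    then obtain V where V: "x \<in> V" "V \<in> \<F>'" by (rule UnionE)
    obtain n where "F n = V"
      unfolding F_def using from_nat_into_surj[OF countable_insert[OF \<F>'(2)] insertI2[OF V(2)], of "{}"] by (rule exE)
    then show ?thesis using V(1) by blast
  qed
  define E where "E n = S \<inter> disjointed F n" for n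
  have openF: "open (F n)" for n using F[of n] by (simp add: \<F>_def)
  have "range (disjointed F) \<subseteq> sets borel"
    by (rule sets.range_disjointed_sets) (use openF in auto)
  then have E[measurable]: "E n \<in> sets borel" for n
    unfolding E_def using S(1) by blast
  have EF: "E n \<subseteq> F n" for n unfolding E_def using disjointed_subset[of F n] by blast
  have disj: "disjoint_family E"
    using disjoint_family_disjointed[of F] unfolding E_def disjoint_family_on_def by blast
  have UE: "(\<Union>n. E n) = S"
  proof -
    have "S \<subseteq> (\<Union>n. F n)"
    proof
      fix x assume "x \<in> S"
      then show "x \<in> (\<Union>n. F n)" using cov'[of x] by simp
    qed
    then show ?thesis
      unfolding E_def Int_UN_distrib[symmetric] UN_disjointed_eq by (rule Int_absorb2)
  qed
  \<comment> \<open>Since the pieces are disjoint and \<open>a\<close> is injective on each, this is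
    the number of preimages of \<open>y\<close> in \<open>S\<close>.\<close>
  define N where "N y = (\<Sum>n. indicator (a ` E n) y :: ennreal)" for y
  have img: "a ` A \<in> sets borel \<and>
      emeasure lborel (a ` A) = (\<integral>\<^sup>+x. indicator A x * ennreal \<bar>J x\<bar> \<partial>lborel)"
    if "A \<in> sets borel" "A \<subseteq> F n" for A n
  proof -
    obtain M where "\<And>y. y \<in> F n \<Longrightarrow> \<bar>J y\<bar> \<le> M" using F[of n] unfolding \<F>_def by blast
    then show ?thesis using emeasure_image[of "F n" M A] F[of n] that unfolding \<F>_def by blast
  qed
  have [measurable]: "a ` E n \<in> sets borel" for n using img[OF E EF] by blast
  show thesis
  proof (rule that[of N])
    show [measurable]: "N \<in> borel_measurable borel" unfolding N_def by measurable
    show "N y = \<infinity> \<or> (\<exists>k::nat. N y = of_nat k)" for y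
    proof -
      have "N y = (\<integral>\<^sup>+n. indicator {n. y \<in> a ` E n} n \<partial>count_space UNIV)"
        unfolding N_def by (subst nn_integral_count_space_nat, rule suminf_cong) (simp add: indicator_def)
      also have "\<dots> = emeasure (count_space UNIV) {n. y \<in> a ` E n}"
        by (rule nn_integral_indicator) simp
      finally show ?thesis by (auto simp: emeasure_count_space)
    qed
    show "distr (density lborel (\<lambda>x. indicator S x * ennreal \<bar>J x\<bar>)) borel a = density lborel N"
    proof (rule measure_eqI)
      fix B assume "B \<in> sets (distr (density lborel (\<lambda>x. indicator S x * ennreal \<bar>J x\<bar>)) borel a)"
      then have B[measurable]: "B \<in> sets borel" by simp
      have aB[measurable]: "a -` B \<in> sets borel"
        using measurable_sets_borel[OF a B] by simp
      have mJ[measurable]: "(\<lambda>x. indicator S x * ennreal \<bar>J x\<bar>) \<in> borel_measurable borel"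
        by (rule borel_measurable_J_ennreal[OF S])
      have ES: "E n \<inter> a -` B \<in> sets borel" "E n \<inter> a -` B \<subseteq> U" "E n \<inter> a -` B \<subseteq> F n" for n
        using E aB S(2) EF unfolding E_def by blast+
      have "emeasure (distr (density lborel (\<lambda>x. indicator S x * ennreal \<bar>J x\<bar>)) borel a) B =
          (\<integral>\<^sup>+x. indicator S x * ennreal \<bar>J x\<bar> * indicator (a -` B) x \<partial>lborel)"
        by (simp add: emeasure_distr emeasure_density)
      also have "\<dots> = (\<integral>\<^sup>+x. (\<Sum>n. indicator (E n \<inter> a -` B) x * ennreal \<bar>J x\<bar>) \<partial>lborel)"
      proof (rule nn_integral_cong)
        fix x
        have "indicator S x = (\<Sum>n. indicator (E n) x :: ennreal)"
          using suminf_indicator[OF disj, of x] UE by simp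
        then have "indicator S x * ennreal \<bar>J x\<bar> * indicator (a -` B) x =
            (\<Sum>n. indicator (E n) x) * (ennreal \<bar>J x\<bar> * indicator (a -` B) x)"
          by (simp only: mult.assoc)
        also have "\<dots> = (\<Sum>n. indicator (E n) x * (ennreal \<bar>J x\<bar> * indicator (a -` B) x))"
          by (simp add: ennreal_suminf_multc)
        also have "\<dots> = (\<Sum>n. indicator (E n \<inter> a -` B) x * ennreal \<bar>J x\<bar>)"
          by (intro suminf_cong) (simp add: indicator_def)
        finally show "indicator S x * ennreal \<bar>J x\<bar> * indicator (a -` B) x =
            (\<Sum>n. indicator (E n \<inter> a -` B) x * ennreal \<bar>J x\<bar>)" .
      qed
      also have "\<dots> = (\<Sum>n. \<integral>\<^sup>+x. indicator (E n \<inter> a -` B) x * ennreal \<bar>J x\<bar> \<partial>lborel)"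
        using borel_measurable_J_ennreal[OF ES(1,2)] by (intro nn_integral_suminf) simp
      also have "\<dots> = (\<Sum>n. emeasure lborel (a ` (E n \<inter> a -` B)))"
        using img[OF ES(1,3)] by simp
      also have "\<dots> = (\<Sum>n. \<integral>\<^sup>+y. indicator (a ` E n) y * indicator B y \<partial>lborel)"
      proof (rule suminf_cong)
        fix n
        have "a ` (E n \<inter> a -` B) = a ` E n \<inter> B" by blast
        then have "emeasure lborel (a ` (E n \<inter> a -` B)) = (\<integral>\<^sup>+y. indicator (a ` E n \<inter> B) y \<partial>lborel)"
          by simp
        then show "emeasure lborel (a ` (E n \<inter> a -` B)) = (\<integral>\<^sup>+y. indicator (a ` E n) y * indicator B y \<partial>lborel)"
          by (simp only: indicator_inter_arith)
      qed
      also have "\<dots> = (\<integral>\<^sup>+y. (\<Sum>n. indicator (a ` E n) y * indicator B y) \<partial>lborel)"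
        by (rule nn_integral_suminf[symmetric]) simp
      also have "\<dots> = (\<integral>\<^sup>+y. N y * indicator B y \<partial>lborel)"
        by (simp add: N_def ennreal_suminf_multc)
      also have "\<dots> = emeasure (density lborel N) B"
        by (simp add: emeasure_density)
      finally show "emeasure (distr (density lborel (\<lambda>x. indicator S x * ennreal \<bar>J x\<bar>)) borel a) B =
          emeasure (density lborel N) B" .
    qed simp
  qed
qed

end


subsection \<open>Integrality of the degree\<close>

text \<open>Compactly supported test functions; one continuous derivative suffices because the
  pulled-back forms are differentiated once.\<close>

definition bump :: "(real \<Rightarrow> real) \<Rightarrow> bool" where
  "bump \<phi> \<longleftrightarrow> (\<forall>y. (\<phi> has_real_derivative deriv \<phi> y) (at y)) \<and> continuous_on UNIV (deriv \<phi>) \<and>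
     (\<exists>R. \<forall>y. R < \<bar>y\<bar> \<longrightarrow> \<phi> y = 0)"

lemma bumpI:
  assumes "\<And>y. (\<phi> has_real_derivative \<phi>' y) (at y)" "continuous_on UNIV \<phi>'"
    "\<And>y. R < \<bar>y\<bar> \<Longrightarrow> \<phi> y = 0"
  shows "bump \<phi>"
proof -
  have "deriv \<phi> = \<phi>'" using assms(1) DERIV_imp_deriv by blast
  then show ?thesis using assms unfolding bump_def by auto
qed

lemma bump_DERIV: "bump \<phi> \<Longrightarrow> (\<phi> has_real_derivative deriv \<phi> y) (at y)"
  by (simp add: bump_def)

lemma bump_cont: "bump \<phi> \<Longrightarrow> continuous_on UNIV \<phi>"
  by (meson DERIV_continuous bump_DERIV continuous_at_imp_continuous_on)

lemma bump_measurable: "bump \<phi> \<Longrightarrow> \<phi> \<in> borel_measurable borel"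
  by (intro borel_measurable_continuous_onI bump_cont)

lemma bump_support:
  assumes "bump \<phi>"
  obtains R where "R > 0" "\<And>y. R < \<bar>y\<bar> \<Longrightarrow> \<phi> y = 0"
proof -
  obtain R where "\<And>y. R < \<bar>y\<bar> \<Longrightarrow> \<phi> y = 0" using assms bump_def by blast
  then show ?thesis by (intro that[of "max R 1"]) auto
qed

lemma bump_bounded:
  assumes "bump \<phi>"
  obtains M where "\<And>y. \<bar>\<phi> y\<bar> \<le> M"
proof -
  obtain R where R: "R > 0" "\<And>y. R < \<bar>y\<bar> \<Longrightarrow> \<phi> y = 0" using bump_support[OF assms] by blast
  have "compact (\<phi> ` {-R..R})"
    by (intro compact_continuous_image continuous_on_subset[OF bump_cont[OF assms]]) auto
  then obtain M where M: "\<And>z. z \<in> \<phi> ` {-R..R} \<Longrightarrow> norm z \<le> M"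
    using compact_imp_bounded bounded_iff by metis
  have "\<bar>\<phi> y\<bar> \<le> max M 0" for y
  proof (cases "\<bar>y\<bar> \<le> R")
    case True
    then have "\<phi> y \<in> \<phi> ` {-R..R}" by (intro imageI) auto
    then show ?thesis using M[of "\<phi> y"] by simp
  next
    case False
    then show ?thesis using R(2)[of y] by simp
  qed
  then show ?thesis by (rule that)
qed

lemma bump_integrable:
  assumes "bump \<phi>"
  shows "integrable lborel \<phi>"
proof -
  obtain R where R: "R > 0" "\<And>y. R < \<bar>y\<bar> \<Longrightarrow> \<phi> y = 0" using bump_support[OF assms] by blast
  have "integrable lborel (\<lambda>y. indicator {-R..R} y *\<^sub>R \<phi> y)"
    by (intro borel_integrable_compact continuous_on_subset[OF bump_cont[OF assms]]) auto
  moreover have "indicator {-R..R} y *\<^sub>R \<phi> y = \<phi> y" for y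
    using R(2)[of y] by (cases "R < \<bar>y\<bar>") (auto simp: indicator_def abs_le_iff)
  then have "(\<lambda>y. indicator {-R..R} y *\<^sub>R \<phi> y) = \<phi>" by blast
  ultimately show ?thesis by (simp only:)
qed

lemma bump_lincomb:
  assumes "bump \<phi>" "bump \<psi>"
  shows "bump (\<lambda>y. \<phi> y - c * \<psi> y)"
proof -
  obtain R where R: "\<And>y. R < \<bar>y\<bar> \<Longrightarrow> \<phi> y = 0" using bump_support[OF assms(1)] by blast
  obtain S where S: "\<And>y. S < \<bar>y\<bar> \<Longrightarrow> \<psi> y = 0" using bump_support[OF assms(2)] by blast
  show ?thesis
  proof (rule bumpI[where R="max R S"])
    show "((\<lambda>y. \<phi> y - c * \<psi> y) has_real_derivative deriv \<phi> y - c * deriv \<psi> y) (at y)" for y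
      using assms by (auto intro!: derivative_eq_intros bump_DERIV)
    show "continuous_on UNIV (\<lambda>y. deriv \<phi> y - c * deriv \<psi> y)"
      using assms unfolding bump_def by (intro continuous_intros) auto
  qed (use R S in auto)
qed

text \<open>Any antiderivative is constant beyond the support on either side; integral 0 makes the
  two constants equal, so one shift removes both.\<close>

lemma bump_primitive:
  assumes \<phi>: "bump \<phi>" and 0: "integral\<^sup>L lborel \<phi> = 0"
  obtains f where "bump f" "deriv f = \<phi>"
proof -
  have "isCont \<phi> y" for y using bump_cont[OF \<phi>] continuous_on_eq_continuous_at by blast
  then obtain F where "\<forall>x. -\<infinity> < ereal x \<longrightarrow> ereal x < \<infinity> \<longrightarrow> (F has_vector_derivative \<phi> x) (at x)"
    using einterval_antiderivative[of "-\<infinity>" "\<infinity>" \<phi>] by auto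
  then have F: "(F has_real_derivative \<phi> x) (at x)" for x
    by (simp add: has_real_derivative_iff_has_vector_derivative)
  obtain R where R: "R > 0" "\<And>y. R < \<bar>y\<bar> \<Longrightarrow> \<phi> y = 0" using bump_support[OF \<phi>] by blast
  have const: "F a = F b" if "a \<le> b" "\<And>y. a < y \<Longrightarrow> y < b \<Longrightarrow> \<phi> y = 0" for a b
  proof (cases "a = b")
    case False
    then have "a < b" using that by simp
    from MVT2[OF this F] obtain z where "a < z" "z < b" "F b - F a = (b - a) * \<phi> z" by blast
    then show ?thesis using that(2)[of z] by simp
  qed simp
  have l: "F y = F (-R)" if "y \<le> -R" for y
    using const[of y "-R"] R that by auto
  have r: "F R = F y" if "R \<le> y" for y
    using const[of R y] R that by auto
  have "integral\<^sup>L lborel (\<lambda>y. \<phi> y * indicator {-R..R} y) = F R - F (-R)"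
    using R(1) by (intro integral_FTC_Icc_real F) (auto intro: \<open>\<And>y. isCont \<phi> y\<close>)
  moreover have "\<phi> y * indicator {-R..R} y = \<phi> y" for y
    using R(2)[of y] by (cases "R < \<bar>y\<bar>") (auto simp: indicator_def abs_le_iff)
  ultimately have eq: "F R = F (-R)" using 0 by simp
  define f where "f y = F y - F (-R)" for y
  have f: "(f has_real_derivative \<phi> y) (at y)" for y
    unfolding f_def by (auto intro!: derivative_eq_intros F)
  have "bump f"
  proof (rule bumpI[OF f bump_cont[OF \<phi>], where R=R])
    fix y assume "R < \<bar>y\<bar>"
    then have "y \<le> -R \<or> R \<le> y" by auto
    then show "f y = 0" using l[of y] r[of y] eq by (auto simp: f_def)
  qed
  moreover have "deriv f = \<phi>" using f DERIV_imp_deriv by blast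
  ultimately show ?thesis by (rule that)
qed

text \<open>Here \<open>m\<close> is positive exactly on the open interval. Squaring it gives a
  continuous derivative at the endpoints, and the quotient tends to 1 inside as \<open>n\<close>
  grows.\<close>

definition bump_seq :: "nat \<Rightarrow> real \<Rightarrow> real \<Rightarrow> real \<Rightarrow> real" where
  "bump_seq n \<alpha> \<beta> y = (let m = max 0 ((y - \<alpha>) * (\<beta> - y)) in real n * m\<^sup>2 / (1 + real n * m\<^sup>2))"

lemma has_real_derivative_max0_square:
  "((\<lambda>t::real. (max 0 t)\<^sup>2) has_real_derivative 2 * max 0 t) (at t)"
proof -
  consider "t < 0" | "t = 0" | "t > 0" by linarith
  then show ?thesis
  proof cases
    case 1
    have "((\<lambda>t::real. 0) has_real_derivative 2 * max 0 t) (at t)"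
      using 1 by simp
    then show ?thesis
      by (rule has_field_derivative_transform_within_open[of _ _ _ "{..<0}"]) (use 1 in auto)
  next
    case 2
    have "((\<lambda>h::real. max 0 h) \<longlongrightarrow> max 0 0) (at 0)"
      by (intro tendsto_intros)
    moreover have "eventually (\<lambda>h::real. max 0 h = (max 0 h)\<^sup>2 / h) (at 0)"
      by (auto simp: max_def power2_eq_square eventually_at intro!: exI[of _ 1])
    ultimately have "((\<lambda>h::real. (max 0 h)\<^sup>2 / h) \<longlongrightarrow> max 0 0) (at 0)"
      by (rule Lim_transform_eventually)
    then show ?thesis using 2 by (simp add: DERIV_def)
  next
    case 3
    have "((\<lambda>t::real. t\<^sup>2) has_real_derivative 2 * max 0 t) (at t)"
      using 3 by (auto intro!: derivative_eq_intros)
    then show ?thesis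
      by (rule has_field_derivative_transform_within_open[of _ _ _ "{0<..}"]) (use 3 in auto)
  qed
qed

lemma bump_bump_seq:
  assumes "\<alpha> \<le> \<beta>"
  shows "bump (bump_seq n \<alpha> \<beta>)"
proof (rule bumpI)
  let ?t = "\<lambda>y. (y - \<alpha>) * (\<beta> - y)"
  let ?s = "\<lambda>y. (max 0 (?t y))\<^sup>2"
  let ?s' = "\<lambda>y. (2 * max 0 (?t y)) * (\<alpha> + \<beta> - 2 * y)"
  have pos: "1 + real n * ?s y > 0" for y
    by (intro add_pos_nonneg) auto
  have s: "(?s has_real_derivative ?s' y) (at y)" for y
    by (rule DERIV_chain2[OF has_real_derivative_max0_square])
       (auto intro!: derivative_eq_intros simp: algebra_simps)
  show "(bump_seq n \<alpha> \<beta> has_real_derivative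
      ((real n * ?s' y) * (1 + real n * ?s y) - (real n * ?s y) * (real n * ?s' y)) /
        ((1 + real n * ?s y) * (1 + real n * ?s y))) (at y)" for y
    unfolding bump_seq_def[abs_def] Let_def
  proof (rule DERIV_divide)
    show d: "((\<lambda>y. real n * ?s y) has_real_derivative real n * ?s' y) (at y)"
      by (rule DERIV_cmult[OF s])
    show "((\<lambda>y. 1 + real n * ?s y) has_real_derivative real n * ?s' y) (at y)"
      using DERIV_add[OF DERIV_const d, of 1] by simp
  qed (use pos[of y] in simp)
  show "continuous_on UNIV (\<lambda>y. ((real n * ?s' y) * (1 + real n * ?s y) - (real n * ?s y) * (real n * ?s' y)) /
        ((1 + real n * ?s y) * (1 + real n * ?s y)))"
    by (intro continuous_intros) (use pos in \<open>auto simp: less_imp_neq[symmetric]\<close>)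
  fix y assume "max \<bar>\<alpha>\<bar> \<bar>\<beta>\<bar> < \<bar>y\<bar>"
  then have "(y \<ge> \<alpha> \<and> y \<ge> \<beta>) \<or> (y \<le> \<alpha> \<and> y \<le> \<beta>)" using assms by auto
  then have "?t y \<le> 0" by (auto intro: mult_nonneg_nonpos mult_nonpos_nonneg)
  then show "bump_seq n \<alpha> \<beta> y = 0" by (simp add: bump_seq_def)
qed

lemma bump_seq_bounds:
  assumes "\<alpha> \<le> \<beta>"
  shows "0 \<le> bump_seq n \<alpha> \<beta> y" "bump_seq n \<alpha> \<beta> y \<le> indicator {\<alpha><..<\<beta>} y"
    "(\<lambda>n. bump_seq n \<alpha> \<beta> y) \<longlonglongrightarrow> indicator {\<alpha><..<\<beta>} y"
proof -
  define m where "m = max 0 ((y - \<alpha>) * (\<beta> - y))"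
  have b: "bump_seq n \<alpha> \<beta> y = real n * m\<^sup>2 / (1 + real n * m\<^sup>2)" for n
    by (simp add: bump_seq_def m_def Let_def)
  have pos: "1 + real n * m\<^sup>2 > 0" for n
    by (intro add_pos_nonneg) auto
  show "0 \<le> bump_seq n \<alpha> \<beta> y"
    unfolding b using pos[of n] by simp
  have out: "m = 0" if "y \<notin> {\<alpha><..<\<beta>}"
  proof -
    have "(y \<ge> \<alpha> \<and> y \<ge> \<beta>) \<or> (y \<le> \<alpha> \<and> y \<le> \<beta>)" using that assms by auto
    then have "(y - \<alpha>) * (\<beta> - y) \<le> 0" by (auto intro: mult_nonneg_nonpos mult_nonpos_nonneg)
    then show ?thesis by (simp add: m_def)
  qed
  have "bump_seq n \<alpha> \<beta> y \<le> 1"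
    unfolding b using pos[of n] by simp
  then show "bump_seq n \<alpha> \<beta> y \<le> indicator {\<alpha><..<\<beta>} y"
    using out by (cases "y \<in> {\<alpha><..<\<beta>}") (auto simp: b)
  show "(\<lambda>n. bump_seq n \<alpha> \<beta> y) \<longlonglongrightarrow> indicator {\<alpha><..<\<beta>} y"
  proof (cases "y \<in> {\<alpha><..<\<beta>}")
    case True
    then have "m > 0" by (simp add: m_def max_def)
    have "(\<lambda>n. 1 - inverse (1 + real n * m\<^sup>2)) \<longlonglongrightarrow> 1 - 0"
      by (intro tendsto_intros tendsto_inverse_0_at_top filterlim_tendsto_add_at_top[OF tendsto_const]
            filterlim_at_top_mult_tendsto_pos[OF tendsto_const] filterlim_real_sequentially)
         (use \<open>m > 0\<close> in auto)
    moreover have "1 - inverse (1 + real n * m\<^sup>2) = bump_seq n \<alpha> \<beta> y" for n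
      unfolding b using pos[of n] by (simp add: field_simps)
    ultimately show ?thesis using True by simp
  qed (simp add: b out)
qed

lemma integral_bump_seq_tendsto:
  assumes "\<alpha> \<le> \<beta>"
  shows "(\<lambda>n. integral\<^sup>L lborel (bump_seq n \<alpha> \<beta>)) \<longlonglongrightarrow> \<beta> - \<alpha>"
proof -
  have "(\<lambda>n. integral\<^sup>L lborel (bump_seq n \<alpha> \<beta>)) \<longlonglongrightarrow> integral\<^sup>L lborel (indicator {\<alpha><..<\<beta>} :: real \<Rightarrow> real)"
  proof (rule integral_dominated_convergence)
    show "integrable lborel (indicator {\<alpha><..<\<beta>} :: real \<Rightarrow> real)"
      using assms by (intro integrable_real_indicator) auto
    show "bump_seq n \<alpha> \<beta> \<in> borel_measurable lborel" for n
      using bump_measurable[OF bump_bump_seq[OF assms]] by simp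
    show "AE x in lborel. norm (bump_seq n \<alpha> \<beta> x) \<le> indicator {\<alpha><..<\<beta>} x" for n
      using bump_seq_bounds(1,2)[OF assms] by (intro AE_I2) simp
  qed (use bump_seq_bounds(3)[OF assms] in \<open>auto intro!: AE_I2\<close>)
  then show ?thesis using assms by simp
qed

lemma ex_bump_integral_1: "\<exists>\<phi>. bump \<phi> \<and> integral\<^sup>L lborel \<phi> = 1"
proof -
  have "eventually (\<lambda>n. integral\<^sup>L lborel (bump_seq n 0 1) > 0) sequentially"
    using integral_bump_seq_tendsto[of 0 1] by (intro order_tendstoD) auto
  then obtain n where n: "integral\<^sup>L lborel (bump_seq n 0 1) > 0"
    by (meson eventually_happens' sequentially_bot)
  define c where "c = 1 / integral\<^sup>L lborel (bump_seq n 0 1)"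
  have b: "bump (bump_seq n 0 1)" by (rule bump_bump_seq) simp
  \<comment> \<open>Rescaling is the case of \<open>bump_lincomb\<close> whose first function is
    0.\<close>
  have "bump (\<lambda>y. 0 - (-c) * bump_seq n 0 1 y)"
    by (rule bump_lincomb[OF _ b], rule bumpI[where \<phi>'="\<lambda>_. 0"]) auto
  then have "bump (\<lambda>y. c * bump_seq n 0 1 y)" by simp
  moreover have "integral\<^sup>L lborel (\<lambda>y. c * bump_seq n 0 1 y) = 1"
    using n by (simp add: c_def)
  ultimately show ?thesis by blast
qed

lemma emeasure_lborel_box_vec:
  fixes l u :: "real^'n"
  assumes "\<And>i. l $ i \<le> u $ i"
  shows "emeasure lborel (box l u) = ennreal (\<Prod>i\<in>UNIV. u $ i - l $ i)"
proof -
  have "emeasure lborel (box l u) = emeasure lborel (cbox l u)"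
    unfolding emeasure_lborel_cbox_eq emeasure_lborel_box_eq by (rule refl)
  also have "\<dots> = ennreal (measure lborel (cbox l u))"
    using emeasure_lborel_cbox_finite[of l u] by (intro emeasure_eq_ennreal_measure) simp
  also have "measure lborel (cbox l u) = (\<Prod>i\<in>UNIV. u $ i - l $ i)"
  proof (rule content_cbox_cart)
    have "l \<in> cbox l u" using assms by (simp add: mem_box_cart)
    then show "cbox l u \<noteq> {}" by blast
  qed
  finally show ?thesis .
qed

text \<open>Boxes form an intersection-stable generator, so the two densities agree almost
  everywhere. A constant difference of counting functions is an integer wherever both are finite,
  and \<open>fin\<close> excludes that they are infinite almost everywhere.\<close>

lemma integer_density_constant:
  fixes N1 N2 :: "real^'n \<Rightarrow> ennreal"
  assumes [measurable]: "N1 \<in> borel_measurable borel" "N2 \<in> borel_measurable borel"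
    and int: "\<And>y. N1 y = \<infinity> \<or> (\<exists>k::nat. N1 y = of_nat k)" "\<And>y. N2 y = \<infinity> \<or> (\<exists>k::nat. N2 y = of_nat k)"
    and fin: "\<And>l u. emeasure (density lborel N2) (box l u) < \<infinity>"
    and c: "c \<ge> 0"
    and eq: "\<And>l u. (\<And>i. l $ i \<le> u $ i) \<Longrightarrow> emeasure (density lborel N1) (box l u) =
      emeasure (density lborel N2) (box l u) + ennreal c * emeasure lborel (box l u)"
  shows "AE y in lborel. N1 y = N2 y + ennreal c" "c \<in> \<int>"
proof -
  have dens: "emeasure (density lborel (\<lambda>y. N2 y + ennreal c)) B =
      emeasure (density lborel N2) B + ennreal c * emeasure lborel B" if [measurable]: "B \<in> sets borel" for B
    by (simp add: emeasure_density distrib_right nn_integral_add nn_integral_cmult)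
  have "density lborel N1 = density lborel (\<lambda>y. N2 y + ennreal c)"
  proof (rule measure_eqI_generator_eq)
    let ?E = "range (\<lambda>(a, b). box a b :: (real^'n) set)"
    show "Int_stable ?E" by (auto simp: Int_stable_def box_Int_box)
    show "?E \<subseteq> Pow UNIV" "sets (density lborel N1) = sigma_sets UNIV ?E"
      "sets (density lborel (\<lambda>y. N2 y + ennreal c)) = sigma_sets UNIV ?E"
      by (simp_all add: borel_eq_box)
    let ?A = "\<lambda>n::nat. box (- (real n *\<^sub>R One)) (real n *\<^sub>R One) :: (real^'n) set"
    show "range ?A \<subseteq> ?E" "(\<Union>i. ?A i) = UNIV"
      unfolding UN_box_eq_UNIV by auto
    have eq': "emeasure (density lborel N1) (box l u) =
        emeasure (density lborel N2) (box l u) + ennreal c * emeasure lborel (box l u)" for l u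
    proof (cases "\<forall>i. l $ i \<le> u $ i")
      case True
      then show ?thesis using eq by blast
    next
      case False
      then have "box l u = {}"
        unfolding set_eq_iff mem_box_cart empty_iff by (meson less_le_trans less_imp_le)
      then show ?thesis by simp
    qed
    show "emeasure (density lborel N1) (?A i) \<noteq> \<infinity>" for i
      unfolding eq' using fin[of "- (real i *\<^sub>R One)" "real i *\<^sub>R One"]
      by (auto simp: ennreal_mult_eq_top_iff)
    show "emeasure (density lborel N1) X = emeasure (density lborel (\<lambda>y. N2 y + ennreal c)) X" if "X \<in> ?E" for X
      using that eq' dens by auto
  qed
  then show AE: "AE y in lborel. N1 y = N2 y + ennreal c"
    by (intro sigma_finite_measure.density_unique[OF sigma_finite_lborel]) auto
  show "c \<in> \<int>"
  proof (rule ccontr)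
    assume c': "c \<notin> \<int>"
    \<comment> \<open>At a point with finite counts, \<open>c\<close> would be a difference of two
      natural numbers.\<close>
    have "AE y in lborel. N2 y = \<infinity>"
      using AE
    proof (eventually_elim)
      fix y assume y: "N1 y = N2 y + ennreal c"
      show "N2 y = \<infinity>"
      proof (rule ccontr)
        assume "N2 y \<noteq> \<infinity>"
        then obtain k where k: "N2 y = of_nat k" using int(2) by blast
        then have "N1 y \<noteq> \<infinity>" using y by (simp add: ennreal_add_eq_top)
        then obtain m where m: "N1 y = of_nat m" using int(1) by blast
        have "ennreal (real m) = ennreal (real k + c)"
          using y c unfolding m k by (simp add: ennreal_of_nat_eq_real_of_nat)
        then have "real m = real k + c" using c by (simp add: ennreal_inj del: ennreal_plus)
        then have "c = of_int (int m - int k)" by simp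
        then show False using c' Ints_of_int by metis
      qed
    qed
    then have "emeasure (density lborel N2) (box 0 One) = (\<integral>\<^sup>+y. \<infinity> * indicator (box 0 One) y \<partial>(lborel :: (real^'n) measure))"
      by (subst emeasure_density) (auto intro!: nn_integral_cong_AE)
    also have "\<dots> = \<infinity> * emeasure lborel (box 0 (One :: real^'n))"
      by (rule nn_integral_cmult_indicator) simp
    also have "\<dots> = \<infinity>"
      by (simp add: emeasure_lborel_box_eq ennreal_top_mult)
    finally show False using fin[of 0 One] by simp
  qed
qed

section \<open>Integer degree from vanishing integrals of exact forms\<close>

context C1_map
begin

lemma borel_measurable_signed_J:
  assumes "S \<in> sets borel" "S \<subseteq> U"
  shows "(\<lambda>x. indicator S x * J x) \<in> borel_measurable borel"
  using borel_measurable_continuous_on_indicator[OF assms(1) continuous_on_subset[OF cont_J assms(2)]]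
  by simp

text \<open>\<open>H\<close> says that the signed measure pushed forward by \<open>a\<close>
  annihilates partial derivatives of product test functions, which forces it to be a constant times
  Lebesgue measure. Splitting by the sign of the Jacobian exhibits the constant as a difference of
  two counting densities. \<open>\<kappa>\<close> may have unbounded support, as the invariant
  density on SO(3) does.\<close>

lemma degree_integer:
  assumes S: "S \<in> sets borel" "S \<subseteq> U" "emeasure lborel S < \<infinity>"
    and a[measurable]: "a \<in> borel_measurable borel"
    and bdd: "\<And>R. \<exists>M. \<forall>x\<in>S. (\<forall>i. \<bar>a x $ i\<bar> \<le> R) \<longrightarrow> \<bar>J x\<bar> \<le> M"
    and H: "\<And>i \<phi>. (\<And>j. bump (\<phi> j)) \<Longrightarrow>
      (\<integral>x. indicator S x * J x * (deriv (\<phi> i) (a x $ i) * (\<Prod>j\<in>UNIV - {i}. \<phi> j (a x $ j))) \<partial>lborel) = 0"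
  obtains c where "c \<in> \<int>"
    "\<And>\<kappa>. \<kappa> \<in> borel_measurable borel \<Longrightarrow> (\<And>y. 0 \<le> \<kappa> y) \<Longrightarrow> integrable lborel \<kappa> \<Longrightarrow>
      integrable lborel (\<lambda>x. indicator S x * J x * \<kappa> (a x)) \<Longrightarrow>
      (\<integral>x. indicator S x * J x * \<kappa> (a x) \<partial>lborel) = c * (\<integral>y. \<kappa> y \<partial>lborel)"
proof -
  define SJ where "SJ x = indicator S x * J x" for x
  have SJ[measurable]: "SJ \<in> borel_measurable borel"
    unfolding SJ_def by (rule borel_measurable_signed_J[OF S(1,2)])
  have [measurable]: "S \<in> sets borel" by (rule S(1))
  \<comment> \<open>The Jacobian may blow up at the edge of \<open>U\<close>; it is bounded only
    where \<open>a\<close> is, and a function supported in a cube sees just that part.\<close>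
  have int_bdd: "integrable lborel (\<lambda>x. SJ x * g (a x))"
    if [measurable]: "g \<in> borel_measurable borel" and K: "\<And>y. \<bar>g y\<bar> \<le> K"
      and R: "\<And>y i. R < \<bar>y $ i\<bar> \<Longrightarrow> g y = 0" for g :: "real^'n::_ \<Rightarrow> real" and K R
  proof -
    obtain M where M: "\<And>x. x \<in> S \<Longrightarrow> (\<And>i. \<bar>a x $ i\<bar> \<le> R) \<Longrightarrow> \<bar>J x\<bar> \<le> M"
      using bdd[of R] by blast
    show ?thesis
    proof (rule Bochner_Integration.integrable_bound[OF _ _ AE_I2])
      show "integrable lborel (\<lambda>x. (max M 0 * K) * indicator S x)"
        using S by (intro integrable_mult_right integrable_real_indicator) auto
      fix x
      have K0: "0 \<le> K" using K[of 0] by linarith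
      show "norm (SJ x * g (a x)) \<le> norm ((max M 0 * K) * indicator S x)"
      proof (cases "x \<in> S \<and> (\<forall>i. \<bar>a x $ i\<bar> \<le> R)")
        case True
        then have "\<bar>J x\<bar> \<le> max M 0" using M[of x] by force
        then have "\<bar>J x\<bar> * \<bar>g (a x)\<bar> \<le> max M 0 * K" using K by (intro mult_mono) auto
        then show ?thesis using True K0 by (simp add: SJ_def abs_mult)
      next
        case False
        then have 0: "SJ x * g (a x) = 0" using R[of "a x"] by (auto simp: SJ_def not_le)
        show ?thesis unfolding 0 by simp
      qed
    qed simp
  qed
  have int_bump: "integrable lborel (\<lambda>x. SJ x * (\<Prod>j\<in>UNIV. \<phi> j (a x $ j)))"
    if b: "\<And>j. bump (\<phi> j)" for \<phi> :: "'n \<Rightarrow> real \<Rightarrow> real"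
  proof -
    have "\<exists>K. \<forall>y. \<bar>\<phi> j y\<bar> \<le> K" for j using bump_bounded[OF b[of j]] by blast
    then obtain K where K: "\<And>j y. \<bar>\<phi> j y\<bar> \<le> K j" by metis
    have "\<exists>R. \<forall>y. R < \<bar>y\<bar> \<longrightarrow> \<phi> j y = 0" for j using bump_support[OF b[of j]] by blast
    then obtain R where R: "\<And>j y. R j < \<bar>y\<bar> \<Longrightarrow> \<phi> j y = 0" by metis
    have [measurable]: "\<phi> j \<in> borel_measurable borel" for j by (rule bump_measurable[OF b])
    show ?thesis
    proof (rule int_bdd[where g="\<lambda>y. \<Prod>j\<in>UNIV. \<phi> j (y $ j)"])
      show "(\<lambda>y. \<Prod>j\<in>UNIV. \<phi> j (y $ j)) \<in> borel_measurable borel"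
        by measurable
      show "\<bar>\<Prod>j\<in>UNIV. \<phi> j (y $ j)\<bar> \<le> (\<Prod>j\<in>UNIV. K j)" for y :: "real^'n::_"
        unfolding abs_prod using K by (intro prod_mono) auto
      fix y :: "real^'n::_" and i assume "Max (range R) < \<bar>y $ i\<bar>"
      then have "\<phi> i (y $ i) = 0" using R[of i] Max_ge[of "range R" "R i"] by auto
      then show "(\<Prod>j\<in>UNIV. \<phi> j (y $ j)) = 0" by (intro prod_zero) auto
    qed
  qed
  define G where "G \<phi> = (\<integral>x. SJ x * (\<Prod>j\<in>UNIV. \<phi> j (a x $ j)) \<partial>lborel)" for \<phi> :: "'n \<Rightarrow> real \<Rightarrow> real"
  obtain \<phi>0 where \<phi>0: "bump \<phi>0" "integral\<^sup>L lborel \<phi>0 = 1" using ex_bump_integral_1 by blast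
  have prod_i: "(\<Prod>j\<in>UNIV. h j) = h i * (\<Prod>j\<in>UNIV - {i}. h j)" for h :: "'n \<Rightarrow> real" and i
    by (rule prod.remove) auto
  \<comment> \<open>Subtracting from the \<open>i\<close>-th factor its integral times
    \<open>\<phi>0\<close> leaves integral 0, hence the derivative of a test function, and
    \<open>H\<close> kills that contribution.\<close>
  have step: "G \<phi> = integral\<^sup>L lborel (\<phi> i) * G (\<phi>(i := \<phi>0))" if b: "\<And>j. bump (\<phi> j)" for \<phi> i
  proof -
    define d where "d = integral\<^sup>L lborel (\<phi> i)"
    have bk: "bump (\<lambda>y. \<phi> i y - d * \<phi>0 y)" by (rule bump_lincomb[OF b \<phi>0(1)])
    have "integral\<^sup>L lborel (\<lambda>y. \<phi> i y - d * \<phi>0 y) = 0"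
      using bump_integrable[OF b[of i]] bump_integrable[OF \<phi>0(1)] \<phi>0(2) by (simp add: d_def)
    then obtain f where f: "bump f" "deriv f = (\<lambda>y. \<phi> i y - d * \<phi>0 y)"
      by (rule bump_primitive[OF bk])
    have b': "bump ((\<phi>(i := f)) j)" "bump ((\<phi>(i := \<phi>0)) j)" for j using b f \<phi>0 by auto
    have "0 = (\<integral>x. indicator S x * J x * (deriv ((\<phi>(i := f)) i) (a x $ i) *
        (\<Prod>j\<in>UNIV - {i}. (\<phi>(i := f)) j (a x $ j))) \<partial>lborel)"
      by (rule H[OF b'(1), symmetric])
    also have "\<dots> = (\<integral>x. SJ x * (\<Prod>j\<in>UNIV. \<phi> j (a x $ j)) -
        d * (SJ x * (\<Prod>j\<in>UNIV. (\<phi>(i := \<phi>0)) j (a x $ j))) \<partial>lborel)"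
    proof (rule Bochner_Integration.integral_cong[OF refl])
      fix x
      have e: "(\<Prod>j\<in>UNIV - {i}. (\<phi>(i := k)) j (a x $ j)) = (\<Prod>j\<in>UNIV - {i}. \<phi> j (a x $ j))" for k
        by (rule prod.cong) auto
      show "indicator S x * J x * (deriv ((\<phi>(i := f)) i) (a x $ i) *
          (\<Prod>j\<in>UNIV - {i}. (\<phi>(i := f)) j (a x $ j))) = SJ x * (\<Prod>j\<in>UNIV. \<phi> j (a x $ j)) -
        d * (SJ x * (\<Prod>j\<in>UNIV. (\<phi>(i := \<phi>0)) j (a x $ j)))"
        unfolding prod_i[of _ i] e by (simp add: f(2) SJ_def algebra_simps)
    qed
    also have "\<dots> = G \<phi> - d * G (\<phi>(i := \<phi>0))"
      unfolding G_def using int_bump[OF b] int_bump[OF b'(2)] by simp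
    finally show ?thesis by (simp add: d_def)
  qed
  define C where "C = G (\<lambda>_. \<phi>0)"
  \<comment> \<open>Exchanging all factors in turn shows that the functional is a multiple of the
    product of the integrals; \<open>C\<close> will be the degree.\<close>
  have G: "G \<phi> = (\<Prod>j\<in>UNIV. integral\<^sup>L lborel (\<phi> j)) * C" if b: "\<And>j. bump (\<phi> j)" for \<phi>
  proof -
    have "G \<phi> = (\<Prod>j\<in>I. integral\<^sup>L lborel (\<phi> j)) * G (\<lambda>j. if j \<in> I then \<phi>0 else \<phi> j)"
      if "finite I" for I
      using that
    proof (induction I rule: finite_induct)
      case empty
      then show ?case by simp
    next
      case (insert i I)
      let ?\<psi> = "\<lambda>j. if j \<in> I then \<phi>0 else \<phi> j"
      have "G ?\<psi> = integral\<^sup>L lborel (?\<psi> i) * G (?\<psi>(i := \<phi>0))"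
        by (rule step) (simp add: b \<phi>0)
      moreover have "?\<psi>(i := \<phi>0) = (\<lambda>j. if j \<in> insert i I then \<phi>0 else \<phi> j)" by auto
      moreover have "?\<psi> i = \<phi> i" using insert by simp
      ultimately show ?case using insert by simp
    qed
    from this[of UNIV] show ?thesis by (simp add: C_def)
  qed
  have int_box: "integrable lborel (\<lambda>x. SJ x * indicator (box l u) (a x))" for l u :: "real^'n::_"
  proof (rule int_bdd)
    show "\<bar>indicator (box l u) y :: real\<bar> \<le> 1" for y by (simp add: indicator_def)
    fix y :: "real^'n::_" and i
    assume R: "Max (range (\<lambda>i. max \<bar>l $ i\<bar> \<bar>u $ i\<bar>)) < \<bar>y $ i\<bar>"
    have "max \<bar>l $ i\<bar> \<bar>u $ i\<bar> \<le> Max (range (\<lambda>i. max \<bar>l $ i\<bar> \<bar>u $ i\<bar>))" by (rule Max_ge) auto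
    then have "max \<bar>l $ i\<bar> \<bar>u $ i\<bar> < \<bar>y $ i\<bar>" using R by (rule le_less_trans)
    then have "\<not> (l $ i < y $ i \<and> y $ i < u $ i)" by linarith
    then have "y \<notin> box l u" unfolding mem_box_cart by blast
    then show "indicator (box l u) y = (0::real)" by simp
  qed simp
  have box: "(\<integral>x. SJ x * indicator (box l u) (a x) \<partial>lborel) = C * (\<Prod>i\<in>UNIV. u $ i - l $ i)"
    if lu: "\<And>i. l $ i \<le> u $ i" for l u :: "real^'n::_"
  proof -
    let ?\<phi> = "\<lambda>n j. bump_seq n (l $ j) (u $ j)"
    have b: "bump (?\<phi> n j)" for n j by (rule bump_bump_seq[OF lu])
    have ind: "(\<Prod>j\<in>UNIV. indicator {l $ j<..<u $ j} (y $ j)) = (indicator (box l u) y :: real)" for y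
    proof (cases "y \<in> box l u")
      case True
      then show ?thesis by (simp add: mem_box_cart)
    next
      case False
      then obtain i where "\<not> (l $ i < y $ i \<and> y $ i < u $ i)" by (auto simp: mem_box_cart)
      then have "indicator {l $ i<..<u $ i} (y $ i) = (0::real)" by auto
      then have "(\<Prod>j\<in>UNIV. indicator {l $ j<..<u $ j} (y $ j)) = (0::real)"
        by (intro prod_zero) auto
      then show ?thesis using False by simp
    qed
    \<comment> \<open>Box indicators are limits of product test functions lying below them, so they
      dominate the sequence themselves.\<close>
    have "(\<lambda>n. G (?\<phi> n)) \<longlonglongrightarrow> (\<integral>x. SJ x * indicator (box l u) (a x) \<partial>lborel)"
      unfolding G_def
    proof (rule integral_dominated_convergence)
      show "integrable lborel (\<lambda>x. \<bar>SJ x * indicator (box l u) (a x)\<bar>)"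
        by (rule integrable_abs[OF int_box])
      show "(\<lambda>x. SJ x * (\<Prod>j\<in>UNIV. ?\<phi> n j (a x $ j))) \<in> borel_measurable lborel" for n
        using borel_measurable_integrable[OF int_bump[OF b]] .
      show "AE x in lborel. (\<lambda>n. SJ x * (\<Prod>j\<in>UNIV. ?\<phi> n j (a x $ j))) \<longlonglongrightarrow> SJ x * indicator (box l u) (a x)"
        unfolding ind[symmetric] by (intro AE_I2 tendsto_intros tendsto_prod bump_seq_bounds(3) lu)
      show "AE x in lborel. norm (SJ x * (\<Prod>j\<in>UNIV. ?\<phi> n j (a x $ j))) \<le> \<bar>SJ x * indicator (box l u) (a x)\<bar>" for n
      proof (rule AE_I2)
        fix x
        have "0 \<le> (\<Prod>j\<in>UNIV. ?\<phi> n j (a x $ j))"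
          by (rule prod_nonneg) (use bump_seq_bounds(1) lu in auto)
        moreover have "(\<Prod>j\<in>UNIV. ?\<phi> n j (a x $ j)) \<le> indicator (box l u) (a x)"
          unfolding ind[symmetric] by (rule prod_mono) (use bump_seq_bounds(1,2) lu in auto)
        ultimately show "norm (SJ x * (\<Prod>j\<in>UNIV. ?\<phi> n j (a x $ j))) \<le> \<bar>SJ x * indicator (box l u) (a x)\<bar>"
          unfolding real_norm_def abs_mult by (intro mult_left_mono) auto
      qed
    qed simp
    moreover have "(\<lambda>n. G (?\<phi> n)) \<longlonglongrightarrow> (\<Prod>i\<in>UNIV. u $ i - l $ i) * C"
      unfolding G[OF b] by (intro tendsto_intros tendsto_prod integral_bump_seq_tendsto lu)
    ultimately have "(\<integral>x. SJ x * indicator (box l u) (a x) \<partial>lborel) = (\<Prod>i\<in>UNIV. u $ i - l $ i) * C"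
      by (rule LIMSEQ_unique)
    then show ?thesis by (simp add: mult.commute)
  qed
  \<comment> \<open>Points of zero Jacobian carry no signed mass and are left out, so no statement
    about critical values arises.\<close>
  define S1 where "S1 = {x. 0 < SJ x}"
  define S2 where "S2 = {x. SJ x < 0}"
  have S12: "S1 \<in> sets borel" "S2 \<in> sets borel" unfolding S1_def S2_def by measurable
  have sub: "S1 \<subseteq> U" "S2 \<subseteq> U" using S(2) by (auto simp: S1_def S2_def SJ_def indicator_def split: if_splits)
  have nz: "J x \<noteq> 0" if "x \<in> S1 \<or> x \<in> S2" for x
    using that by (auto simp: S1_def S2_def SJ_def)
  obtain N1 where N1[measurable]: "N1 \<in> borel_measurable borel"
    and N1': "\<And>y. N1 y = \<infinity> \<or> (\<exists>k::nat. N1 y = of_nat k)"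
    "distr (density lborel (\<lambda>x. indicator S1 x * ennreal \<bar>J x\<bar>)) borel a = density lborel N1"
    using area_formula[OF S12(1) sub(1) _ a] nz by blast
  obtain N2 where N2[measurable]: "N2 \<in> borel_measurable borel"
    and N2': "\<And>y. N2 y = \<infinity> \<or> (\<exists>k::nat. N2 y = of_nat k)"
    "distr (density lborel (\<lambda>x. indicator S2 x * ennreal \<bar>J x\<bar>)) borel a = density lborel N2"
    using area_formula[OF S12(2) sub(2) _ a] nz by blast
  note mJ[measurable] = borel_measurable_J_ennreal[OF S12(1) sub(1)] borel_measurable_J_ennreal[OF S12(2) sub(2)]
  have nn1: "(\<integral>\<^sup>+y. N1 y * g y \<partial>lborel) = (\<integral>\<^sup>+x. indicator S1 x * ennreal \<bar>J x\<bar> * g (a x) \<partial>lborel)"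
    if [measurable]: "g \<in> borel_measurable borel" for g
  proof -
    have "(\<integral>\<^sup>+y. N1 y * g y \<partial>lborel) = (\<integral>\<^sup>+y. g y \<partial>density lborel N1)"
      by (simp add: nn_integral_density)
    also have "\<dots> = (\<integral>\<^sup>+x. g (a x) \<partial>density lborel (\<lambda>x. indicator S1 x * ennreal \<bar>J x\<bar>))"
      unfolding N1'(2)[symmetric] by (simp add: nn_integral_distr)
    finally show ?thesis by (simp add: nn_integral_density)
  qed
  have nn2: "(\<integral>\<^sup>+y. N2 y * g y \<partial>lborel) = (\<integral>\<^sup>+x. indicator S2 x * ennreal \<bar>J x\<bar> * g (a x) \<partial>lborel)"
    if [measurable]: "g \<in> borel_measurable borel" for g
  proof -
    have "(\<integral>\<^sup>+y. N2 y * g y \<partial>lborel) = (\<integral>\<^sup>+y. g y \<partial>density lborel N2)"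
      by (simp add: nn_integral_density)
    also have "\<dots> = (\<integral>\<^sup>+x. g (a x) \<partial>density lborel (\<lambda>x. indicator S2 x * ennreal \<bar>J x\<bar>))"
      unfolding N2'(2)[symmetric] by (simp add: nn_integral_distr)
    finally show ?thesis by (simp add: nn_integral_density)
  qed
  have split: "(\<integral>x. SJ x * g (a x) \<partial>lborel) =
        enn2real (\<integral>\<^sup>+y. N1 y * ennreal (g y) \<partial>lborel) - enn2real (\<integral>\<^sup>+y. N2 y * ennreal (g y) \<partial>lborel)"
      "(\<integral>\<^sup>+y. N1 y * ennreal (g y) \<partial>lborel) < \<infinity>" "(\<integral>\<^sup>+y. N2 y * ennreal (g y) \<partial>lborel) < \<infinity>"
    if [measurable]: "g \<in> borel_measurable borel" and g: "\<And>y. 0 \<le> g y"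
      and int: "integrable lborel (\<lambda>x. SJ x * g (a x))" for g
  proof -
    have p: "ennreal (SJ x * g (a x)) = indicator S1 x * ennreal \<bar>J x\<bar> * ennreal (g (a x))" for x
    proof (cases "x \<in> S1")
      case True
      then have "SJ x = \<bar>J x\<bar>" by (auto simp: S1_def SJ_def indicator_def split: if_splits)
      then show ?thesis using True g by (simp add: ennreal_mult)
    next
      case False
      then have "SJ x * g (a x) \<le> 0" using g by (auto simp: S1_def intro: mult_nonpos_nonneg)
      then show ?thesis using False by (simp add: ennreal_neg)
    qed
    have m: "ennreal (- (SJ x * g (a x))) = indicator S2 x * ennreal \<bar>J x\<bar> * ennreal (g (a x))" for x
    proof (cases "x \<in> S2")
      case True
      then have "- SJ x = \<bar>J x\<bar>" by (auto simp: S2_def SJ_def indicator_def split: if_splits)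
      then have "- (SJ x * g (a x)) = \<bar>J x\<bar> * g (a x)" by (metis mult_minus_left)
      then show ?thesis using True g by (simp add: ennreal_mult)
    next
      case False
      then have "0 \<le> SJ x * g (a x)" using g by (auto simp: S2_def intro: mult_nonneg_nonneg)
      then show ?thesis using False by (simp add: ennreal_neg)
    qed
    have 1: "(\<integral>\<^sup>+y. N1 y * ennreal (g y) \<partial>lborel) = (\<integral>\<^sup>+x. ennreal (SJ x * g (a x)) \<partial>lborel)"
      unfolding p by (rule nn1) simp
    have 2: "(\<integral>\<^sup>+y. N2 y * ennreal (g y) \<partial>lborel) = (\<integral>\<^sup>+x. ennreal (- (SJ x * g (a x))) \<partial>lborel)"
      unfolding m by (rule nn2) simp
    show "(\<integral>x. SJ x * g (a x) \<partial>lborel) =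
        enn2real (\<integral>\<^sup>+y. N1 y * ennreal (g y) \<partial>lborel) - enn2real (\<integral>\<^sup>+y. N2 y * ennreal (g y) \<partial>lborel)"
      unfolding 1 2 by (rule real_lebesgue_integral_def[OF int])
    show "(\<integral>\<^sup>+y. N1 y * ennreal (g y) \<partial>lborel) < \<infinity>" "(\<integral>\<^sup>+y. N2 y * ennreal (g y) \<partial>lborel) < \<infinity>"
      unfolding 1 2 using int by (simp_all add: real_integrable_def less_top)
  qed
  have emb: "emeasure (density lborel N) (box l u) = (\<integral>\<^sup>+y. N y * ennreal (indicator (box l u) y) \<partial>lborel)"
    if [measurable]: "N \<in> borel_measurable borel" for N and l u :: "real^'n::_"
    by (simp add: emeasure_density ennreal_indicator)
  have box_split: "(\<integral>x. SJ x * indicator (box l u) (a x) \<partial>lborel) =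
        enn2real (\<integral>\<^sup>+y. N1 y * ennreal (indicator (box l u) y) \<partial>lborel) -
        enn2real (\<integral>\<^sup>+y. N2 y * ennreal (indicator (box l u) y) \<partial>lborel)"
      "(\<integral>\<^sup>+y. N1 y * ennreal (indicator (box l u) y) \<partial>lborel) < \<infinity>"
      "(\<integral>\<^sup>+y. N2 y * ennreal (indicator (box l u) y) \<partial>lborel) < \<infinity>" for l u
    by (rule split, simp, simp, rule int_box)+
  have fin: "emeasure (density lborel N1) (box l u) < \<infinity>" "emeasure (density lborel N2) (box l u) < \<infinity>"
    for l u :: "real^'n::_"
    unfolding emb[OF N1] emb[OF N2] by (rule box_split)+
  have diff: "enn2real (emeasure (density lborel N1) (box l u)) - enn2real (emeasure (density lborel N2) (box l u)) =
      C * (\<Prod>i\<in>UNIV. u $ i - l $ i)" if "\<And>i. l $ i \<le> u $ i" for l u :: "real^'n::_"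
    unfolding emb[OF N1] emb[OF N2] box[OF that, symmetric] by (rule box_split(1)[symmetric])
  have conv: "x = y + ennreal c * ennreal v"
    if "x < \<infinity>" "y < \<infinity>" "enn2real x - enn2real y = c * v" "0 \<le> c" "0 \<le> v" for x y :: ennreal and c v
  proof -
    have "enn2real x = enn2real y + c * v" using that by simp
    then have "ennreal (enn2real x) = ennreal (enn2real y) + ennreal (c * v)"
      using that by (metis ennreal_plus enn2real_nonneg mult_nonneg_nonneg)
    moreover have "ennreal (enn2real x) = x" "ennreal (enn2real y) = y"
      using that(1,2) by (auto intro!: ennreal_enn2real)
    ultimately show ?thesis using that(4,5) by (simp only: ennreal_mult)
  qed
  have vol: "0 \<le> (\<Prod>i\<in>UNIV. u $ i - l $ i)" if "\<And>i. l $ i \<le> u $ i" for l u :: "real^'n::_"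
    using that by (intro prod_nonneg) simp
  have weight: "enn2real (\<integral>\<^sup>+y. M1 y * ennreal (\<kappa> y) \<partial>lborel) =
      enn2real (\<integral>\<^sup>+y. M2 y * ennreal (\<kappa> y) \<partial>lborel) + c * (\<integral>y. \<kappa> y \<partial>lborel)"
    if AE: "AE y in lborel. M1 y = M2 y + ennreal c" and c: "0 \<le> c"
      and [measurable]: "M2 \<in> borel_measurable borel" "\<kappa> \<in> borel_measurable borel"
      and k: "\<And>y. 0 \<le> \<kappa> y" "integrable lborel \<kappa>"
      and fin: "(\<integral>\<^sup>+y. M2 y * ennreal (\<kappa> y) \<partial>lborel) < \<infinity>"
    for M1 M2 :: "real^'n::_ \<Rightarrow> ennreal" and \<kappa> :: "real^'n::_ \<Rightarrow> real" and c
  proof -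
    have "(\<integral>\<^sup>+y. M1 y * ennreal (\<kappa> y) \<partial>lborel) = (\<integral>\<^sup>+y. M2 y * ennreal (\<kappa> y) + ennreal c * ennreal (\<kappa> y) \<partial>lborel)"
      by (rule nn_integral_cong_AE) (use AE in \<open>eventually_elim, simp add: distrib_right\<close>)
    also have "\<dots> = (\<integral>\<^sup>+y. M2 y * ennreal (\<kappa> y) \<partial>lborel) + ennreal c * (\<integral>\<^sup>+y. ennreal (\<kappa> y) \<partial>lborel)"
      by (simp add: nn_integral_add nn_integral_cmult)
    also have "(\<integral>\<^sup>+y. ennreal (\<kappa> y) \<partial>lborel) = ennreal (\<integral>y. \<kappa> y \<partial>lborel)"
      by (rule nn_integral_eq_integral[OF k(2)]) (simp add: k)
    also have "ennreal c * ennreal (\<integral>y. \<kappa> y \<partial>lborel) = ennreal (c * (\<integral>y. \<kappa> y \<partial>lborel))"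
      using c k by (simp add: ennreal_mult)
    finally show ?thesis
      using fin c k by (simp add: enn2real_plus)
  qed
  show thesis
  \<comment> \<open>Extended nonnegative densities cannot be subtracted, so the multiple of Lebesgue
    measure is added to whichever side is smaller.\<close>
  proof (cases "0 \<le> C")
    case True
    have eq: "emeasure (density lborel N1) (box l u) =
        emeasure (density lborel N2) (box l u) + ennreal C * emeasure lborel (box l u)"
      if lu: "\<And>i. l $ i \<le> u $ i" for l u :: "real^'n::_"
      unfolding emeasure_lborel_box_vec[OF lu]
      by (rule conv[OF fin(1) fin(2) diff[OF lu] True vol[OF lu]])
    note ic = integer_density_constant[OF N1 N2 N1'(1) N2'(1) fin(2) True eq]
    show thesis
    proof (rule that[OF ic(2)])
      fix \<kappa> :: "real^'n::_ \<Rightarrow> real"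
      assume k: "\<kappa> \<in> borel_measurable borel" "\<And>y. 0 \<le> \<kappa> y" "integrable lborel \<kappa>"
        "integrable lborel (\<lambda>x. indicator S x * J x * \<kappa> (a x))"
      note sp = split[OF k(1,2) k(4)[folded SJ_def]]
      show "(\<integral>x. indicator S x * J x * \<kappa> (a x) \<partial>lborel) = C * (\<integral>y. \<kappa> y \<partial>lborel)"
        using sp(1) weight[OF ic(1) True N2 k(1-3) sp(3)] by (simp add: SJ_def)
    qed
  next
    case False
    then have C': "0 \<le> - C" by simp
    have eq: "emeasure (density lborel N2) (box l u) =
        emeasure (density lborel N1) (box l u) + ennreal (-C) * emeasure lborel (box l u)"
      if lu: "\<And>i. l $ i \<le> u $ i" for l u :: "real^'n::_"
      unfolding emeasure_lborel_box_vec[OF lu]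
      by (rule conv[OF fin(2) fin(1) _ C' vol[OF lu]]) (use diff[OF lu] in simp)
    note ic = integer_density_constant[OF N2 N1 N2'(1) N1'(1) fin(1) C' eq]
    show thesis
    proof (rule that)
      show "C \<in> \<int>" using ic(2) by simp
      fix \<kappa> :: "real^'n::_ \<Rightarrow> real"
      assume k: "\<kappa> \<in> borel_measurable borel" "\<And>y. 0 \<le> \<kappa> y" "integrable lborel \<kappa>"
        "integrable lborel (\<lambda>x. indicator S x * J x * \<kappa> (a x))"
      note sp = split[OF k(1,2) k(4)[folded SJ_def]]
      show "(\<integral>x. indicator S x * J x * \<kappa> (a x) \<partial>lborel) = C * (\<integral>y. \<kappa> y \<partial>lborel)"
        using sp(1) weight[OF ic(1) C' N1 k(1-3) sp(2)] by (simp add: SJ_def)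
    qed
  qed
qed

end


subsection \<open>The volume of the rotation group\<close>

lemma nn_integral_FTC_UNIV:
  fixes f F :: "real \<Rightarrow> real"
  assumes F: "\<And>x. (F has_real_derivative f x) (at x)" and cont: "continuous_on UNIV f"
    and f: "\<And>x. 0 \<le> f x" and lim: "(F \<longlongrightarrow> T) at_top" "(F \<longlongrightarrow> B) at_bot"
  shows "(\<integral>\<^sup>+x. ennreal (f x) \<partial>lborel) = ennreal (T - B)"
proof -
  have c: "isCont f x" for x using cont continuous_on_eq_continuous_at by blast
  have A: "((F \<circ> real_of_ereal) \<longlongrightarrow> B) (at_right (-\<infinity>))"
    "((F \<circ> real_of_ereal) \<longlongrightarrow> T) (at_left \<infinity>)"
    using lim by (simp_all add: ereal_tendsto_simps)
  have ei: "einterval (-\<infinity>) \<infinity> = UNIV" by (auto simp: einterval_def)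
  have "set_integrable lborel (einterval (-\<infinity>) \<infinity>) f" "(LBINT x=-\<infinity>..\<infinity>. f x) = T - B"
    by (rule interval_integral_FTC_nonneg[OF _ F c _ A]; use f in simp)+
  then have "integrable lborel f" "integral\<^sup>L lborel f = T - B"
    by (simp_all add: set_integrable_def interval_lebesgue_integral_def set_lebesgue_integral_def ei)
  then show ?thesis using nn_integral_eq_integral[of lborel f] f by simp
qed

lemma nn_integral_inverse_square_quadratic:
  fixes A :: real
  assumes "A > 0"
  shows "(\<integral>\<^sup>+z. ennreal (1 / (A + z\<^sup>2)\<^sup>2) \<partial>lborel) = ennreal (pi / (2 * (A * sqrt A)))"
proof -
  define s where "s = sqrt A"
  have s: "s > 0" "A = s\<^sup>2" using assms by (simp_all add: s_def)
  have pos: "s\<^sup>2 + z\<^sup>2 > 0" for z :: real using s by (simp add: add_pos_nonneg)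
  \<comment> \<open>Antiderivative of \<open>1 / (s\<^sup>2 + z\<^sup>2)\<^sup>2\<close> from the
    usual reduction to an arctangent; only that term contributes at infinity.\<close>
  define F where "F z = (1 / (2 * s\<^sup>2)) * (z / (s\<^sup>2 + z\<^sup>2)) + (1 / (2 * s ^ 3)) * arctan (z / s)" for z
  have "(\<integral>\<^sup>+z. ennreal (1 / (s\<^sup>2 + z\<^sup>2)\<^sup>2) \<partial>lborel) = ennreal (pi / (4 * s ^ 3) - (- pi / (4 * s ^ 3)))"
  proof (rule nn_integral_FTC_UNIV[where F=F])
    fix z :: real
    have e: "1 + (z / s)\<^sup>2 = (s\<^sup>2 + z\<^sup>2) / s\<^sup>2" using s by (simp add: field_simps)
    have d1: "((\<lambda>z. z / (s\<^sup>2 + z\<^sup>2)) has_real_derivative ((s\<^sup>2 + z\<^sup>2) - z * (2 * z)) / (s\<^sup>2 + z\<^sup>2)\<^sup>2) (at z)"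
      using pos[of z] by (auto intro!: derivative_eq_intros simp: power2_eq_square)
    have d2: "((\<lambda>z. arctan (z / s)) has_real_derivative inverse (1 + (z / s)\<^sup>2) * (1 / s)) (at z)"
      using s(1) by (auto intro!: derivative_eq_intros)
    have "(F has_real_derivative (1 / (2 * s\<^sup>2)) * (((s\<^sup>2 + z\<^sup>2) - z * (2 * z)) / (s\<^sup>2 + z\<^sup>2)\<^sup>2) +
        (1 / (2 * s ^ 3)) * (inverse (1 + (z / s)\<^sup>2) * (1 / s))) (at z)"
      unfolding F_def by (intro DERIV_add DERIV_cmult d1 d2)
    also have "(1 / (2 * s\<^sup>2)) * (((s\<^sup>2 + z\<^sup>2) - z * (2 * z)) / (s\<^sup>2 + z\<^sup>2)\<^sup>2) +
        (1 / (2 * s ^ 3)) * (inverse (1 + (z / s)\<^sup>2) * (1 / s)) = 1 / (s\<^sup>2 + z\<^sup>2)\<^sup>2"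
    proof -
      define q where "q = s\<^sup>2 + z\<^sup>2"
      have q: "q > 0" "z * z = q - s * s" using pos[of z] by (auto simp: q_def power2_eq_square)
      have N: "q - z * (2 * z) = 2 * (s * s) - q" using q(2) by algebra
      show ?thesis
        unfolding e q_def[symmetric] N using s(1) q(1) by (simp add: field_simps power2_eq_square power3_eq_cube)
    qed
    finally show "(F has_real_derivative 1 / (s\<^sup>2 + z\<^sup>2)\<^sup>2) (at z)" .
  next
    show "continuous_on UNIV (\<lambda>z. 1 / (s\<^sup>2 + z\<^sup>2)\<^sup>2)"
      using pos by (intro continuous_intros) (auto simp: less_imp_neq[symmetric])
    show "(F \<longlongrightarrow> pi / (4 * s ^ 3)) at_top" unfolding F_def using s(1) by real_asymp
    show "(F \<longlongrightarrow> - pi / (4 * s ^ 3)) at_bot" unfolding F_def using s(1) by real_asymp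
  qed simp
  also have "pi / (4 * s ^ 3) - (- pi / (4 * s ^ 3)) = pi / (2 * (A * sqrt A))"
    using s by (simp add: s_def[symmetric] power2_eq_square power3_eq_cube)
  finally show ?thesis unfolding s(2) .
qed

lemma nn_integral_inverse_three_halves:
  fixes B :: real
  assumes "B > 0"
  shows "(\<integral>\<^sup>+y. ennreal (pi / (2 * ((B + y\<^sup>2) * sqrt (B + y\<^sup>2)))) \<partial>lborel) = ennreal (pi / B)"
proof -
  have pos: "B + y\<^sup>2 > 0" for y :: real using assms by (simp add: add_pos_nonneg)
  \<comment> \<open>Up to the factor pi / 2, the antiderivative of the power -3/2 of
    \<open>B + y\<^sup>2\<close>.\<close>
  define F where "F y = pi * y / (2 * B * sqrt (B + y\<^sup>2))" for y
  have "(\<integral>\<^sup>+y. ennreal (pi / (2 * ((B + y\<^sup>2) * sqrt (B + y\<^sup>2)))) \<partial>lborel) = ennreal (pi / (2 * B) - (- pi / (2 * B)))"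
  proof (rule nn_integral_FTC_UNIV[where F=F])
    fix y :: real
    define r where "r = sqrt (B + y\<^sup>2)"
    have r: "r > 0" "r * r = B + y * y" "r\<^sup>2 = B + y\<^sup>2"
      using pos[of y] by (auto simp: r_def power2_eq_square)
    have "(F has_real_derivative (pi * (2 * B * r) - pi * y * (2 * B * (inverse r / 2 * (2 * y)))) / (2 * B * r)\<^sup>2) (at y)"
      unfolding F_def r_def using pos[of y] assms
      by (auto intro!: derivative_eq_intros simp: power2_eq_square)
    also have "(pi * (2 * B * r) - pi * y * (2 * B * (inverse r / 2 * (2 * y)))) / (2 * B * r)\<^sup>2 =
        pi / (2 * ((B + y\<^sup>2) * sqrt (B + y\<^sup>2)))"
    proof -
      have "pi * (2 * B * r) - pi * y * (2 * B * (inverse r / 2 * (2 * y))) = 2 * B * (r * r - y * y) * pi / r"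
        using r(1) by (simp add: field_simps)
      also have "r * r - y * y = B" using r(2) by simp
      finally have "pi * (2 * B * r) - pi * y * (2 * B * (inverse r / 2 * (2 * y))) = 2 * B * B * pi / r" .
      then show ?thesis
        unfolding r_def[symmetric] r(3)[symmetric] using r(1) assms by (simp add: field_simps power2_eq_square)
    qed
    finally show "(F has_real_derivative pi / (2 * ((B + y\<^sup>2) * sqrt (B + y\<^sup>2)))) (at y)" .
  next
    show "continuous_on UNIV (\<lambda>y. pi / (2 * ((B + y\<^sup>2) * sqrt (B + y\<^sup>2))))"
      using pos by (intro continuous_intros) (auto simp: less_imp_neq[symmetric])
    have "(F \<longlongrightarrow> pi * inverse B / 2) at_top" unfolding F_def using assms by real_asymp
    moreover have "pi * inverse B / 2 = pi / (2 * B)" using assms by (simp add: field_simps)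
    ultimately show "(F \<longlongrightarrow> pi / (2 * B)) at_top" by simp
    have "(F \<longlongrightarrow> - (pi * inverse B / 2)) at_bot" unfolding F_def using assms by real_asymp
    moreover have "- (pi * inverse B / 2) = - pi / (2 * B)" using assms by (simp add: field_simps)
    ultimately show "(F \<longlongrightarrow> - pi / (2 * B)) at_bot" by simp
  qed (use pos in \<open>auto simp: less_imp_le\<close>)
  then show ?thesis by (simp add: field_simps)
qed

lemma emeasure_lborel_Times_open:
  fixes A :: "'a::euclidean_space set" and B :: "'b::euclidean_space set"
  assumes "open A" "open B"
  shows "emeasure lborel (A \<times> B) = emeasure lborel A * emeasure lborel B"
  unfolding lborel_prod[symmetric] using assms
  by (intro lborel.emeasure_pair_measure_Times) auto

lemma distr_lborel_vector_3:
  "distr (lborel :: (real \<times> real \<times> real) measure) borel (\<lambda>(x, y, z). vector [x, y, z] :: real^3) = lborel"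
proof (rule lborel_eqI[symmetric])
  let ?T = "\<lambda>(x, y, z). vector [x, y, z] :: real^3"
  have T[measurable]: "?T \<in> borel_measurable borel"
    unfolding case_prod_beta by (intro borel_measurable_continuous_onI continuous_intros)
  fix l u :: "real^3"
  assume lu: "\<And>b. b \<in> Basis \<Longrightarrow> l \<bullet> b \<le> u \<bullet> b"
  have le: "l $ i \<le> u $ i" for i
    using lu[of "axis i 1"] by (simp add: inner_axis axis_in_Basis_iff)
  have "?T -` box l u = {l$1<..<u$1} \<times> {l$2<..<u$2} \<times> {l$3<..<u$3}"
    by (auto simp: mem_box_cart forall_3)
  then have "emeasure (distr lborel borel ?T) (box l u) =
      emeasure lborel ({l$1<..<u$1} \<times> ({l$2<..<u$2} \<times> {l$3<..<u$3}))"
    by (subst emeasure_distr) auto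
  also have "\<dots> = emeasure lborel {l$1<..<u$1} * emeasure lborel ({l$2<..<u$2} \<times> {l$3<..<u$3})"
    by (intro emeasure_lborel_Times_open open_Times open_greaterThanLessThan)
  also have "emeasure lborel ({l$2<..<u$2} \<times> {l$3<..<u$3}) = emeasure lborel {l$2<..<u$2} * emeasure lborel {l$3<..<u$3}"
    by (intro emeasure_lborel_Times_open open_Times open_greaterThanLessThan)
  also have "emeasure lborel {l$1<..<u$1} * (emeasure lborel {l$2<..<u$2} * emeasure lborel {l$3<..<u$3}) =
      ennreal ((u$1 - l$1) * ((u$2 - l$2) * (u$3 - l$3)))"
    by (simp only: emeasure_lborel_Ioo[OF le] ennreal_mult diff_ge_0_iff_ge le mult_nonneg_nonneg)
  also have "(u$1 - l$1) * ((u$2 - l$2) * (u$3 - l$3)) = (\<Prod>i\<in>UNIV. u $ i - l $ i)"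
    unfolding UNIV_3 by simp
  also have "ennreal \<dots> = emeasure lborel (box l u)"
    by (rule emeasure_lborel_box_vec[OF le, symmetric])
  also have "\<dots> = (\<Prod>b\<in>Basis. (u - l) \<bullet> b)"
    using lu by (subst emeasure_lborel_box) auto
  finally show "emeasure (distr lborel borel ?T) (box l u) = (\<Prod>b\<in>Basis. (u - l) \<bullet> b)" .
qed simp

lemma nn_integral_real_3:
  assumes [measurable]: "f \<in> borel_measurable borel"
  shows "(\<integral>\<^sup>+p. f p \<partial>(lborel :: (real^3) measure)) =
    (\<integral>\<^sup>+x. (\<integral>\<^sup>+y. (\<integral>\<^sup>+z. f (vector [x, y, z]) \<partial>lborel) \<partial>lborel) \<partial>lborel)"
proof -
  let ?T = "\<lambda>(x, y, z). vector [x, y, z] :: real^3"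
  have T[measurable]: "?T \<in> borel_measurable borel"
    unfolding case_prod_beta by (intro borel_measurable_continuous_onI continuous_intros)
  have "(\<integral>\<^sup>+p. f p \<partial>(lborel :: (real^3) measure)) = (\<integral>\<^sup>+q. f (?T q) \<partial>lborel)"
    by (subst distr_lborel_vector_3[symmetric]) (simp add: nn_integral_distr)
  also have "\<dots> = (\<integral>\<^sup>+x. (\<integral>\<^sup>+q. f (?T (x, q)) \<partial>lborel) \<partial>lborel)"
    by (subst lborel_prod[symmetric], subst lborel.nn_integral_fst[symmetric]) (simp_all add: lborel_prod)
  also have "\<dots> = (\<integral>\<^sup>+x. (\<integral>\<^sup>+y. (\<integral>\<^sup>+z. f (?T (x, y, z)) \<partial>lborel) \<partial>lborel) \<partial>lborel)"
  proof (rule nn_integral_cong)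
    show "(\<integral>\<^sup>+q. f (?T (x, q)) \<partial>lborel) = (\<integral>\<^sup>+y. (\<integral>\<^sup>+z. f (?T (x, y, z)) \<partial>lborel) \<partial>lborel)" for x
    proof -
      have "(\<lambda>q. ?T (x, q)) \<in> borel_measurable borel"
        unfolding case_prod_beta by (intro borel_measurable_continuous_onI continuous_intros)
      then have "(\<lambda>q. f (?T (x, q))) \<in> borel_measurable borel"
        using assms by (rule measurable_compose)
      then show ?thesis
        by (subst lborel_prod[symmetric], subst lborel.nn_integral_fst[symmetric]) (simp_all add: lborel_prod)
    qed
  qed
  finally show ?thesis by simp
qed

text \<open>The round volume of the 3-sphere of unit quaternions in gnomonic coordinates: a rotation
  by angle t about the unit vector n has Cayley coordinate tan(t/2) n, the quotient of the vector
  part by the real part. The total mass pi^2 is the volume of a hemisphere.\<close>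

definition spin_density :: "real^3 \<Rightarrow> real" where
  "spin_density y = 1 / (1 + (y$1)\<^sup>2 + (y$2)\<^sup>2 + (y$3)\<^sup>2)\<^sup>2"

lemma spin_density_nonneg: "0 \<le> spin_density y"
  by (simp add: spin_density_def)

lemma spin_density_measurable [measurable]: "spin_density \<in> borel_measurable borel"
  unfolding spin_density_def by measurable

lemma has_bochner_integral_spin_density: "has_bochner_integral lborel spin_density (pi\<^sup>2)"
proof (rule has_bochner_integral_nn_integral)
  have "(\<integral>\<^sup>+y. ennreal (spin_density y) \<partial>lborel) =
      (\<integral>\<^sup>+x. (\<integral>\<^sup>+y. (\<integral>\<^sup>+z. ennreal (1 / ((1 + x\<^sup>2 + y\<^sup>2) + z\<^sup>2)\<^sup>2) \<partial>lborel) \<partial>lborel) \<partial>lborel)"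
    by (subst nn_integral_real_3) (simp_all add: spin_density_def)
  also have "\<dots> = (\<integral>\<^sup>+x. (\<integral>\<^sup>+y. ennreal (pi / (2 * (((1 + x\<^sup>2) + y\<^sup>2) * sqrt ((1 + x\<^sup>2) + y\<^sup>2)))) \<partial>lborel) \<partial>lborel)"
    by (intro nn_integral_cong nn_integral_inverse_square_quadratic) (simp add: add_pos_nonneg)
  also have "\<dots> = (\<integral>\<^sup>+x. ennreal (pi / (1 + x\<^sup>2)) \<partial>lborel)"
    by (intro nn_integral_cong nn_integral_inverse_three_halves) (simp add: add_pos_nonneg)
  also have "\<dots> = ennreal (pi * (pi / 2) - pi * (- (pi / 2)))"
  proof (rule nn_integral_FTC_UNIV)
    show "((\<lambda>x. pi * arctan x) has_real_derivative pi / (1 + x\<^sup>2)) (at x)" for x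
      by (auto intro!: derivative_eq_intros simp: divide_inverse)
    show "continuous_on UNIV (\<lambda>x. pi / (1 + x\<^sup>2))"
      by (intro continuous_intros) (auto simp: add_nonneg_eq_0_iff)
    show "((\<lambda>x. pi * arctan x) \<longlongrightarrow> pi * (pi / 2)) at_top"
      by (intro tendsto_intros tendsto_arctan_at_top)
    show "((\<lambda>x. pi * arctan x) \<longlongrightarrow> pi * (- (pi / 2))) at_bot"
      by (intro tendsto_intros tendsto_arctan_at_bot)
  qed (simp add: add_nonneg_nonneg)
  finally show "(\<integral>\<^sup>+y. ennreal (spin_density y) \<partial>lborel) = ennreal (pi\<^sup>2)"
    by (simp add: power2_eq_square)
qed (auto simp: spin_density_nonneg)


subsection \<open>Maps into the rotation group\<close>

lemma has_derivative_vec: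
  fixes f :: "'a::euclidean_space \<Rightarrow> 'n::finite \<Rightarrow> real"
  assumes "\<And>i. ((\<lambda>x. f x i) has_derivative (\<lambda>v. f' v i)) (at x)"
  shows "((\<lambda>x. \<chi> i. f x i) has_derivative (\<lambda>v. \<chi> i. f' v i)) (at x)"
  unfolding has_derivative_componentwise_within[of "\<lambda>x. \<chi> i. f x i"]
  using assms by (auto simp: Basis_vec_def inner_axis)

locale so3_map =
  fixes h :: "real^3 \<Rightarrow> real^3^3"
  assumes C2_h: "\<And>i j. C2 UNIV (\<lambda>p. h p $ i $ j)"
    and orth: "\<And>p. transpose (h p) ** h p = mat 1"
    and det_h: "\<And>p. det (h p) = 1"
begin

lemma cols: "(\<Sum>k\<in>UNIV. h p $ k $ i * h p $ k $ j) = (if i = j then 1 else 0)"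
proof -
  have "(transpose (h p) ** h p) $ i $ j = mat 1 $ i $ j" by (simp only: orth)
  then show ?thesis by (simp add: matrix_matrix_mult_def transpose_def mat_def)
qed

lemma rows: "(\<Sum>k\<in>UNIV. h p $ i $ k * h p $ j $ k) = (if i = j then 1 else 0)"
proof -
  have "h p ** transpose (h p) = mat 1" using orth matrix_left_right_inverse by blast
  then have "(h p ** transpose (h p)) $ i $ j = mat 1 $ i $ j" by simp
  then show ?thesis by (simp add: matrix_matrix_mult_def transpose_def mat_def)
qed

lemma column_eqI:
  assumes "transpose (h p) *v m = axis i 1"
  shows "m = column i (h p)"
proof -
  have "h p ** transpose (h p) = mat 1" using orth matrix_left_right_inverse by blast
  then have "m = (h p ** transpose (h p)) *v m" by simp
  also have "\<dots> = h p *v axis i 1"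
    by (simp only: matrix_vector_mul_assoc[symmetric] assms)
  also have "\<dots> = column i (h p)"
    by (rule matrix_vector_mult_basis)
  finally show ?thesis .
qed

text \<open>Each column of a rotation is the cross product of the other two. A vector is identified
  by its dot products with the three columns, and these are given by orthogonality and the
  determinant.\<close>

lemma cofactor_rels:
  "h p$2$2 * h p$3$3 - h p$3$2 * h p$2$3 = h p$1$1"
  "h p$3$2 * h p$1$3 - h p$1$2 * h p$3$3 = h p$2$1"
  "h p$1$2 * h p$2$3 - h p$2$2 * h p$1$3 = h p$3$1"
  "h p$2$3 * h p$3$1 - h p$3$3 * h p$2$1 = h p$1$2"
  "h p$3$3 * h p$1$1 - h p$1$3 * h p$3$1 = h p$2$2"
  "h p$1$3 * h p$2$1 - h p$2$3 * h p$1$1 = h p$3$2"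
  "h p$2$1 * h p$3$2 - h p$3$1 * h p$2$2 = h p$1$3"
  "h p$3$1 * h p$1$2 - h p$1$1 * h p$3$2 = h p$2$3"
  "h p$1$1 * h p$2$2 - h p$2$1 * h p$1$2 = h p$3$3"
proof -
  note d = det_h[of p, unfolded det_3]
  let ?m1 = "vector [h p$2$2 * h p$3$3 - h p$3$2 * h p$2$3, h p$3$2 * h p$1$3 - h p$1$2 * h p$3$3,
    h p$1$2 * h p$2$3 - h p$2$2 * h p$1$3] :: real^3"
  have "transpose (h p) *v ?m1 = axis 1 1"
    using d by (simp add: vec_eq_iff forall_3 matrix_vector_mult_def transpose_def sum_3 axis_def algebra_simps)
  from column_eqI[OF this] show "h p$2$2 * h p$3$3 - h p$3$2 * h p$2$3 = h p$1$1"
    "h p$3$2 * h p$1$3 - h p$1$2 * h p$3$3 = h p$2$1" "h p$1$2 * h p$2$3 - h p$2$2 * h p$1$3 = h p$3$1"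
    by (simp_all add: vec_eq_iff forall_3 column_def)
  let ?m2 = "vector [h p$2$3 * h p$3$1 - h p$3$3 * h p$2$1, h p$3$3 * h p$1$1 - h p$1$3 * h p$3$1,
    h p$1$3 * h p$2$1 - h p$2$3 * h p$1$1] :: real^3"
  have "transpose (h p) *v ?m2 = axis 2 1"
    using d by (simp add: vec_eq_iff forall_3 matrix_vector_mult_def transpose_def sum_3 axis_def algebra_simps)
  from column_eqI[OF this] show "h p$2$3 * h p$3$1 - h p$3$3 * h p$2$1 = h p$1$2"
    "h p$3$3 * h p$1$1 - h p$1$3 * h p$3$1 = h p$2$2" "h p$1$3 * h p$2$1 - h p$2$3 * h p$1$1 = h p$3$2"
    by (simp_all add: vec_eq_iff forall_3 column_def)
  let ?m3 = "vector [h p$2$1 * h p$3$2 - h p$3$1 * h p$2$2, h p$3$1 * h p$1$2 - h p$1$1 * h p$3$2,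
    h p$1$1 * h p$2$2 - h p$2$1 * h p$1$2] :: real^3"
  have "transpose (h p) *v ?m3 = axis 3 1"
    using d by (simp add: vec_eq_iff forall_3 matrix_vector_mult_def transpose_def sum_3 axis_def algebra_simps)
  from column_eqI[OF this] show "h p$2$1 * h p$3$2 - h p$3$1 * h p$2$2 = h p$1$3"
    "h p$3$1 * h p$1$2 - h p$1$1 * h p$3$2 = h p$2$3" "h p$1$1 * h p$2$2 - h p$2$1 * h p$1$2 = h p$3$3"
    by (simp_all add: vec_eq_iff forall_3 column_def)
qed

lemmas row_rels = rows[of _ 1 1, simplified sum_3, simplified] rows[of _ 1 2, simplified sum_3, simplified]
  rows[of _ 1 3, simplified sum_3, simplified] rows[of _ 2 2, simplified sum_3, simplified]
  rows[of _ 2 3, simplified sum_3, simplified] rows[of _ 3 3, simplified sum_3, simplified]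

lemmas col_rels = cols[of _ 1 1, simplified sum_3, simplified] cols[of _ 1 2, simplified sum_3, simplified]
  cols[of _ 1 3, simplified sum_3, simplified] cols[of _ 2 2, simplified sum_3, simplified]
  cols[of _ 2 3, simplified sum_3, simplified] cols[of _ 3 3, simplified sum_3, simplified]

definition H :: "3 \<Rightarrow> 3 \<Rightarrow> 3 \<Rightarrow> real^3 \<Rightarrow> real" where
  "H k i j = fr k (\<lambda>p. h p $ i $ j)"

lemma diff_h: "(\<lambda>p. h p $ i $ j) differentiable at p"
  using C1_diffD[OF C2_C1[OF C2_h]] by simp

lemma C1_h: "C1 UNIV (\<lambda>p. h p $ i $ j)"
  using C2_C1[OF C2_h] .

lemma C1_H: "C1 UNIV (H k i j)"
  unfolding H_def by (rule C2_fr[OF open_UNIV C2_h])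

text \<open>The vector \<open>(tv k 1, tv k 2, tv k 3)\<close> is the axial vector of the skew matrix \<open>h\<^sup>T E\<^sub>k(h)\<close>.\<close>

definition tv :: "3 \<Rightarrow> 3 \<Rightarrow> real^3 \<Rightarrow> real" where
  "tv k i p = (let (r, s) = (if i = 1 then (3, 2) else if i = 2 then (1, 3) else (2, 1)) in
     \<Sum>a\<in>UNIV. h p $ a $ r * H k a s p)"

lemma C1_tv: "C1 UNIV (tv k i)"
proof -
  have "C1 UNIV (\<lambda>p. tv k i p)"
    unfolding tv_def by (auto simp: case_prod_beta Let_def intro!: C1_sum C1_mult C1_h C1_H)
  then show ?thesis .
qed

text \<open>Differentiate the constant \<open>transpose (h p) ** h p\<close>.\<close>

lemma skew: "(\<Sum>a\<in>UNIV. h p $ a $ i * H k a j p) + (\<Sum>a\<in>UNIV. h p $ a $ j * H k a i p) = 0"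
proof -
  have "fr k (\<lambda>p. \<Sum>a\<in>UNIV. h p $ a $ i * h p $ a $ j) p = 0"
    unfolding cols by (rule fr_const)
  then show ?thesis
    unfolding sum_3 by (simp add: fr_add fr_mult diff_h differentiable_mult H_def algebra_simps)
qed

text \<open>By orthogonality the derivative of h is h times the skew matrix with axial vector t, and
  multiplication by a skew matrix is a cross product.\<close>

lemma H_eq:
  "H k i 1 p = h p$i$2 * tv k 3 p - h p$i$3 * tv k 2 p"
  "H k i 2 p = h p$i$3 * tv k 1 p - h p$i$1 * tv k 3 p"
  "H k i 3 p = h p$i$1 * tv k 2 p - h p$i$2 * tv k 1 p"
proof -
  define X where "X b j = (\<Sum>a\<in>UNIV. h p $ a $ b * H k a j p)" for b j
  have exp: "H k i j p = h p$i$1 * X 1 j + h p$i$2 * X 2 j + h p$i$3 * X 3 j" for j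
  proof -
    have "h p$i$1 * X 1 j + h p$i$2 * X 2 j + h p$i$3 * X 3 j =
        (\<Sum>b\<in>UNIV. \<Sum>a\<in>UNIV. (h p $ i $ b * h p $ a $ b) * H k a j p)"
      by (simp add: X_def sum_3 algebra_simps)
    also have "\<dots> = (\<Sum>a\<in>UNIV. \<Sum>b\<in>UNIV. (h p $ i $ b * h p $ a $ b) * H k a j p)"
      by (rule sum.swap)
    also have "\<dots> = (\<Sum>a\<in>UNIV. (if i = a then 1 else 0) * H k a j p)"
      unfolding sum_distrib_right[symmetric] rows ..
    also have "\<dots> = H k i j p" using exhaust_3[of i] by (auto simp: sum_3)
    finally show ?thesis by simp
  qed
  have sk: "X i j + X j i = 0" for i j using skew[of p i k j] by (simp add: X_def)
  have t: "tv k 1 p = X 3 2" "tv k 2 p = X 1 3" "tv k 3 p = X 2 1"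
    by (simp_all add: tv_def X_def)
  have d: "X 1 1 = 0" "X 2 2 = 0" "X 3 3 = 0" using sk[of 1 1] sk[of 2 2] sk[of 3 3] by simp_all
  have o: "X 2 3 = - X 3 2" "X 3 1 = - X 1 3" "X 1 2 = - X 2 1"
    using sk[of 2 3] sk[of 3 1] sk[of 1 2] by linarith+
  show "H k i 1 p = h p$i$2 * tv k 3 p - h p$i$3 * tv k 2 p"
    "H k i 2 p = h p$i$3 * tv k 1 p - h p$i$1 * tv k 3 p"
    "H k i 3 p = h p$i$1 * tv k 2 p - h p$i$2 * tv k 1 p"
    unfolding exp t d o by simp_all
qed

text \<open>The pull-back by h of the invariant volume form of SO(3), evaluated on X, Y, Z.\<close>

definition tdet :: "real^3 \<Rightarrow> real" where
  "tdet p = det (\<chi> k i. tv k i p)"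

lemma C1_tdet: "C1 UNIV tdet"
proof -
  have "C1 UNIV (\<lambda>p. tdet p)"
    unfolding tdet_def det_3 by (simp add: C1_add C1_diff C1_mult C1_tv)
  then show ?thesis .
qed

text \<open>\<open>chart\<close> inverts the Cayley parametrisation \<open>y \<mapsto> (I - [y])\<^sup>-\<^sup>1 (I + [y])\<close> of the rotations by an
  angle other than \<open>\<pi>\<close>; these are the ones with \<open>wt \<noteq> 0\<close>.\<close>

definition wt :: "real^3 \<Rightarrow> real" where
  "wt p = 1 + h p$1$1 + h p$2$2 + h p$3$3"

text \<open>The axial vector of h minus its transpose: 2 sin(t) times the axis of a rotation by t,
  while \<open>wt\<close> is 2 + 2 cos(t).\<close>

definition ax :: "3 \<Rightarrow> real^3 \<Rightarrow> real" where
  "ax i p = (if i = 1 then h p$3$2 - h p$2$3 else if i = 2 then h p$1$3 - h p$3$1 else h p$2$1 - h p$1$2)"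

lemma ax_expand: "ax 1 p = h p$3$2 - h p$2$3" "ax 2 p = h p$1$3 - h p$3$1" "ax 3 p = h p$2$1 - h p$1$2"
  by (simp_all add: ax_def)

definition chart :: "real^3 \<Rightarrow> real^3" where
  "chart p = (\<chi> i. ax i p / wt p)"

definition Udom :: "(real^3) set" where
  "Udom = {p. wt p \<noteq> 0}"

lemma C2_wt: "C2 UNIV wt"
proof -
  have "C2 UNIV (\<lambda>p. wt p)"
    unfolding wt_def by (intro C2_add C2_const C2_h open_UNIV)
  then show ?thesis .
qed

lemma C2_ax: "C2 UNIV (ax i)"
proof -
  have "C2 UNIV (ax 1)" "C2 UNIV (ax 2)" "C2 UNIV (ax 3)"
    unfolding ax_def by (simp_all add: C2_diff C2_h)
  then show ?thesis using exhaust_3[of i] by metis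
qed

lemma open_Udom: "open Udom"
  unfolding Udom_def by (rule open_Collect_neq[OF C1_contD[OF C2_C1[OF C2_wt]] continuous_on_const])

lemma C2_chart: "C2 Udom (\<lambda>p. chart p $ i)"
  unfolding chart_def using open_Udom
  by (simp, intro C2_divide C2_subset[OF C2_ax] C2_subset[OF C2_wt]) (auto simp: Udom_def)

text \<open>Rodrigues' formula with denominators cleared: ax ax^T = wt (h + h^T + (2 - wt) I). It
  stays valid at half turns, where it forces \<open>ax\<close> to vanish.\<close>

lemma ax_rels:
  "ax 1 p * ax 1 p = wt p * (2 * h p$1$1 + 2 - wt p)"
  "ax 2 p * ax 2 p = wt p * (2 * h p$2$2 + 2 - wt p)"
  "ax 3 p * ax 3 p = wt p * (2 * h p$3$3 + 2 - wt p)"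
  "ax 1 p * ax 2 p = wt p * (h p$1$2 + h p$2$1)"
  "ax 1 p * ax 3 p = wt p * (h p$1$3 + h p$3$1)"
  "ax 2 p * ax 3 p = wt p * (h p$2$3 + h p$3$2)"
  using row_rels[of p] col_rels[of p] cofactor_rels[of p]
  unfolding ax_expand wt_def by (simp_all add: algebra_simps)


text \<open>The half-angle identity 1 + tan^2 = 1 / cos^2, obtained as the trace of
  \<open>ax_rels\<close>. It shows that the chart leaves every bounded set as \<open>wt\<close>
  tends to 0.\<close>

lemma wt_chart: "wt p \<noteq> 0 \<Longrightarrow> wt p * (1 + (chart p $ 1)\<^sup>2 + (chart p $ 2)\<^sup>2 + (chart p $ 3)\<^sup>2) = 4"
proof -
  assume w: "wt p \<noteq> 0"
  have "ax 1 p * ax 1 p + ax 2 p * ax 2 p + ax 3 p * ax 3 p = wt p * (4 - wt p)"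
    unfolding ax_rels by (simp add: wt_def algebra_simps)
  moreover have "wt p * wt p * (1 + (chart p $ 1)\<^sup>2 + (chart p $ 2)\<^sup>2 + (chart p $ 3)\<^sup>2) =
      wt p * wt p + (ax 1 p * ax 1 p + ax 2 p * ax 2 p + ax 3 p * ax 3 p)"
    using w by (simp add: chart_def field_simps power2_eq_square)
  ultimately have "wt p * (wt p * (1 + (chart p $ 1)\<^sup>2 + (chart p $ 2)\<^sup>2 + (chart p $ 3)\<^sup>2)) = wt p * 4"
    by (simp add: algebra_simps)
  then show ?thesis using w by simp
qed

lemma wt_pos: "wt p \<noteq> 0 \<Longrightarrow> wt p > 0"
proof -
  assume w: "wt p \<noteq> 0"
  have "1 + (chart p $ 1)\<^sup>2 + (chart p $ 2)\<^sup>2 + (chart p $ 3)\<^sup>2 > 0"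
    by (intro add_pos_nonneg) auto
  then show ?thesis using wt_chart[OF w] by (metis zero_less_mult_pos2 zero_less_numeral)
qed

lemma fr_wt: "fr k wt p = - (ax 1 p * tv k 1 p + ax 2 p * tv k 2 p + ax 3 p * tv k 3 p)"
proof -
  have "fr k (\<lambda>p. wt p) p = H k 1 1 p + H k 2 2 p + H k 3 3 p"
    unfolding wt_def H_def by (simp add: fr_add diff_h)
  then show ?thesis by (simp add: H_eq ax_expand algebra_simps)
qed

lemma fr_ax:
  "fr k (ax 1) p = (h p$2$2 + h p$3$3) * tv k 1 p - h p$2$1 * tv k 2 p - h p$3$1 * tv k 3 p"
  "fr k (ax 2) p = (h p$1$1 + h p$3$3) * tv k 2 p - h p$1$2 * tv k 1 p - h p$3$2 * tv k 3 p"
  "fr k (ax 3) p = (h p$1$1 + h p$2$2) * tv k 3 p - h p$1$3 * tv k 1 p - h p$2$3 * tv k 2 p"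
proof -
  have "ax 1 = (\<lambda>p. h p$3$2 - h p$2$3)" "ax 2 = (\<lambda>p. h p$1$3 - h p$3$1)" "ax 3 = (\<lambda>p. h p$2$1 - h p$1$2)"
    by (auto simp: ax_expand fun_eq_iff)
  then have "fr k (ax 1) p = H k 3 2 p - H k 2 3 p" "fr k (ax 2) p = H k 1 3 p - H k 3 1 p"
    "fr k (ax 3) p = H k 2 1 p - H k 1 2 p"
    by (simp_all add: fr_diff diff_h H_def)
  then show "fr k (ax 1) p = (h p$2$2 + h p$3$3) * tv k 1 p - h p$2$1 * tv k 2 p - h p$3$1 * tv k 3 p"
    "fr k (ax 2) p = (h p$1$1 + h p$3$3) * tv k 2 p - h p$1$2 * tv k 1 p - h p$3$2 * tv k 3 p"
    "fr k (ax 3) p = (h p$1$1 + h p$2$2) * tv k 3 p - h p$1$3 * tv k 1 p - h p$2$3 * tv k 2 p"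
    by (simp_all add: H_eq algebra_simps)
qed

text \<open>\<open>I + a a\<^sup>T + [a]\<close>, the cofactor matrix of \<open>I + [a]\<close>, where \<open>a = chart p\<close>.\<close>

definition cayley :: "real^3 \<Rightarrow> real^3^3" where
  "cayley p = (let a = chart p in vector [
     vector [1 + a$1 * a$1, a$1 * a$2 - a$3, a$1 * a$3 + a$2],
     vector [a$2 * a$1 + a$3, 1 + a$2 * a$2, a$2 * a$3 - a$1],
     vector [a$3 * a$1 - a$2, a$3 * a$2 + a$1, 1 + a$3 * a$3]])"

lemma det_cayley: "det (cayley p) = (1 + (chart p $ 1)\<^sup>2 + (chart p $ 2)\<^sup>2 + (chart p $ 3)\<^sup>2)\<^sup>2"
  by (simp add: cayley_def Let_def det_3 power2_eq_square algebra_simps)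

text \<open>The kinematic equation of the Rodrigues parameters, da = (I + a a^T + [a]) t / 2, from
  the quotient rule and \<open>ax_rels\<close>.\<close>

lemma fr_chart:
  assumes "p \<in> Udom"
  shows "fr k (\<lambda>p. chart p $ i) p = (1/2) * (\<Sum>m\<in>UNIV. cayley p $ i $ m * tv k m p)"
proof -
  have w: "wt p \<noteq> 0" using assms by (simp add: Udom_def)
  define q where "q m = ax m p / wt p" for m
  define t where "t m = tv k m p" for m
  have ax: "ax m p = wt p * q m" for m using w by (simp add: q_def)
  have "fr k (\<lambda>p. ax i p / wt p) p = (fr k (ax i) p * wt p - ax i p * fr k wt p) / (wt p * wt p)"
    using C1_diffD[OF C2_C1[OF C2_ax]] C1_diffD[OF C2_C1[OF C2_wt]] w by (intro fr_divide) auto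
  also have "\<dots> = fr k (ax i) p / wt p + q i * (q 1 * t 1 + q 2 * t 2 + q 3 * t 3)"
    unfolding fr_wt ax using w by (simp add: field_simps t_def)
  finally have 1: "fr k (\<lambda>p. chart p $ i) p = fr k (ax i) p / wt p + q i * (q 1 * t 1 + q 2 * t 2 + q 3 * t 3)"
    by (simp add: chart_def)
  \<comment> \<open>After multiplication by \<open>wt p\<close>, products of two chart coordinates
    become linear in the entries of \<open>h\<close>, so what remains is a polynomial
    identity.\<close>
  have rel: "wt p * (q 1 * q 1) = 2 * h p$1$1 + 2 - wt p" "wt p * (q 2 * q 2) = 2 * h p$2$2 + 2 - wt p"
    "wt p * (q 3 * q 3) = 2 * h p$3$3 + 2 - wt p" "wt p * (q 1 * q 2) = h p$1$2 + h p$2$1"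
    "wt p * (q 1 * q 3) = h p$1$3 + h p$3$1" "wt p * (q 2 * q 3) = h p$2$3 + h p$3$2"
    using ax_rels[of p] w unfolding ax by (simp_all add: mult_ac)
  have q: "wt p * q 1 = h p$3$2 - h p$2$3" "wt p * q 2 = h p$1$3 - h p$3$1" "wt p * q 3 = h p$2$1 - h p$1$2"
    unfolding ax[symmetric] by (simp_all add: ax_expand)
  have tr: "wt p = 1 + h p$1$1 + h p$2$2 + h p$3$3" by (simp add: wt_def)
  have i1: "wt p * ((1/2) * ((1 + q 1 * q 1) * t 1 + (q 1 * q 2 - q 3) * t 2 + (q 1 * q 3 + q 2) * t 3)) =
      fr k (ax 1) p + wt p * (q 1 * (q 1 * t 1 + q 2 * t 2 + q 3 * t 3))"
  proof -
    have "2 * (wt p * ((1/2) * ((1 + q 1 * q 1) * t 1 + (q 1 * q 2 - q 3) * t 2 + (q 1 * q 3 + q 2) * t 3))) =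
        (wt p + wt p * (q 1 * q 1)) * t 1 + (wt p * (q 1 * q 2) - wt p * q 3) * t 2 + (wt p * (q 1 * q 3) + wt p * q 2) * t 3"
      by (simp add: algebra_simps)
    moreover have "2 * (fr k (ax 1) p + wt p * (q 1 * (q 1 * t 1 + q 2 * t 2 + q 3 * t 3))) =
        2 * fr k (ax 1) p + 2 * ((wt p * (q 1 * q 1)) * t 1 + (wt p * (q 1 * q 2)) * t 2 + (wt p * (q 1 * q 3)) * t 3)"
      by (simp add: algebra_simps)
    ultimately show ?thesis unfolding rel q fr_ax t_def[symmetric] by (simp add: tr algebra_simps)
  qed
  have i2: "wt p * ((1/2) * ((q 2 * q 1 + q 3) * t 1 + (1 + q 2 * q 2) * t 2 + (q 2 * q 3 - q 1) * t 3)) =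
      fr k (ax 2) p + wt p * (q 2 * (q 1 * t 1 + q 2 * t 2 + q 3 * t 3))"
  proof -
    have "2 * (wt p * ((1/2) * ((q 2 * q 1 + q 3) * t 1 + (1 + q 2 * q 2) * t 2 + (q 2 * q 3 - q 1) * t 3))) =
        (wt p * (q 1 * q 2) + wt p * q 3) * t 1 + (wt p + wt p * (q 2 * q 2)) * t 2 + (wt p * (q 2 * q 3) - wt p * q 1) * t 3"
      by (simp add: algebra_simps)
    moreover have "2 * (fr k (ax 2) p + wt p * (q 2 * (q 1 * t 1 + q 2 * t 2 + q 3 * t 3))) =
        2 * fr k (ax 2) p + 2 * ((wt p * (q 1 * q 2)) * t 1 + (wt p * (q 2 * q 2)) * t 2 + (wt p * (q 2 * q 3)) * t 3)"
      by (simp add: algebra_simps)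
    ultimately show ?thesis unfolding rel q fr_ax t_def[symmetric] by (simp add: tr algebra_simps)
  qed
  have i3: "wt p * ((1/2) * ((q 3 * q 1 - q 2) * t 1 + (q 3 * q 2 + q 1) * t 2 + (1 + q 3 * q 3) * t 3)) =
      fr k (ax 3) p + wt p * (q 3 * (q 1 * t 1 + q 2 * t 2 + q 3 * t 3))"
  proof -
    have "2 * (wt p * ((1/2) * ((q 3 * q 1 - q 2) * t 1 + (q 3 * q 2 + q 1) * t 2 + (1 + q 3 * q 3) * t 3))) =
        (wt p * (q 1 * q 3) - wt p * q 2) * t 1 + (wt p * (q 2 * q 3) + wt p * q 1) * t 2 + (wt p + wt p * (q 3 * q 3)) * t 3"
      by (simp add: algebra_simps)
    moreover have "2 * (fr k (ax 3) p + wt p * (q 3 * (q 1 * t 1 + q 2 * t 2 + q 3 * t 3))) =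
        2 * fr k (ax 3) p + 2 * ((wt p * (q 1 * q 3)) * t 1 + (wt p * (q 2 * q 3)) * t 2 + (wt p * (q 3 * q 3)) * t 3)"
      by (simp add: algebra_simps)
    ultimately show ?thesis unfolding rel q fr_ax t_def[symmetric] by (simp add: tr algebra_simps)
  qed
  have c: "chart p $ m = q m" for m by (simp add: chart_def q_def)
  have cancel: "x = a / wt p + b" if "wt p * x = a + wt p * b" for x a b
    using that w by (simp add: field_simps)
  consider "i = 1" | "i = 2" | "i = 3" using exhaust_3[of i] by blast
  then show ?thesis
    unfolding 1 sum_3 cayley_def Let_def c t_def[symmetric]
    by cases (simp_all add: cancel[OF i1, symmetric] cancel[OF i2, symmetric] cancel[OF i3, symmetric])
qed

text \<open>X, Y, Z differ from the coordinate fields by a unipotent matrix, so the Jacobian may be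
  computed with either.\<close>

lemma det_frame_derivatives:
  assumes "\<And>i. f i differentiable at p"
  shows "det (\<chi> k i. fr k (f i) p :: real^3^3) = det (matrix (\<lambda>v. \<chi> i. dd (f i) p v))"
  unfolding det_3 matrix_def by (simp add: fr_axis[OF assms] algebra_simps)

lemma has_derivative_chart:
  assumes "p \<in> Udom"
  shows "(chart has_derivative (\<lambda>v. \<chi> i. dd (\<lambda>q. chart q $ i) p v)) (at p)"
proof -
  have "((\<lambda>q. \<chi> i. chart q $ i) has_derivative (\<lambda>v. \<chi> i. dd (\<lambda>q. chart q $ i) p v)) (at p)"
    by (rule has_derivative_vec) (use C1_diffD[OF C2_C1[OF C2_chart] assms] has_derivative_dd in blast)
  then show ?thesis by simp
qed

sublocale C1_map Udom chart "\<lambda>p v. \<chi> i. dd (\<lambda>q. chart q $ i) p v"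
proof
  show "open Udom" by (rule open_Udom)
  show "(chart has_derivative (\<lambda>v. \<chi> i. dd (\<lambda>q. chart q $ i) x v)) (at x)" if "x \<in> Udom" for x
    using has_derivative_chart[OF that] .
  show "continuous_on Udom (\<lambda>x. \<chi> i. dd (\<lambda>q. chart q $ i) x v)" for v
    by (intro continuous_on_vec_lambda C1_dd_contD[OF C2_C1[OF C2_chart]])
qed

lemma J_frame: "p \<in> Udom \<Longrightarrow> J p = det (\<chi> k i. fr k (\<lambda>q. chart q $ i) p)"
  unfolding J_def
  by (rule det_frame_derivatives[symmetric]) (rule C1_diffD[OF C2_C1[OF C2_chart]])

lemma J_eq:
  assumes "p \<in> Udom"
  shows "J p = (1/8) * (1 + (chart p $ 1)\<^sup>2 + (chart p $ 2)\<^sup>2 + (chart p $ 3)\<^sup>2)\<^sup>2 * tdet p"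
proof -
  have "(\<chi> k i. fr k (\<lambda>q. chart q $ i) p) = (\<chi> k i. tv k i p) ** ((1/2) *\<^sub>R transpose (cayley p))"
    unfolding fr_chart[OF assms]
    by (simp add: vec_eq_iff matrix_matrix_mult_def transpose_def sum_distrib_left mult_ac)
  then have "J p = tdet p * det ((1/2) *\<^sub>R transpose (cayley p))"
    using J_frame[OF assms] by (simp add: det_mul tdet_def)
  also have "det ((1/2) *\<^sub>R transpose (cayley p)) = (1/8) * det (transpose (cayley p))"
    by (simp add: det_3 algebra_simps)
  also have "det (transpose (cayley p)) = (1 + (chart p $ 1)\<^sup>2 + (chart p $ 2)\<^sup>2 + (chart p $ 3)\<^sup>2)\<^sup>2"
    by (simp only: det_transpose det_cayley)
  finally show ?thesis by simp
qed

text \<open>The invariant density cancels the unbounded factor of the Jacobian. The 8 is the cube of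
  the 2 in \<open>fr_chart\<close>, and 8 times pi^2 is the volume of SO(3).\<close>

lemma J_spin_density: "p \<in> Udom \<Longrightarrow> J p * spin_density (chart p) = tdet p / 8"
proof -
  assume p: "p \<in> Udom"
  have "1 + (chart p $ 1)\<^sup>2 + (chart p $ 2)\<^sup>2 + (chart p $ 3)\<^sup>2 \<noteq> 0"
    using wt_chart[of p] p by (auto simp: Udom_def)
  then show ?thesis unfolding J_eq[OF p] spin_density_def by simp
qed

text \<open>Where \<open>tdet\<close> is nonzero the chart has invertible derivative, so preimages
  of null sets are null.\<close>

lemma negligible_chart_hyperplane: "negligible {p \<in> Udom. chart p $ i = 0 \<and> tdet p \<noteq> 0}"
proof -
  have "negligible {p \<in> {p \<in> Udom. tdet p \<noteq> 0}. chart p \<in> {y. axis i 1 \<bullet> y = 0}}"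
  proof (rule negligible_differentiable_vimage)
    show "negligible {y :: real^3. axis i 1 \<bullet> y = 0}"
      by (rule negligible_hyperplane) (simp add: axis_eq_0_iff)
    fix p assume p: "p \<in> {p \<in> Udom. tdet p \<noteq> 0}"
    then have d: "(chart has_derivative (\<lambda>v. \<chi> i. dd (\<lambda>q. chart q $ i) p v)) (at p)"
      using has_derivative_chart by simp
    then show "(chart has_derivative (\<lambda>v. \<chi> i. dd (\<lambda>q. chart q $ i) p v)) (at p within {p \<in> Udom. tdet p \<noteq> 0})"
      by (rule has_derivative_at_withinI)
    have "tdet p / 8 \<noteq> 0" using p by simp
    then have "J p \<noteq> 0" using J_spin_density[of p] p by auto
    then show "inj (\<lambda>v. \<chi> i. dd (\<lambda>q. chart q $ i) p v)"
      unfolding J_def using det_nz_iff_inj[OF has_derivative_linear[OF d]] by blast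
  qed
  then show ?thesis by (simp add: inner_axis' conj_commute conj_left_commute Collect_conj_eq)
qed

end

section \<open>Half turns as a null set\<close>

context so3_map
begin

text \<open>Left multiplication by a constant diagonal rotation stays in SO(3).\<close>

lemma so3_map_flip:
  assumes s: "\<And>i. \<sigma> i * \<sigma> i = 1" "\<sigma> 1 * \<sigma> 2 * \<sigma> (3::3) = 1"
  shows "so3_map (\<lambda>p. \<chi> i j. \<sigma> i * h p $ i $ j)"
proof
  show "C2 UNIV (\<lambda>p. (\<chi> i j. \<sigma> i * h p $ i $ j) $ i $ j)" for i j
    by (simp add: C2_mult C2_const C2_h)
  fix p
  have sq: "(\<sigma> k * x) * (\<sigma> k * y) = x * y" for k x y
    using s(1)[of k] by (metis mult.assoc mult.commute mult.left_commute mult_1)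
  show "transpose (\<chi> i j. \<sigma> i * h p $ i $ j) ** (\<chi> i j. \<sigma> i * h p $ i $ j) = mat 1"
    by (simp add: vec_eq_iff matrix_matrix_mult_def transpose_def sq cols mat_def)
  have "det (\<chi> i j. \<sigma> i * h p $ i $ j) = (\<sigma> 1 * \<sigma> 2 * \<sigma> 3) * det (h p)"
    by (simp add: det_3 algebra_simps)
  then show "det (\<chi> i j. \<sigma> i * h p $ i $ j) = 1" by (simp add: s(2) det_h)
qed

text \<open>The form h^-1 dh is unchanged when h is multiplied on the left by a constant.\<close>

lemma tdet_flip:
  assumes s: "\<And>i. \<sigma> i * \<sigma> i = 1" "\<sigma> 1 * \<sigma> 2 * \<sigma> (3::3) = 1"
  shows "so3_map.tdet (\<lambda>p. \<chi> i j. \<sigma> i * h p $ i $ j) = tdet"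
proof -
  interpret f: so3_map "\<lambda>p. \<chi> i j. \<sigma> i * h p $ i $ j" by (rule so3_map_flip[OF s])
  have H: "f.H k i j p = \<sigma> i * H k i j p" for k i j p
    unfolding f.H_def H_def by (simp add: fr_mult diff_h)
  have sq: "(\<sigma> k * x) * (\<sigma> k * y) = x * y" for k x y
    using s(1)[of k] by (metis mult.assoc mult.commute mult.left_commute mult_1)
  have "f.tv k i p = tv k i p" for k i p
    unfolding f.tv_def tv_def H by (simp add: case_prod_beta Let_def sq)
  then show ?thesis by (auto simp: fun_eq_iff f.tdet_def tdet_def)
qed

text \<open>Where \<open>wt\<close> vanishes, \<open>h\<close> is a half turn; a sign change of two rows moves it into the domain of
  the chart, onto a coordinate plane.\<close>

lemma negligible_half_turns: "negligible {p. wt p = 0 \<and> tdet p \<noteq> 0}"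
proof -
  \<comment> \<open>\<open>\<sigma> k\<close> is the diagonal of the half turn about the k-th
    coordinate axis.\<close>
  define \<sigma> :: "3 \<Rightarrow> 3 \<Rightarrow> real" where "\<sigma> k i = (if i = k then 1 else -1)" for k i
  have s: "\<sigma> k i * \<sigma> k i = 1" "\<sigma> k 1 * \<sigma> k 2 * \<sigma> k 3 = 1" for k i
    using exhaust_3[of k] by (auto simp: \<sigma>_def)
  define g where "g k = (\<lambda>p. \<chi> i j. \<sigma> k i * h p $ i $ j)" for k
  have so3: "so3_map (g k)" for k unfolding g_def by (rule so3_map_flip[OF s])
  have td: "so3_map.tdet (g k) = tdet" for k unfolding g_def by (rule tdet_flip[OF s])
  define N where "N k = {p \<in> so3_map.Udom (g k). so3_map.chart (g k) p $ k = 0 \<and> tdet p \<noteq> 0}" for k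
  have N: "negligible (N k)" for k
    using so3_map.negligible_chart_hyperplane[OF so3[of k], of k] by (simp only: td N_def)
  have "{p. wt p = 0 \<and> tdet p \<noteq> 0} \<subseteq> N 1 \<union> N 2 \<union> N 3"
  proof
    fix p assume "p \<in> {p. wt p = 0 \<and> tdet p \<noteq> 0}"
    then have p: "wt p = 0" "tdet p \<noteq> 0" by auto
    have "ax k p * ax k p = 0" for k
      using ax_rels(1-3)[of p] p(1) exhaust_3[of k] by auto
    then have ax0: "ax k p = 0" for k by simp
    have axk: "so3_map.ax (g k) k p = 0" for k
    proof -
      have "so3_map.ax (g k) 1 p = g k p$3$2 - g k p$2$3" "so3_map.ax (g k) 2 p = g k p$1$3 - g k p$3$1"
        "so3_map.ax (g k) 3 p = g k p$2$1 - g k p$1$2"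
        by (rule so3_map.ax_expand[OF so3])+
      moreover have "g k p $ i $ j = \<sigma> k i * h p $ i $ j" for i j by (simp add: g_def)
      moreover have "h p$3$2 = h p$2$3" "h p$1$3 = h p$3$1" "h p$2$1 = h p$1$2"
        using ax0[of 1] ax0[of 2] ax0[of 3] unfolding ax_expand by simp_all
      ultimately show ?thesis
        using exhaust_3[of k] by (elim disjE) (simp_all add: \<sigma>_def)
    qed
    have w: "so3_map.wt (g k) p = 1 + \<sigma> k 1 * h p$1$1 + \<sigma> k 2 * h p$2$2 + \<sigma> k 3 * h p$3$3" for k
      unfolding so3_map.wt_def[OF so3] by (simp add: g_def)
    \<comment> \<open>For each diagonal entry the three sign patterns add up to -1. So if
      \<open>wt\<close> vanishes, the three flipped weights add up to 4 and one of them is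
      nonzero.\<close>
    have "so3_map.wt (g 1) p + so3_map.wt (g 2) p + so3_map.wt (g 3) p = 4 - wt p"
      unfolding w wt_def by (simp add: \<sigma>_def)
    then obtain k where k: "so3_map.wt (g k) p \<noteq> 0" using p(1)
      by (metis add.right_neutral diff_zero zero_neq_numeral)
    have "p \<in> N k"
      unfolding N_def using k p(2) axk[of k]
      by (simp add: so3_map.Udom_def[OF so3] so3_map.chart_def[OF so3])
    then show "p \<in> N 1 \<union> N 2 \<union> N 3" using exhaust_3[of k] by auto
  qed
  then show ?thesis by (rule negligible_subset[rotated]) (intro negligible_Un N)
qed

lemma AE_Udom: "AE p in lborel. tdet p \<noteq> 0 \<longrightarrow> p \<in> Udom"
proof -
  have [measurable]: "wt \<in> borel_measurable borel" "tdet \<in> borel_measurable borel"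
    using C1_contD[OF C2_C1[OF C2_wt]] C1_contD[OF C1_tdet] by (auto intro: borel_measurable_continuous_onI)
  have "{p. wt p = 0 \<and> tdet p \<noteq> 0} \<in> sets borel" by measurable
  then have "{p. wt p = 0 \<and> tdet p \<noteq> 0} \<in> null_sets lborel"
    using negligible_half_turns by (simp add: negligible_iff_null_sets null_sets_completion_iff)
  then show ?thesis
    by (rule AE_I') (auto simp: Udom_def)
qed

end

text \<open>\<open>dF \<and> du \<and> dv = d(F du \<and> dv)\<close>, written in the left-invariant frame.\<close>

lemma divergence_cross_gradients:
  assumes S: "open S" "p \<in> S" and F: "C1 S F" and u: "C2 S u" and v: "C2 S v"
  shows "fr 1 (\<lambda>p. F p * (fr 2 u p * fr 3 v p - fr 3 u p * fr 2 v p)) p +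
      fr 2 (\<lambda>p. F p * (fr 3 u p * fr 1 v p - fr 1 u p * fr 3 v p)) p +
      fr 3 (\<lambda>p. F p * (fr 1 u p * fr 2 v p - fr 2 u p * fr 1 v p)) p =
    fr 1 F p * (fr 2 u p * fr 3 v p - fr 3 u p * fr 2 v p) +
    fr 2 F p * (fr 3 u p * fr 1 v p - fr 1 u p * fr 3 v p) +
    fr 3 F p * (fr 1 u p * fr 2 v p - fr 2 u p * fr 1 v p)"
proof -
  have d: "F differentiable at p" "fr k u differentiable at p" "fr k v differentiable at p" for k
    using C1_diffD[OF F S(2)] C1_diffD[OF C2_fr[OF S(1) u] S(2)] C1_diffD[OF C2_fr[OF S(1) v] S(2)] .
  have dm: "(\<lambda>p. fr i u p * fr j v p) differentiable at p" for i j
    by (intro differentiable_mult d)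
  have e: "fr k (\<lambda>p. F p * (fr i u p * fr j v p - fr j u p * fr i v p)) p =
      F p * (fr i u p * fr k (fr j v) p + fr k (fr i u) p * fr j v p
        - (fr j u p * fr k (fr i v) p + fr k (fr j u) p * fr i v p)) +
      fr k F p * (fr i u p * fr j v p - fr j u p * fr i v p)" for i j k
    by (simp add: fr_mult fr_diff d dm differentiable_diff)
  show ?thesis
    unfolding e fr_bracket[OF S u] fr_bracket[OF S v] by (simp add: algebra_simps)
qed

section \<open>The degree integral over the quotient\<close>

locale so3_quotient = nil_quotient \<Gamma> + so3_map h for \<Gamma> h +
  assumes invariant_h: "invariant h"
begin

lemma invariant_entry: "invariant (\<lambda>p. h p $ i $ j)"
  using invariant_h by (simp add: invariant_def)

lemma invariant_H: "invariant (H k i j)"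
  unfolding H_def by (rule invariant_fr[OF invariant_entry diff_h])

lemma invariant_tv: "invariant (tv k i)"
  unfolding invariant_def tv_def
  using invariantD[OF invariant_entry] invariantD[OF invariant_H] by (simp add: case_prod_beta Let_def)

lemma invariant_tdet: "invariant tdet"
  using invariantD[OF invariant_tv] by (simp add: invariant_def tdet_def)

lemma invariant_chart: "invariant wt" "invariant chart" "\<gamma> \<in> \<Gamma> \<Longrightarrow> nil_mult \<gamma> p \<in> Udom \<longleftrightarrow> p \<in> Udom"
  using invariantD[OF invariant_h] by (simp_all add: invariant_def wt_def chart_def ax_def Udom_def cong: if_cong)

text \<open>Stokes' theorem for the 2-form \<open>F(a) da\<^sub>j \<and> da\<^sub>k\<close>, \<open>a = chart\<close>, which extends by zero across
  the half turns because \<open>\<bar>a\<bar>\<close> tends to infinity there.\<close>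

lemma integral_pullback_exact:
  assumes b: "\<And>j. bump (\<phi> j)" and ijk: "(i, j, k) \<in> {(1, 2, 3), (2, 3, 1), (3, 1, 2 :: 3)}"
  shows "(\<integral>p. indicator (fdom \<inter> Udom) p * J p *
    (deriv (\<phi> i) (chart p $ i) * (\<phi> j (chart p $ j) * \<phi> k (chart p $ k))) \<partial>lborel) = 0"
proof -
  define F where "F p = \<phi> i (chart p $ i) * (\<phi> j (chart p $ j) * \<phi> k (chart p $ k))" for p
  define u where "u p = chart p $ j" for p
  define v where "v p = chart p $ k" for p
  have u2: "C2 Udom u" and v2: "C2 Udom v" unfolding u_def v_def by (rule C2_chart)+
  have F1: "C1 Udom F"
    unfolding F_def using b unfolding bump_def
    by (intro C1_mult C1_compose_real[OF C2_C1[OF C2_chart]]) blast+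
  have "\<exists>R. \<forall>y. R < \<bar>y\<bar> \<longrightarrow> \<phi> m y = 0" for m using b bump_def by blast
  then obtain R where R: "\<And>m y. R m < \<bar>y\<bar> \<Longrightarrow> \<phi> m y = 0" by metis
  define r where "r = 1 + (R 1)\<^sup>2 + (R 2)\<^sup>2 + (R 3)\<^sup>2"
  \<comment> \<open>By \<open>wt_chart\<close>, inside the domain this says that the squared norm of
    the chart exceeds the sum of the squares of the \<open>R m\<close>; so some coordinate lies
    outside its support. \<open>W\<close> is open and contains all half turns.\<close>
  define W where "W = {p. wt p * r < 4}"
  have r: "r > 0" unfolding r_def by (intro add_pos_nonneg) auto
  have F0: "F p = 0" if p: "p \<in> Udom" "p \<in> W" for p
  proof (rule ccontr)
    assume "F p \<noteq> 0"
    then have "\<phi> i (chart p $ i) \<noteq> 0 \<and> \<phi> j (chart p $ j) \<noteq> 0 \<and> \<phi> k (chart p $ k) \<noteq> 0"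
      by (simp add: F_def)
    then have "\<phi> m (chart p $ m) \<noteq> 0" for m using ijk exhaust_3[of m] by auto
    then have "\<bar>chart p $ m\<bar> \<le> R m" for m using R[of m "chart p $ m"] by force
    then have le: "(chart p $ m)\<^sup>2 \<le> (R m)\<^sup>2" for m
      by (metis abs_ge_zero power2_abs power_mono)
    have w: "wt p \<noteq> 0" using p(1) by (simp add: Udom_def)
    have "1 + (chart p $ 1)\<^sup>2 + (chart p $ 2)\<^sup>2 + (chart p $ 3)\<^sup>2 \<le> r"
      unfolding r_def by (intro add_mono le order_refl)
    then have "wt p * (1 + (chart p $ 1)\<^sup>2 + (chart p $ 2)\<^sup>2 + (chart p $ 3)\<^sup>2) \<le> wt p * r"
      using wt_pos[OF w] by (intro mult_left_mono) auto
    then show False using p(2) wt_chart[OF w] by (simp add: W_def)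
  qed
  have "continuous_on UNIV wt" using C1_contD[OF C2_C1[OF C2_wt]] .
  then have openW: "open W"
    unfolding W_def by (intro open_Collect_less continuous_intros)
  have UW: "UNIV = Udom \<union> W" by (auto simp: Udom_def W_def)
  \<comment> \<open>The components of the 2-form F du wedge dv in the left-invariant frame, extended
    by zero.\<close>
  define V where "V m n p = (if p \<in> Udom then F p * (fr m u p * fr n v p - fr n u p * fr m v p) else 0)" for m n p
  have C1V: "C1 UNIV (V m n)" for m n
    unfolding UW
  proof (rule C1_Un[OF _ _ open_Udom openW])
    show "C1 Udom (V m n)"
      by (rule C1_cong[OF open_Udom, where f="\<lambda>p. F p * (fr m u p * fr n v p - fr n u p * fr m v p)"])
         (auto simp: V_def intro!: C1_mult C1_diff F1 C2_fr open_Udom u2 v2)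
    show "C1 W (V m n)"
      by (rule C1_cong[OF openW, where f="\<lambda>_. 0"]) (auto simp: V_def F0)
  qed
  have invV: "invariant (V m n)" for m n
    unfolding invariant_def
  proof (intro ballI allI)
    fix \<gamma> p assume \<gamma>: "\<gamma> \<in> \<Gamma>"
    show "V m n (nil_mult \<gamma> p) = V m n p"
    proof (cases "p \<in> Udom")
      case True
      then have T: "nil_mult \<gamma> p \<in> Udom" using invariant_chart(3)[OF \<gamma>] by simp
      have iu: "invariant u" "invariant v" using invariant_chart(2) by (simp_all add: invariant_def u_def v_def)
      have "fr l u (nil_mult \<gamma> p) = fr l u p" "fr l v (nil_mult \<gamma> p) = fr l v p" for l
        using C1_diffD[OF C2_C1[OF u2]] C1_diffD[OF C2_C1[OF v2]] True T
        by (auto intro!: fr_translate iu \<gamma>)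
      moreover have "F (nil_mult \<gamma> p) = F p" using invariantD[OF invariant_chart(2) \<gamma>] by (simp add: F_def)
      ultimately show ?thesis using True T by (simp add: V_def)
    qed (use invariant_chart(3)[OF \<gamma>] in \<open>simp add: V_def\<close>)
  qed
  have intV: "(\<integral>p. indicator fdom p * fr l (V m n) p \<partial>lborel) = 0"
    "integrable lborel (\<lambda>p. indicator fdom p * fr l (V m n) p)" for l m n
  proof -
    show "(\<integral>p. indicator fdom p * fr l (V m n) p \<partial>lborel) = 0"
      by (rule integral_fr_eq_0[OF invV C1V])
    have c: "continuous_on UNIV (fr l (V m n))" by (rule C1_fr_cont[OF C1V])
    obtain M where "\<And>p. \<bar>fr l (V m n) p\<bar> \<le> M"
      using bounded_invariant[OF invariant_fr[OF invV] c] C1_diffD[OF C1V] by blast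
    then show "integrable lborel (\<lambda>p. indicator fdom p * fr l (V m n) p)"
      using c by (intro integrable_fdom borel_measurable_continuous_onI) auto
  qed
  have div: "indicator fdom p * fr 1 (V 2 3) p + indicator fdom p * fr 2 (V 3 1) p + indicator fdom p * fr 3 (V 1 2) p =
      indicator (fdom \<inter> Udom) p * J p * (deriv (\<phi> i) (chart p $ i) * (\<phi> j (chart p $ j) * \<phi> k (chart p $ k)))" for p
  proof (cases "p \<in> Udom")
    case True
    have eq: "fr l (V m n) p = fr l (\<lambda>p. F p * (fr m u p * fr n v p - fr n u p * fr m v p)) p" for l m n
      by (rule fr_cong[OF open_Udom True]) (simp add: V_def)
    have dc: "(\<lambda>p. chart p $ m) differentiable at p" for m
      using C1_diffD[OF C2_C1[OF C2_chart] True] .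
    have dp: "(\<lambda>p. \<phi> m (chart p $ m)) differentiable at p"
      "fr l (\<lambda>p. \<phi> m (chart p $ m)) p = deriv (\<phi> m) (chart p $ m) * fr l (\<lambda>p. chart p $ m) p" for m l
      using dd_compose_real(2)[OF dc bump_DERIV[OF b]] fr_compose_real[OF dc bump_DERIV[OF b]] by auto
    \<comment> \<open>The terms along du and dv disappear on wedging with du wedge dv; only the
      derivative of the \<open>i\<close>-th factor survives.\<close>
    have Ff: "fr l F p = deriv (\<phi> i) (chart p $ i) * (\<phi> j (chart p $ j) * \<phi> k (chart p $ k)) * fr l (\<lambda>p. chart p $ i) p +
      (\<phi> i (chart p $ i) * deriv (\<phi> j) (chart p $ j) * \<phi> k (chart p $ k)) * fr l u p +
      (\<phi> i (chart p $ i) * \<phi> j (chart p $ j) * deriv (\<phi> k) (chart p $ k)) * fr l v p" for l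
      unfolding F_def u_def v_def
      by (simp add: fr_mult dp differentiable_mult algebra_simps)
    have "fr 1 (V 2 3) p + fr 2 (V 3 1) p + fr 3 (V 1 2) p =
      deriv (\<phi> i) (chart p $ i) * (\<phi> j (chart p $ j) * \<phi> k (chart p $ k)) *
      (fr 1 (\<lambda>p. chart p $ i) p * (fr 2 u p * fr 3 v p - fr 3 u p * fr 2 v p) +
       fr 2 (\<lambda>p. chart p $ i) p * (fr 3 u p * fr 1 v p - fr 1 u p * fr 3 v p) +
       fr 3 (\<lambda>p. chart p $ i) p * (fr 1 u p * fr 2 v p - fr 2 u p * fr 1 v p))"
      unfolding eq divergence_cross_gradients[OF open_Udom True F1 u2 v2] Ff by (simp add: algebra_simps)
    also have "fr 1 (\<lambda>p. chart p $ i) p * (fr 2 u p * fr 3 v p - fr 3 u p * fr 2 v p) +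
       fr 2 (\<lambda>p. chart p $ i) p * (fr 3 u p * fr 1 v p - fr 1 u p * fr 3 v p) +
       fr 3 (\<lambda>p. chart p $ i) p * (fr 1 u p * fr 2 v p - fr 2 u p * fr 1 v p) = J p"
      unfolding J_frame[OF True] det_3 u_def v_def using ijk by (auto simp: algebra_simps)
    finally show ?thesis using True by (simp add: indicator_def algebra_simps)
  next
    case False
    then have "p \<in> W" using UW by blast
    have "fr l (V m n) p = fr l (\<lambda>_. 0) p" for l m n
      by (rule fr_cong[OF openW \<open>p \<in> W\<close>]) (simp add: V_def F0)
    then show ?thesis using False by simp
  qed
  have "(\<integral>p. indicator fdom p * fr 1 (V 2 3) p + indicator fdom p * fr 2 (V 3 1) p + indicator fdom p * fr 3 (V 1 2) p \<partial>lborel) = 0"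
    using intV by simp
  then show ?thesis unfolding div .
qed

text \<open>The degree theorem weighted by \<open>spin_density\<close>: the integrand becomes
  \<open>tdet / 8\<close> and the right-hand side the degree times pi^2.\<close>

lemma integral_tdet: "\<exists>n\<in>\<int>. (\<integral>p. indicator fdom p * tdet p \<partial>lborel) = 8 * pi\<^sup>2 * n"
proof -
  let ?S = "fdom \<inter> Udom"
  have cont: "continuous_on UNIV tdet" by (rule C1_contD[OF C1_tdet])
  have [measurable]: "wt \<in> borel_measurable borel" "tdet \<in> borel_measurable borel"
    using C1_contD[OF C2_C1[OF C2_wt]] cont by (auto intro: borel_measurable_continuous_onI)
  have "ax i \<in> borel_measurable borel" for i
    using C1_contD[OF C2_C1[OF C2_ax]] by (auto intro: borel_measurable_continuous_onI)
  then have [measurable]: "(\<lambda>p. ax i p) \<in> borel_measurable borel" for i by simp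
  have "(\<lambda>p. (ax 1 p / wt p) *\<^sub>R axis 1 1 + (ax 2 p / wt p) *\<^sub>R axis 2 1 + (ax 3 p / wt p) *\<^sub>R axis 3 1 :: real^3) \<in> borel_measurable borel"
    by measurable
  moreover have "(\<lambda>p. (ax 1 p / wt p) *\<^sub>R axis 1 1 + (ax 2 p / wt p) *\<^sub>R axis 2 1 + (ax 3 p / wt p) *\<^sub>R axis 3 1 :: real^3) = chart"
    by (simp add: fun_eq_iff vec_eq_iff forall_3 chart_def axis_def)
  ultimately have chart_m: "chart \<in> borel_measurable borel" by simp
  have S: "?S \<in> sets borel" "?S \<subseteq> Udom" using open_Udom by auto
  have "emeasure lborel ?S \<le> emeasure lborel fdom"
    by (rule emeasure_mono) auto
  then have Sfin: "emeasure lborel ?S < \<infinity>" using finite_fdom by (rule le_less_trans)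
  obtain M where M: "\<And>p. \<bar>tdet p\<bar> \<le> M" using bounded_invariant[OF invariant_tdet cont] by blast
  have bdd: "\<exists>K. \<forall>p\<in>?S. (\<forall>i. \<bar>chart p $ i\<bar> \<le> R) \<longrightarrow> \<bar>J p\<bar> \<le> K" for R
  proof (intro exI ballI impI)
    fix p assume p: "p \<in> ?S" "\<forall>i. \<bar>chart p $ i\<bar> \<le> R"
    have le: "(chart p $ i)\<^sup>2 \<le> R\<^sup>2" for i using p(2) by (metis abs_ge_zero power2_abs power_mono)
    have "(1 + (chart p $ 1)\<^sup>2 + (chart p $ 2)\<^sup>2 + (chart p $ 3)\<^sup>2)\<^sup>2 \<le> (1 + R\<^sup>2 + R\<^sup>2 + R\<^sup>2)\<^sup>2"
      by (intro power_mono add_mono le order_refl add_nonneg_nonneg) auto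
    then have "(1/8) * (1 + (chart p $ 1)\<^sup>2 + (chart p $ 2)\<^sup>2 + (chart p $ 3)\<^sup>2)\<^sup>2 * \<bar>tdet p\<bar> \<le>
        (1/8) * (1 + R\<^sup>2 + R\<^sup>2 + R\<^sup>2)\<^sup>2 * M"
      using M by (intro mult_mono) auto
    then show "\<bar>J p\<bar> \<le> (1/8) * (1 + R\<^sup>2 + R\<^sup>2 + R\<^sup>2)\<^sup>2 * M"
      using p(1) by (simp add: J_eq abs_mult)
  qed
  have stokes: "(\<integral>p. indicator ?S p * J p * (deriv (\<phi> i) (chart p $ i) *
      (\<Prod>j\<in>UNIV - {i}. \<phi> j (chart p $ j))) \<partial>lborel) = 0" if b: "\<And>j. bump (\<phi> j)" for i :: 3 and \<phi>
  proof -
    obtain j k :: 3 where ijk: "(i, j, k) \<in> {(1, 2, 3), (2, 3, 1), (3, 1, 2)}"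
      using exhaust_3[of i] by auto
    then have "UNIV - {i} = {j, k}" "j \<noteq> k" unfolding UNIV_3 by auto
    then show ?thesis using integral_pullback_exact[OF b ijk] by simp
  qed
  obtain n where n: "n \<in> \<int>" "\<And>\<kappa>. \<kappa> \<in> borel_measurable borel \<Longrightarrow> (\<And>y. 0 \<le> \<kappa> y) \<Longrightarrow> integrable lborel \<kappa> \<Longrightarrow>
      integrable lborel (\<lambda>x. indicator ?S x * J x * \<kappa> (chart x)) \<Longrightarrow>
      (\<integral>x. indicator ?S x * J x * \<kappa> (chart x) \<partial>lborel) = n * (\<integral>y. \<kappa> y \<partial>lborel)"
    using degree_integer[OF S Sfin chart_m bdd stokes] by blast
  have eq: "indicator ?S p * J p * spin_density (chart p) = indicator Udom p * (indicator fdom p * tdet p) / 8" for p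
    using J_spin_density[of p] by (auto simp: indicator_def)
  have int: "integrable lborel (\<lambda>p. indicator fdom p * tdet p)"
    by (rule integrable_fdom[OF _ M]) simp
  have Ub: "Udom \<in> sets borel" using open_Udom by simp
  have "integrable lborel (\<lambda>p. indicator Udom p *\<^sub>R (indicator fdom p * tdet p))"
    using int Ub by (intro integrable_mult_indicator) auto
  then have "integrable lborel (\<lambda>x. indicator ?S x * J x * spin_density (chart x))"
    unfolding eq by simp
  then have "(\<integral>x. indicator ?S x * J x * spin_density (chart x) \<partial>lborel) = n * pi\<^sup>2"
    using n(2)[OF spin_density_measurable spin_density_nonneg] has_bochner_integral_spin_density
    by (simp add: has_bochner_integral_iff)
  \<comment> \<open>Half turns either have \<open>tdet\<close> zero or lie in a null set.\<close>
  moreover have "(\<integral>p. indicator fdom p * tdet p \<partial>lborel) = (\<integral>p. indicator Udom p * (indicator fdom p * tdet p) \<partial>lborel)"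
  proof (rule integral_cong_AE)
    show "AE p in lborel. indicator fdom p * tdet p = indicator Udom p * (indicator fdom p * tdet p)"
      using AE_Udom by eventually_elim auto
  qed (use Ub in measurable)
  ultimately have "(\<integral>p. indicator fdom p * tdet p \<partial>lborel) = 8 * pi\<^sup>2 * n"
    unfolding eq by simp
  then show ?thesis using n(1) by blast
qed

end


subsection \<open>The Levi-Civita connection of Nil\<close>

lemma matrix_inv_eqI:
  fixes A B :: "real^'n^'n"
  assumes "A ** B = mat 1"
  shows "matrix_inv A = B"
proof -
  have BA: "B ** A = mat 1" using assms matrix_left_right_inverse by blast
  have "\<exists>A'. A ** A' = mat 1 \<and> A' ** A = mat 1" using assms BA by blast
  then have "A ** matrix_inv A = mat 1 \<and> matrix_inv A ** A = mat 1"
    unfolding matrix_inv_def by (rule someI_ex)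
  then show ?thesis by (metis assms matrix_mul_assoc matrix_mul_lid matrix_mul_rid)
qed

lemma gram_nil: "gram nil_metric p = vector [vector [1, 0, 0], vector [0, 1 + p$1 * p$1, - p$1], vector [0, - p$1, 1]]"
  by (simp add: gram_def nil_metric_def vec_eq_iff forall_3 axis_def)

lemma det_gram_nil: "det (gram nil_metric p) = 1"
  by (simp add: gram_nil det_3)

lemma matrix_inv_gram_nil:
  "matrix_inv (gram nil_metric p) = vector [vector [1, 0, 0], vector [0, 1, p$1], vector [0, p$1, 1 + p$1 * p$1]]"
  by (rule matrix_inv_eqI)
     (simp add: gram_nil matrix_matrix_mult_def mat_def vec_eq_iff forall_3 sum_3 algebra_simps)

lemma partial_gram_nil:
  "partial i (\<lambda>q. gram nil_metric q $ j $ l) p = (if i = 1 then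
     (if j = 2 \<and> l = 2 then 2 * p$1 else if (j = 2 \<and> l = 3) \<or> (j = 3 \<and> l = 2) then -1 else 0) else 0)"
proof -
  have d: "(\<lambda>q::real^3. q $ 1) differentiable at p"
    using C1_diffD[OF C1_nth[of UNIV]] by simp
  have v: "(axis i 1 :: real^3) $ 1 = (if i = 1 then 1 else 0)" by (simp add: axis_def)
  have 22: "dd (\<lambda>q::real^3. 1 + q$1 * q$1) p (axis i 1) = (if i = 1 then 2 * p$1 else 0)"
    by (simp add: dd_add dd_mult d differentiable_mult dd_nth v)
  have 23: "dd (\<lambda>q::real^3. - q$1) p (axis i 1) = (if i = 1 then -1 else 0)"
    by (simp add: dd_minus d dd_nth v)
  show ?thesis
    unfolding partial_def gram_nil using exhaust_3[of j] exhaust_3[of l] 22 23 by (elim disjE) simp_all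
qed

lemma covariant_deriv_nil:
  "covariant_deriv nil_metric v W p = dd W p v + vector
     [- p$1 * (v$2 * W p$2) + (v$2 * W p$3 + v$3 * W p$2) / 2,
      p$1 / 2 * (v$1 * W p$2 + v$2 * W p$1) - (v$1 * W p$3 + v$3 * W p$1) / 2,
      ((p$1 * p$1) - 1) / 2 * (v$1 * W p$2 + v$2 * W p$1) - p$1 / 2 * (v$1 * W p$3 + v$3 * W p$1)]"
  unfolding covariant_deriv_def christoffel_def matrix_inv_gram_nil partial_gram_nil
  by (simp add: sum_3 vec_eq_iff forall_3 algebra_simps add_divide_distrib diff_divide_distrib)

text \<open>The isomorphism of R^3 with so(3) under which the matrix acts as the cross product with
  \<open>u\<close>.\<close>

definition hat :: "(3 \<Rightarrow> real) \<Rightarrow> real^3^3" where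
  "hat u = vector [vector [0, - u 3, u 2], vector [u 3, 0, - u 1], vector [- u 2, u 1, 0]]"

lemma hat_add: "hat u + hat w = hat (\<lambda>i. u i + w i)"
  and hat_diff: "hat u - hat w = hat (\<lambda>i. u i - w i)"
  by (simp_all add: hat_def vec_eq_iff forall_3)

lemma dd_hat:
  assumes "\<And>i. f i differentiable at p"
  shows "dd (\<lambda>q. hat (\<lambda>i. f i q)) p v = hat (\<lambda>i. dd (f i) p v)"
proof -
  have lin: "linear (\<lambda>u::real^3. hat (($) u))"
    by (rule linearI) (simp_all add: hat_def vec_eq_iff forall_3)
  have "((\<lambda>q. \<chi> i. f i q) has_derivative (\<lambda>v. \<chi> i. dd (f i) p v)) (at p)"
    by (rule has_derivative_vec[OF has_derivative_dd[OF assms]])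
  from bounded_linear.has_derivative[OF lin[unfolded linear_conv_bounded_linear] this]
  have "((\<lambda>q. hat (($) (\<chi> i. f i q))) has_derivative (\<lambda>v. hat (($) (\<chi> i. dd (f i) p v)))) (at p)" .
  then show ?thesis by (intro dd_eqI) (simp add: hat_def)
qed

text \<open>The trace of a product is -2 times the dot product, and commutators are cross products.
  The cubic term therefore gives (2/3) times 3 times -2, that is -4, triple products.\<close>

lemma chern_simons_hat:
  "trace (hat a1 ** hat e23 - hat a2 ** hat e13 + hat a3 ** hat e12 +
     (2/3) *\<^sub>R (hat a1 ** (hat a2 ** hat a3 - hat a3 ** hat a2) - hat a2 ** (hat a1 ** hat a3 - hat a3 ** hat a1) +
       hat a3 ** (hat a1 ** hat a2 - hat a2 ** hat a1))) =
   -2 * ((a1 1 * e23 1 + a1 2 * e23 2 + a1 3 * e23 3) - (a2 1 * e13 1 + a2 2 * e13 2 + a2 3 * e13 3) +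
     (a3 1 * e12 1 + a3 2 * e12 2 + a3 3 * e12 3)) -
   4 * (a1 1 * (a2 2 * a3 3 - a2 3 * a3 2) + a1 2 * (a2 3 * a3 1 - a2 1 * a3 3) + a1 3 * (a2 1 * a3 2 - a2 2 * a3 1))"
  by (simp add: trace_def sum_3 matrix_matrix_mult_def hat_def algebra_simps)

section \<open>Connection and Chern-Simons form of an arbitrary frame\<close>

context so3_map
begin

definition sec :: "real^3 \<Rightarrow> real^3^3" where
  "sec p = nil_frame p ** h p"

lemma sec_nth: "sec p $ 1 $ j = h p$1$j" "sec p $ 2 $ j = h p$2$j" "sec p $ 3 $ j = h p$3$j + p$1 * h p$2$j"
  by (simp_all add: sec_def nil_frame_def matrix_matrix_mult_def sum_3)

text \<open>The metric dual coframe of \<open>X, Y, Z\<close> is \<open>dx, dy, dz - x dy\<close>.\<close>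

definition coframe :: "3 \<Rightarrow> real^3 \<Rightarrow> real^3 \<Rightarrow> real" where
  "coframe k p v = (if k = 3 then v$3 - p$1 * v$2 else v$k)"

lemma coframe_expand: "coframe 1 p v = v$1" "coframe 2 p v = v$2" "coframe 3 p v = v$3 - p$1 * v$2"
  by (simp_all add: coframe_def)

text \<open>In the frame \<open>X, Y, Z\<close> itself the connection form is \<open>hat\<close> of \<open>(\<theta>\<^sup>1, \<theta>\<^sup>2, - \<theta>\<^sup>3) / 2\<close>.\<close>

definition bv :: "3 \<Rightarrow> 3 \<Rightarrow> real^3 \<Rightarrow> real" where
  "bv k i p = (if k = 3 then - 1/2 else 1/2) * h p $ k $ i"

lemma bv_expand: "bv 1 i p = h p$1$i / 2" "bv 2 i p = h p$2$i / 2" "bv 3 i p = - (h p$3$i / 2)"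
  by (simp_all add: bv_def)

text \<open>The gauge transformation law at the level of axial vectors: \<open>tv\<close> for h^-1
  dh, \<open>bv\<close> for the conjugated connection of X, Y, Z.\<close>

definition cv :: "3 \<Rightarrow> 3 \<Rightarrow> real^3 \<Rightarrow> real" where
  "cv k i p = tv k i p + bv k i p"

lemma dd_coframe:
  assumes "f differentiable at p"
  shows "dd f p v = coframe 1 p v * fr 1 f p + coframe 2 p v * fr 2 f p + coframe 3 p v * fr 3 f p"
proof -
  have "v = v$1 *\<^sub>R axis 1 1 + v$2 *\<^sub>R axis 2 1 + v$3 *\<^sub>R axis 3 1"
    by (simp add: vec_eq_iff forall_3 axis_def)
  then have "dd f p v = dd f p (v$1 *\<^sub>R axis 1 1 + v$2 *\<^sub>R axis 2 1 + v$3 *\<^sub>R axis 3 1)"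
    by simp
  also have "\<dots> = v$1 * dd f p (axis 1 1) + v$2 * dd f p (axis 2 1) + v$3 * dd f p (axis 3 1)"
    using dd_linear[OF assms] by (simp add: linear_add linear_scale)
  finally show ?thesis by (simp add: fr_axis[OF assms] coframe_expand algebra_simps)
qed

lemma nil_metric_sec: "nil_metric p (column i (sec p)) w = h p$1$i * w$1 + h p$2$i * w$2 + h p$3$i * (w$3 - p$1 * w$2)"
  by (simp add: nil_metric_def column_def sec_nth)

lemma dd_column_sec:
  "dd (\<lambda>q. column j (sec q)) p v = vector [dd (\<lambda>q. h q$1$j) p v, dd (\<lambda>q. h q$2$j) p v,
     dd (\<lambda>q. h q$3$j) p v + p$1 * dd (\<lambda>q. h q$2$j) p v + v$1 * h p$2$j]"
proof -
  have d: "(\<lambda>q::real^3. q $ 1) differentiable at p"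
    using C1_diffD[OF C1_nth[of UNIV]] by simp
  have dsec: "(\<lambda>q. sec q $ i $ j) differentiable at p" for i
  proof -
    have "(\<lambda>q. sec q $ 1 $ j) differentiable at p" "(\<lambda>q. sec q $ 2 $ j) differentiable at p"
      "(\<lambda>q. sec q $ 3 $ j) differentiable at p"
      unfolding sec_nth by (simp_all add: diff_h d differentiable_mult)
    then show ?thesis using exhaust_3[of i] by auto
  qed
  have "((\<lambda>q. \<chi> i. sec q $ i $ j) has_derivative (\<lambda>v. \<chi> i. dd (\<lambda>q. sec q $ i $ j) p v)) (at p)"
    by (rule has_derivative_vec[OF has_derivative_dd[OF dsec]])
  then have "dd (\<lambda>q. column j (sec q)) p v = (\<chi> i. dd (\<lambda>q. sec q $ i $ j) p v)"
    unfolding column_def by (rule dd_eqI)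
  then show ?thesis
    by (simp add: vec_eq_iff forall_3 sec_nth dd_add dd_mult diff_h d differentiable_mult dd_nth)
qed

text \<open>The derivative of \<open>h\<close> contributes the skew matrix of t by column
  orthogonality. The Christoffel part consists of 2 by 2 minors of \<open>h\<close>, which are
  entries of \<open>h\<close> again; equivalently, conjugating \<open>hat u\<close> by a rotation
  rotates \<open>u\<close>.\<close>

lemma connection_form_sec:
  "connection_form nil_metric sec p v = hat (\<lambda>i. \<Sum>k\<in>UNIV. coframe k p v * cv k i p)"
proof -
  define T where "T i = coframe 1 p v * tv 1 i p + coframe 2 p v * tv 2 i p + coframe 3 p v * tv 3 i p" for i
  have dh: "dd (\<lambda>q. h q$a$1) p v = h p$a$2 * T 3 - h p$a$3 * T 2"
    "dd (\<lambda>q. h q$a$2) p v = h p$a$3 * T 1 - h p$a$1 * T 3"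
    "dd (\<lambda>q. h q$a$3) p v = h p$a$1 * T 2 - h p$a$2 * T 1" for a
    by (simp_all add: dd_coframe[OF diff_h] H_def[symmetric] H_eq T_def algebra_simps)
  have cf: "connection_form nil_metric sec p v $ i $ j =
      (h p$1$i * dd (\<lambda>q. h q$1$j) p v + h p$2$i * dd (\<lambda>q. h q$2$j) p v + h p$3$i * dd (\<lambda>q. h q$3$j) p v) +
      (coframe 1 p v * (h p$3$i * h p$2$j - h p$2$i * h p$3$j) + coframe 2 p v * (h p$1$i * h p$3$j - h p$3$i * h p$1$j) +
       coframe 3 p v * (h p$1$i * h p$2$j - h p$2$i * h p$1$j)) / 2" for i j
    unfolding connection_form_def covariant_deriv_nil dd_column_sec vec_lambda_beta nil_metric_sec
    by (simp add: coframe_expand column_def sec_nth algebra_simps add_divide_distrib diff_divide_distrib)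
  have dot: "h p$1$i * (x1 * y - x2 * z) + h p$2$i * (x3 * y - x4 * z) + h p$3$i * (x5 * y - x6 * z) =
      (h p$1$i * x1 + h p$2$i * x3 + h p$3$i * x5) * y - (h p$1$i * x2 + h p$2$i * x4 + h p$3$i * x6) * z"
    for i x1 x2 x3 x4 x5 x6 y z
    by (simp add: algebra_simps)
  have col: "h p$1$i * h p$1$j + h p$2$i * h p$2$j + h p$3$i * h p$3$j = (if i = j then 1 else 0)" for i j
    using cols[of p i j] by (simp add: sum_3)
  have part1: "h p$1$i * dd (\<lambda>q. h q$1$j) p v + h p$2$i * dd (\<lambda>q. h q$2$j) p v + h p$3$i * dd (\<lambda>q. h q$3$j) p v =
      hat T $ i $ j" for i j
  proof -
    have "j = 1 \<or> j = 2 \<or> j = 3" "i = 1 \<or> i = 2 \<or> i = 3" using exhaust_3 by auto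
    then show ?thesis
      by (elim disjE; hypsubst) (simp_all only: dh dot col, simp_all add: hat_def)
  qed
  have minors: "h p$3$i * h p$2$j - h p$2$i * h p$3$j = hat (($) (h p$1)) $ i $ j"
    "h p$1$i * h p$3$j - h p$3$i * h p$1$j = hat (($) (h p$2)) $ i $ j"
    "h p$1$i * h p$2$j - h p$2$i * h p$1$j = - (hat (($) (h p$3)) $ i $ j)" for i j
  proof -
    have ij: "j = 1 \<or> j = 2 \<or> j = 3" "i = 1 \<or> i = 2 \<or> i = 3" using exhaust_3 by auto
    show "h p$3$i * h p$2$j - h p$2$i * h p$3$j = hat (($) (h p$1)) $ i $ j"
      using ij by (elim disjE; hypsubst) (simp_all add: hat_def, insert cofactor_rels[of p], simp_all add: algebra_simps)
    show "h p$1$i * h p$3$j - h p$3$i * h p$1$j = hat (($) (h p$2)) $ i $ j"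
      using ij by (elim disjE; hypsubst) (simp_all add: hat_def, insert cofactor_rels[of p], simp_all add: algebra_simps)
    show "h p$1$i * h p$2$j - h p$2$i * h p$1$j = - (hat (($) (h p$3)) $ i $ j)"
      using ij by (elim disjE; hypsubst) (simp_all add: hat_def, insert cofactor_rels[of p], simp_all add: algebra_simps)
  qed
  have part2: "(coframe 1 p v * (h p$3$i * h p$2$j - h p$2$i * h p$3$j) + coframe 2 p v * (h p$1$i * h p$3$j - h p$3$i * h p$1$j) +
       coframe 3 p v * (h p$1$i * h p$2$j - h p$2$i * h p$1$j)) / 2 =
      hat (\<lambda>m. coframe 1 p v * bv 1 m p + coframe 2 p v * bv 2 m p + coframe 3 p v * bv 3 m p) $ i $ j" for i j
  proof -
    have "j = 1 \<or> j = 2 \<or> j = 3" "i = 1 \<or> i = 2 \<or> i = 3" using exhaust_3 by auto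
    then show ?thesis
      unfolding minors by (elim disjE; hypsubst) (simp_all add: hat_def bv_expand field_simps)
  qed
  have "connection_form nil_metric sec p v $ i $ j = hat (\<lambda>i. \<Sum>k\<in>UNIV. coframe k p v * cv k i p) $ i $ j" for i j
    unfolding cf part1 part2
    using arg_cong[OF hat_add[of T "\<lambda>m. coframe 1 p v * bv 1 m p + coframe 2 p v * bv 2 m p + coframe 3 p v * bv 3 m p"],
        of "\<lambda>M. M $ i $ j"]
    by (simp add: T_def sum_3 cv_def algebra_simps)
  then show ?thesis by (simp add: vec_eq_iff)
qed

lemma C1_bv: "C1 UNIV (bv k i)"
proof -
  have "C1 UNIV (\<lambda>p. bv k i p)" unfolding bv_def by (intro C1_mult C1_const C1_h)
  then show ?thesis .
qed

lemma diff_vectors: "tv k i differentiable at p" "bv k i differentiable at p" "cv k i differentiable at p"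
proof -
  show t: "tv k i differentiable at p" using C1_diffD[OF C1_tv] by simp
  show b: "bv k i differentiable at p" using C1_diffD[OF C1_bv] by simp
  have "(\<lambda>p. cv k i p) differentiable at p" unfolding cv_def using t b by simp
  then show "cv k i differentiable at p" .
qed

text \<open>Each \<open>bv k\<close> is a constant multiple of a row of \<open>h\<close>, so it
  inherits the cross product rule \<open>H_eq\<close>.\<close>

lemma fr_bv:
  "fr l (bv k 1) p = bv k 2 p * tv l 3 p - bv k 3 p * tv l 2 p"
  "fr l (bv k 2) p = bv k 3 p * tv l 1 p - bv k 1 p * tv l 3 p"
  "fr l (bv k 3) p = bv k 1 p * tv l 2 p - bv k 2 p * tv l 1 p"
proof -
  have b: "fr l (bv k i) p = (if k = 3 then - 1/2 else 1/2) * H l k i p" for i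
  proof -
    have "bv k i = (\<lambda>p. (if k = 3 then - 1/2 else 1/2) * h p $ k $ i)"
      by (simp add: fun_eq_iff bv_def)
    then show ?thesis by (simp add: fr_mult diff_h H_def)
  qed
  show "fr l (bv k 1) p = bv k 2 p * tv l 3 p - bv k 3 p * tv l 2 p"
    "fr l (bv k 2) p = bv k 3 p * tv l 1 p - bv k 1 p * tv l 3 p"
    "fr l (bv k 3) p = bv k 1 p * tv l 2 p - bv k 2 p * tv l 1 p"
    unfolding b by (simp_all add: H_eq bv_def algebra_simps)
qed

text \<open>Product rule for t = h^T dh. The second derivatives of \<open>h\<close> enter only
  through the commutator \<open>c\<close>, and the products of first derivatives reduce to cross
  products of t.\<close>

lemma fr_tv_bracket:
  fixes l k :: 3
  defines "c \<equiv> \<lambda>i j p. fr l (H k i j) p - fr k (H l i j) p"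
  shows "fr l (tv k 1) p - fr k (tv l 1) p = (\<Sum>a\<in>UNIV. h p$a$3 * c a 2 p) - (tv l 2 p * tv k 3 p - tv l 3 p * tv k 2 p)"
    "fr l (tv k 2) p - fr k (tv l 2) p = (\<Sum>a\<in>UNIV. h p$a$1 * c a 3 p) - (tv l 3 p * tv k 1 p - tv l 1 p * tv k 3 p)"
    "fr l (tv k 3) p - fr k (tv l 3) p = (\<Sum>a\<in>UNIV. h p$a$2 * c a 1 p) - (tv l 1 p * tv k 2 p - tv l 2 p * tv k 1 p)"
proof -
  have dH: "H k i j differentiable at p" for k i j using C1_diffD[OF C1_H] by simp
  have e: "fr l (\<lambda>p. \<Sum>a\<in>UNIV. h p $ a $ r * H k a s p) p = (\<Sum>a\<in>UNIV. h p $ a $ r * fr l (H k a s) p) +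
      (\<Sum>a\<in>UNIV. H l a r p * H k a s p)" for l k r s
    unfolding sum_3 by (simp add: fr_add fr_mult diff_h dH differentiable_mult differentiable_add H_def[symmetric] algebra_simps)
  have t: "tv k 1 = (\<lambda>p. \<Sum>a\<in>UNIV. h p $ a $ 3 * H k a 2 p)" "tv k 2 = (\<lambda>p. \<Sum>a\<in>UNIV. h p $ a $ 1 * H k a 3 p)"
    "tv k 3 = (\<lambda>p. \<Sum>a\<in>UNIV. h p $ a $ 2 * H k a 1 p)" for k
    by (simp_all add: fun_eq_iff tv_def)
  \<comment> \<open>After substituting \<open>H_eq\<close>, column orthogonality turns each product
    of first derivatives into products of components of t.\<close>
  have quad: "(\<Sum>a\<in>UNIV. (h p$a$i * x1 - h p$a$j * x2) * (h p$a$m * y1 - h p$a$n * y2)) =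
      (if i = m then x1 * y1 else 0) - (if i = n then x1 * y2 else 0) - (if j = m then x2 * y1 else 0) + (if j = n then x2 * y2 else 0)"
    for i j m n x1 x2 y1 y2
  proof -
    have "(\<Sum>a\<in>UNIV. (h p$a$i * x1 - h p$a$j * x2) * (h p$a$m * y1 - h p$a$n * y2)) =
       (\<Sum>a\<in>UNIV. h p$a$i * h p$a$m) * (x1 * y1) - (\<Sum>a\<in>UNIV. h p$a$i * h p$a$n) * (x1 * y2) -
       (\<Sum>a\<in>UNIV. h p$a$j * h p$a$m) * (x2 * y1) + (\<Sum>a\<in>UNIV. h p$a$j * h p$a$n) * (x2 * y2)"
      by (simp add: sum_3 algebra_simps)
    then show ?thesis unfolding cols by auto
  qed
  show "fr l (tv k 1) p - fr k (tv l 1) p = (\<Sum>a\<in>UNIV. h p$a$3 * c a 2 p) - (tv l 2 p * tv k 3 p - tv l 3 p * tv k 2 p)"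
    unfolding t(1)[of k] t(1)[of l] e c_def
    by (simp only: H_eq quad) (simp add: right_diff_distrib sum_subtractf)
  show "fr l (tv k 2) p - fr k (tv l 2) p = (\<Sum>a\<in>UNIV. h p$a$1 * c a 3 p) - (tv l 3 p * tv k 1 p - tv l 1 p * tv k 3 p)"
    unfolding t(2)[of k] t(2)[of l] e c_def
    by (simp only: H_eq quad) (simp add: right_diff_distrib sum_subtractf)
  show "fr l (tv k 3) p - fr k (tv l 3) p = (\<Sum>a\<in>UNIV. h p$a$2 * c a 1 p) - (tv l 1 p * tv k 2 p - tv l 2 p * tv k 1 p)"
    unfolding t(3)[of k] t(3)[of l] e c_def
    by (simp only: H_eq quad) (simp add: right_diff_distrib sum_subtractf)
qed

text \<open>The structure equations \<open>dt + t \<times> t / 2 = 0\<close> of the flat connection \<open>h\<^sup>-\<^sup>1 dh\<close>.\<close>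

lemma structure_equations:
  "fr 1 (tv 2 1) p - fr 2 (tv 1 1) p = tv 3 1 p - (tv 1 2 p * tv 2 3 p - tv 1 3 p * tv 2 2 p)"
  "fr 1 (tv 2 2) p - fr 2 (tv 1 2) p = tv 3 2 p - (tv 1 3 p * tv 2 1 p - tv 1 1 p * tv 2 3 p)"
  "fr 1 (tv 2 3) p - fr 2 (tv 1 3) p = tv 3 3 p - (tv 1 1 p * tv 2 2 p - tv 1 2 p * tv 2 1 p)"
  "fr 1 (tv 3 1) p - fr 3 (tv 1 1) p = - (tv 1 2 p * tv 3 3 p - tv 1 3 p * tv 3 2 p)"
  "fr 1 (tv 3 2) p - fr 3 (tv 1 2) p = - (tv 1 3 p * tv 3 1 p - tv 1 1 p * tv 3 3 p)"
  "fr 1 (tv 3 3) p - fr 3 (tv 1 3) p = - (tv 1 1 p * tv 3 2 p - tv 1 2 p * tv 3 1 p)"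
  "fr 2 (tv 3 1) p - fr 3 (tv 2 1) p = - (tv 2 2 p * tv 3 3 p - tv 2 3 p * tv 3 2 p)"
  "fr 2 (tv 3 2) p - fr 3 (tv 2 2) p = - (tv 2 3 p * tv 3 1 p - tv 2 1 p * tv 3 3 p)"
  "fr 2 (tv 3 3) p - fr 3 (tv 2 3) p = - (tv 2 1 p * tv 3 2 p - tv 2 2 p * tv 3 1 p)"
proof -
  have H: "H k i j = fr k (\<lambda>p. h p $ i $ j)" for k i j by (simp add: H_def fun_eq_iff)
  have c: "fr 1 (H 2 i j) p - fr 2 (H 1 i j) p = H 3 i j p" "fr 1 (H 3 i j) p - fr 3 (H 1 i j) p = 0"
    "fr 2 (H 3 i j) p - fr 3 (H 2 i j) p = 0" for i j
    unfolding H using fr_bracket[OF open_UNIV UNIV_I C2_h[of i j], of p] by simp_all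
  have t: "(\<Sum>a\<in>UNIV. h p$a$3 * H 3 a 2 p) = tv 3 1 p" "(\<Sum>a\<in>UNIV. h p$a$1 * H 3 a 3 p) = tv 3 2 p"
    "(\<Sum>a\<in>UNIV. h p$a$2 * H 3 a 1 p) = tv 3 3 p"
    by (simp_all add: tv_def)
  show "fr 1 (tv 2 1) p - fr 2 (tv 1 1) p = tv 3 1 p - (tv 1 2 p * tv 2 3 p - tv 1 3 p * tv 2 2 p)"
    "fr 1 (tv 2 2) p - fr 2 (tv 1 2) p = tv 3 2 p - (tv 1 3 p * tv 2 1 p - tv 1 1 p * tv 2 3 p)"
    "fr 1 (tv 2 3) p - fr 2 (tv 1 3) p = tv 3 3 p - (tv 1 1 p * tv 2 2 p - tv 1 2 p * tv 2 1 p)"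
    "fr 1 (tv 3 1) p - fr 3 (tv 1 1) p = - (tv 1 2 p * tv 3 3 p - tv 1 3 p * tv 3 2 p)"
    "fr 1 (tv 3 2) p - fr 3 (tv 1 2) p = - (tv 1 3 p * tv 3 1 p - tv 1 1 p * tv 3 3 p)"
    "fr 1 (tv 3 3) p - fr 3 (tv 1 3) p = - (tv 1 1 p * tv 3 2 p - tv 1 2 p * tv 3 1 p)"
    "fr 2 (tv 3 1) p - fr 3 (tv 2 1) p = - (tv 2 2 p * tv 3 3 p - tv 2 3 p * tv 3 2 p)"
    "fr 2 (tv 3 2) p - fr 3 (tv 2 2) p = - (tv 2 3 p * tv 3 1 p - tv 2 1 p * tv 3 3 p)"
    "fr 2 (tv 3 3) p - fr 3 (tv 2 3) p = - (tv 2 1 p * tv 3 2 p - tv 2 2 p * tv 3 1 p)"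
    unfolding fr_tv_bracket c t by simp_all
qed

text \<open>The components of the 2-form -1/2 Tr(h^-1 dh wedge h^-1 A h), the transgression term in
  the change of the Chern-Simons form.\<close>

definition tb :: "3 \<Rightarrow> 3 \<Rightarrow> real^3 \<Rightarrow> real" where
  "tb k l p = (tv k 1 p * bv l 1 p + tv k 2 p * bv l 2 p + tv k 3 p * bv l 3 p) -
     (tv l 1 p * bv k 1 p + tv l 2 p * bv k 2 p + tv l 3 p * bv k 3 p)"

lemma C1_tb: "C1 UNIV (tb k l)"
proof -
  have "C1 UNIV (\<lambda>p. tb k l p)" unfolding tb_def by (intro C1_add C1_diff C1_mult C1_tv C1_bv)
  then show ?thesis .
qed

lemma fr_tb: "fr m (tb k l) p =
  (tv k 1 p * fr m (bv l 1) p + fr m (tv k 1) p * bv l 1 p + (tv k 2 p * fr m (bv l 2) p + fr m (tv k 2) p * bv l 2 p) +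
   (tv k 3 p * fr m (bv l 3) p + fr m (tv k 3) p * bv l 3 p)) -
  (tv l 1 p * fr m (bv k 1) p + fr m (tv l 1) p * bv k 1 p + (tv l 2 p * fr m (bv k 2) p + fr m (tv l 2) p * bv k 2 p) +
   (tv l 3 p * fr m (bv k 3) p + fr m (tv l 3) p * bv k 3 p))"
proof -
  have "fr m (\<lambda>p. tb k l p) p = (tv k 1 p * fr m (bv l 1) p + fr m (tv k 1) p * bv l 1 p + (tv k 2 p * fr m (bv l 2) p + fr m (tv k 2) p * bv l 2 p) +
   (tv k 3 p * fr m (bv l 3) p + fr m (tv k 3) p * bv l 3 p)) -
  (tv l 1 p * fr m (bv k 1) p + fr m (tv l 1) p * bv k 1 p + (tv l 2 p * fr m (bv k 2) p + fr m (tv l 2) p * bv k 2 p) +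
   (tv l 3 p * fr m (bv k 3) p + fr m (tv l 3) p * bv k 3 p))"
    unfolding tb_def
    by (simp add: fr_diff fr_add fr_mult diff_vectors differentiable_mult differentiable_add)
  then show ?thesis .
qed


text \<open>The coordinate field d/dy is Y - x Z. Differentiating its coefficient x along X produces
  the isolated term \<open>cv 3\<close>, the trace of the bracket [X, Y] = Z.\<close>

lemma ext_deriv_sec:
  defines "\<theta> \<equiv> connection_form nil_metric sec"
  shows "ext_deriv \<theta> p (axis 2 1) (axis 3 1) = hat (\<lambda>i. fr 2 (cv 3 i) p - fr 3 (cv 2 i) p)"
    "ext_deriv \<theta> p (axis 1 1) (axis 3 1) = hat (\<lambda>i. fr 1 (cv 3 i) p - fr 3 (cv 1 i) p)"
    "ext_deriv \<theta> p (axis 1 1) (axis 2 1) = hat (\<lambda>i. fr 1 (cv 2 i) p - fr 2 (cv 1 i) p - cv 3 i p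
       - p$1 * (fr 1 (cv 3 i) p - fr 3 (cv 1 i) p))"
proof -
  have d: "(\<lambda>q::real^3. q $ 1) differentiable at p"
    using C1_diffD[OF C1_nth[of UNIV]] by simp
  note dm = differentiable_mult[OF d diff_vectors(3)]
  have \<theta>: "(\<lambda>q. \<theta> q (axis 1 1)) = (\<lambda>q. hat (\<lambda>i. cv 1 i q))"
    "(\<lambda>q. \<theta> q (axis 2 1)) = (\<lambda>q. hat (\<lambda>i. cv 2 i q - q$1 * cv 3 i q))"
    "(\<lambda>q. \<theta> q (axis 3 1)) = (\<lambda>q. hat (\<lambda>i. cv 3 i q))"
    by (simp_all add: \<theta>_def connection_form_sec sum_3 coframe_expand axis_def)
  have dd2: "dd (\<lambda>q. cv 2 i q - q$1 * cv 3 i q) p v = dd (cv 2 i) p v - (p$1 * dd (cv 3 i) p v + v$1 * cv 3 i p)" for i v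
    by (simp add: dd_diff dd_mult diff_vectors d dm dd_nth)
  have D: "dd (\<lambda>q. \<theta> q (axis 1 1)) p v = hat (\<lambda>i. dd (cv 1 i) p v)"
    "dd (\<lambda>q. \<theta> q (axis 2 1)) p v = hat (\<lambda>i. dd (cv 2 i) p v - (p$1 * dd (cv 3 i) p v + v$1 * cv 3 i p))"
    "dd (\<lambda>q. \<theta> q (axis 3 1)) p v = hat (\<lambda>i. dd (cv 3 i) p v)" for v
    unfolding \<theta> using diff_vectors(3) dm by (simp_all add: dd_hat dd2)
  have f: "dd (cv k i) p (axis 1 1) = fr 1 (cv k i) p" "dd (cv k i) p (axis 3 1) = fr 3 (cv k i) p"
    "dd (cv k i) p (axis 2 1) = fr 2 (cv k i) p - p$1 * fr 3 (cv k i) p" for k i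
    by (simp_all add: fr_axis[OF diff_vectors(3)])
  have ax: "(axis 1 1 :: real^3) $ 1 = 1" "(axis 2 1 :: real^3) $ 1 = 0" "(axis 3 1 :: real^3) $ 1 = 0"
    by (simp_all add: axis_def)
  show "ext_deriv \<theta> p (axis 2 1) (axis 3 1) = hat (\<lambda>i. fr 2 (cv 3 i) p - fr 3 (cv 2 i) p)"
    "ext_deriv \<theta> p (axis 1 1) (axis 3 1) = hat (\<lambda>i. fr 1 (cv 3 i) p - fr 3 (cv 1 i) p)"
    "ext_deriv \<theta> p (axis 1 1) (axis 2 1) = hat (\<lambda>i. fr 1 (cv 2 i) p - fr 2 (cv 1 i) p - cv 3 i p
       - p$1 * (fr 1 (cv 3 i) p - fr 3 (cv 1 i) p))"
    unfolding ext_deriv_def D f ax hat_diff by (simp_all add: algebra_simps)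
qed

text \<open>The vectors are rows of a rotation scaled by 1/2, 1/2, -1/2. These two values make the
  Chern-Simons form of X, Y, Z equal to 2/4 + 4/8 = 1.\<close>

lemma bv_volume:
  "bv 1 1 p * (bv 2 2 p * bv 3 3 p - bv 2 3 p * bv 3 2 p) + bv 1 2 p * (bv 2 3 p * bv 3 1 p - bv 2 1 p * bv 3 3 p) +
    bv 1 3 p * (bv 2 1 p * bv 3 2 p - bv 2 2 p * bv 3 1 p) = - 1/8"
  "bv 3 1 p * bv 3 1 p + bv 3 2 p * bv 3 2 p + bv 3 3 p * bv 3 3 p = 1/4"
  using det_h[of p] row_rels(6)[of p] by (simp_all add: bv_expand det_3 field_simps)

text \<open>Since \<open>\<omega> = h\<^sup>-\<^sup>1 dh + h\<^sup>-\<^sup>1 A h\<close>, the Chern-Simons form changes by a multiple of the volume of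
  \<open>h\<^sup>-\<^sup>1 dh\<close> and an exact form, given here by \<open>tb\<close>.\<close>

lemma chern_simons_form_sec:
  "chern_simons_form nil_metric sec p (axis 1 1) (axis 2 1) (axis 3 1) =
    1 + 2 * tdet p + 2 * (fr 1 (tb 2 3) p + fr 2 (tb 3 1) p + fr 3 (tb 1 2) p)"
proof -
  define t where "t k i = tv k i p" for k i
  define b where "b k i = bv k i p" for k i
  define D12 where "D12 i = fr 1 (tv 2 i) p - fr 2 (tv 1 i) p" for i
  define D13 where "D13 i = fr 1 (tv 3 i) p - fr 3 (tv 1 i) p" for i
  define D23 where "D23 i = fr 2 (tv 3 i) p - fr 3 (tv 2 i) p" for i
  define E12 where "E12 i = fr 1 (bv 2 i) p - fr 2 (bv 1 i) p" for i
  define E13 where "E13 i = fr 1 (bv 3 i) p - fr 3 (bv 1 i) p" for i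
  define E23 where "E23 i = fr 2 (bv 3 i) p - fr 3 (bv 2 i) p" for i
  define c where "c k i = t k i + b k i" for k i
  define dot where "dot u v = u 1 * v 1 + u 2 * v 2 + u 3 * (v 3 :: real)" for u v :: "3 \<Rightarrow> real"
  define vol where "vol u v w = u 1 * (v 2 * w 3 - v 3 * w 2) + u 2 * (v 3 * w 1 - v 1 * w 3) +
    u 3 * (v 1 * w 2 - v 2 * (w 1 :: real))" for u v w :: "3 \<Rightarrow> real"
  have cv: "cv k i p = c k i" for k i by (simp add: cv_def c_def t_def b_def)
  have frc: "fr l (cv k i) p = fr l (tv k i) p + fr l (bv k i) p" for l k i
  proof -
    have "cv k i = (\<lambda>p. tv k i p + bv k i p)" by (simp add: fun_eq_iff cv_def)
    then show ?thesis by (simp add: fr_add diff_vectors)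
  qed
  have e: "(\<lambda>i. fr 2 (cv 3 i) p - fr 3 (cv 2 i) p) = (\<lambda>i. D23 i + E23 i)"
    "(\<lambda>i. fr 1 (cv 3 i) p - fr 3 (cv 1 i) p) = (\<lambda>i. D13 i + E13 i)"
    "(\<lambda>i. fr 1 (cv 2 i) p - fr 2 (cv 1 i) p - cv 3 i p - p$1 * (fr 1 (cv 3 i) p - fr 3 (cv 1 i) p)) =
      (\<lambda>i. D12 i + E12 i - c 3 i - p$1 * (D13 i + E13 i))"
    by (simp_all add: fun_eq_iff frc cv D12_def D13_def D23_def E12_def E13_def E23_def algebra_simps)
  have \<theta>: "connection_form nil_metric sec p (axis 1 1) = hat (c 1)"
    "connection_form nil_metric sec p (axis 2 1) = hat (\<lambda>i. c 2 i - p$1 * c 3 i)"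
    "connection_form nil_metric sec p (axis 3 1) = hat (c 3)"
    by (simp_all add: connection_form_sec sum_3 coframe_expand axis_def cv)
  have "chern_simons_form nil_metric sec p (axis 1 1) (axis 2 1) (axis 3 1) =
    -2 * (dot (c 1) (\<lambda>i. D23 i + E23 i) - dot (\<lambda>i. c 2 i - p$1 * c 3 i) (\<lambda>i. D13 i + E13 i) +
       dot (c 3) (\<lambda>i. D12 i + E12 i - c 3 i - p$1 * (D13 i + E13 i))) -
    4 * vol (c 1) (\<lambda>i. c 2 i - p$1 * c 3 i) (c 3)"
    unfolding chern_simons_form_def Let_def wedge12_def wedge11_def ext_deriv_sec \<theta> e chern_simons_hat
    by (simp add: dot_def vol_def)
  \<comment> \<open>All multiples of \<open>p$1\<close> cancel: a 3-form takes the same value on the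
    coordinate fields as on X, Y, Z.\<close>
  also have "\<dots> = -2 * (dot (c 1) D23 - dot (c 2) D13 + dot (c 3) D12 +
      (dot (c 1) E23 - dot (c 2) E13 + dot (c 3) E12) - dot (c 3) (c 3)) - 4 * vol (c 1) (c 2) (c 3)"
    by (simp add: dot_def vol_def algebra_simps)
  finally have 1: "chern_simons_form nil_metric sec p (axis 1 1) (axis 2 1) (axis 3 1) =
    -2 * (dot (c 1) D23 - dot (c 2) D13 + dot (c 3) D12 +
      (dot (c 1) E23 - dot (c 2) E13 + dot (c 3) E12) - dot (c 3) (c 3)) - 4 * vol (c 1) (c 2) (c 3)" .
  have "fr 1 (tb 2 3) p + fr 2 (tb 3 1) p + fr 3 (tb 1 2) p =
      dot D12 (b 3) - dot D13 (b 2) + dot D23 (b 1) - (dot (t 1) E23 - dot (t 2) E13 + dot (t 3) E12)"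
    unfolding fr_tb dot_def D12_def D13_def D23_def E12_def E13_def E23_def t_def[symmetric] b_def[symmetric]
    by (simp add: algebra_simps)
  moreover have D: "D12 1 = t 3 1 - (t 1 2 * t 2 3 - t 1 3 * t 2 2)" "D12 2 = t 3 2 - (t 1 3 * t 2 1 - t 1 1 * t 2 3)"
    "D12 3 = t 3 3 - (t 1 1 * t 2 2 - t 1 2 * t 2 1)"
    "D13 1 = - (t 1 2 * t 3 3 - t 1 3 * t 3 2)" "D13 2 = - (t 1 3 * t 3 1 - t 1 1 * t 3 3)"
    "D13 3 = - (t 1 1 * t 3 2 - t 1 2 * t 3 1)"
    "D23 1 = - (t 2 2 * t 3 3 - t 2 3 * t 3 2)" "D23 2 = - (t 2 3 * t 3 1 - t 2 1 * t 3 3)"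
    "D23 3 = - (t 2 1 * t 3 2 - t 2 2 * t 3 1)"
    unfolding D12_def D13_def D23_def t_def by (rule structure_equations)+
  moreover have E: "E12 1 = (b 2 2 * t 1 3 - b 2 3 * t 1 2) - (b 1 2 * t 2 3 - b 1 3 * t 2 2)"
    "E12 2 = (b 2 3 * t 1 1 - b 2 1 * t 1 3) - (b 1 3 * t 2 1 - b 1 1 * t 2 3)"
    "E12 3 = (b 2 1 * t 1 2 - b 2 2 * t 1 1) - (b 1 1 * t 2 2 - b 1 2 * t 2 1)"
    "E13 1 = (b 3 2 * t 1 3 - b 3 3 * t 1 2) - (b 1 2 * t 3 3 - b 1 3 * t 3 2)"
    "E13 2 = (b 3 3 * t 1 1 - b 3 1 * t 1 3) - (b 1 3 * t 3 1 - b 1 1 * t 3 3)"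
    "E13 3 = (b 3 1 * t 1 2 - b 3 2 * t 1 1) - (b 1 1 * t 3 2 - b 1 2 * t 3 1)"
    "E23 1 = (b 3 2 * t 2 3 - b 3 3 * t 2 2) - (b 2 2 * t 3 3 - b 2 3 * t 3 2)"
    "E23 2 = (b 3 3 * t 2 1 - b 3 1 * t 2 3) - (b 2 3 * t 3 1 - b 2 1 * t 3 3)"
    "E23 3 = (b 3 1 * t 2 2 - b 3 2 * t 2 1) - (b 2 1 * t 3 2 - b 2 2 * t 3 1)"
    unfolding E12_def E13_def E23_def fr_bv t_def b_def by simp_all
  moreover have "vol (b 1) (b 2) (b 3) = - 1/8" "dot (b 3) (b 3) = 1/4"
    using bv_volume[of p] by (simp_all add: vol_def dot_def b_def)
  moreover have "tdet p = vol (t 1) (t 2) (t 3)"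
    by (simp add: tdet_def det_3 vol_def t_def algebra_simps)
  \<comment> \<open>The part free of t is the constant of the frame X, Y, Z. The part cubic in t is
    the volume term: the structure equations give +6 and the cubic term -4. All mixed parts together
    are the derivative of \<open>tb\<close>.\<close>
  moreover have "-2 * (dot (c 1) D23 - dot (c 2) D13 + dot (c 3) D12 +
      (dot (c 1) E23 - dot (c 2) E13 + dot (c 3) E12) - dot (c 3) (c 3)) - 4 * vol (c 1) (c 2) (c 3) =
      2 * dot (b 3) (b 3) - 4 * vol (b 1) (b 2) (b 3) + 2 * vol (t 1) (t 2) (t 3) +
      2 * (dot D12 (b 3) - dot D13 (b 2) + dot D23 (b 1) - (dot (t 1) E23 - dot (t 2) E13 + dot (t 3) E12))"
    unfolding dot_def vol_def c_def D E by (simp add: algebra_simps)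
  ultimately show ?thesis unfolding 1 by simp
qed

end

section \<open>Smooth sections and the final assembly\<close>

lemma Ck_const: "Ck k (\<lambda>x. c)"
  by (induction k arbitrary: c) auto

lemma C2_entry:
  fixes s :: "real^3 \<Rightarrow> real^3^3"
  assumes "smooth s"
  shows "C2 UNIV (\<lambda>p. s p $ i $ j)"
proof -
  have "Ck (Suc (Suc 0)) s" using assms by (simp add: smooth_def del: Ck.simps)
  then have d: "s differentiable at p" and dv: "(\<lambda>x. dd s x v) differentiable at p"
    and cont: "continuous_on UNIV (\<lambda>x. dd (\<lambda>x. dd s x v) x u)" for p u v
    by simp_all
  have bl: "bounded_linear (\<lambda>M::real^3^3. M $ i $ j)"
    using bounded_linear_compose[OF bounded_linear_vec_nth bounded_linear_vec_nth] .
  have e: "((\<lambda>p. f p $ i $ j) has_derivative (\<lambda>v. dd f p v $ i $ j)) (at p)"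
    if "f differentiable at p" for f :: "real^3 \<Rightarrow> real^3^3" and p
    by (rule bounded_linear.has_derivative[OF bl has_derivative_dd[OF that]])
  have c: "continuous_on UNIV (\<lambda>p. f p $ i $ j)" if "continuous_on UNIV f" for f :: "real^3 \<Rightarrow> real^3^3"
    by (rule bounded_linear.continuous_on[OF bl that])
  have e1: "dd (\<lambda>p. s p $ i $ j) p v = dd s p v $ i $ j" for p v
    by (rule dd_eqI[OF e[OF d]])
  have e2: "dd (\<lambda>p. dd s p v $ i $ j) p u = dd (\<lambda>x. dd s x v) p u $ i $ j" for p u v
    by (rule dd_eqI[OF e[OF dv]])
  have c1: "continuous_on UNIV (\<lambda>x. dd s x v)" for v
    using dv by (simp add: continuous_on_eq_continuous_at differentiable_imp_continuous_within)
  show ?thesis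
    unfolding C2_def C1_def e1 e2
    using differentiableI[OF e[OF d]] differentiableI[OF e[OF dv]] c[OF c1] c[OF cont] by blast
qed

text \<open>The frame is affine in x, so its derivative does not depend on the point and higher
  derivatives vanish.\<close>

lemma smooth_nil_frame: "smooth nil_frame"
  unfolding smooth_def
proof
  define E :: "real^3^3" where "E = vector [vector [0, 0, 0], vector [0, 0, 0], vector [0, 1, 0]]"
  have e: "nil_frame = (\<lambda>p. nil_frame 0 + p$1 *\<^sub>R E)"
    by (simp add: fun_eq_iff nil_frame_def E_def vec_eq_iff forall_3)
  have g: "((\<lambda>p. nil_frame 0 + p$1 *\<^sub>R E) has_derivative (\<lambda>v. v$1 *\<^sub>R E)) (at p)" for p
    by (auto intro!: derivative_eq_intros bounded_linear_imp_has_derivative bounded_linear_vec_nth)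
  have d: "(nil_frame has_derivative (\<lambda>v. v$1 *\<^sub>R E)) (at p)" for p
    by (subst e) (rule g)
  then have dd: "dd nil_frame p v = v$1 *\<^sub>R E" for p v by (rule dd_eqI)
  show "Ck k nil_frame" for k
  proof (cases k)
    case 0
    have "continuous_on UNIV nil_frame"
      by (intro continuous_at_imp_continuous_on ballI has_derivative_continuous[OF d])
    then show ?thesis by (simp add: 0)
  next
    case (Suc n)
    have "nil_frame differentiable at p" for p by (rule differentiableI[OF d])
    then show ?thesis by (simp add: Suc dd Ck_const)
  qed
qed

lemma dd_nil_mult: "dd (nil_mult a) p w = vector [w$1, w$2, w$3 + a$1 * w$2]"
proof -
  let ?L = "\<lambda>w. vector [w$1, w$2, w$3 + a$1 * w$2] :: real^3"
  have "linear ?L" by (rule linearI) (simp_all add: vec_eq_iff forall_3 algebra_simps)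
  then have "(?L has_derivative ?L) (at p)" by (rule linear_imp_has_derivative)
  then have "((\<lambda>q. a + ?L q) has_derivative ?L) (at p)" by (auto intro!: derivative_eq_intros)
  moreover have "nil_mult a = (\<lambda>q. a + ?L q)"
    by (auto simp: fun_eq_iff nil_mult_def vec_eq_iff forall_3)
  ultimately show ?thesis by (simp add: dd_eqI)
qed

text \<open>Provides a section: otherwise the union defining \<open>chern_simons\<close> would be
  empty rather than a coset.\<close>

lemma frame_section_nil_frame: "frame_section (left_translations \<Gamma>) nil_metric nil_frame"
  unfolding frame_section_def
proof (intro conjI ballI allI)
  show "column i (nil_frame (\<phi> p)) = dd \<phi> p (column i (nil_frame p))"
    if "\<phi> \<in> left_translations \<Gamma>" for \<phi> p i
    using that exhaust_3[of i]
    by (auto simp: left_translations_def dd_nil_mult column_def nil_frame_def vec_eq_iff forall_3)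
qed (simp_all add: smooth_nil_frame nil_frame_orthonormal det_nil_frame)

context nil_quotient
begin

lemma quotient_integral_eq:
  "quotient_integral (left_translations \<Gamma>) \<Omega> =
    (\<integral>p. indicator fdom p * \<Omega> p (axis 1 1) (axis 2 1) (axis 3 1) \<partial>lborel)"
  by (simp add: quotient_integral_def set_lebesgue_integral_def fdom_def)

lemma riemannian_volume_eq: "riemannian_volume (left_translations \<Gamma>) nil_metric = (\<integral>p. indicator fdom p \<partial>lborel)"
proof -
  have "volume_form nil_metric p (axis 1 1) (axis 2 1) (axis 3 1) = 1" for p
    unfolding volume_form_def det_gram_nil by (simp add: det_3 axis_def)
  then show ?thesis by (simp add: riemannian_volume_def quotient_integral_eq)
qed

text \<open>This compares an arbitrary section with X, Y, Z. Its integer is the degree of the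
  transition map into SO(3).\<close>

lemma chern_simons_integral:
  assumes s: "frame_section (left_translations \<Gamma>) nil_metric s"
  shows "\<exists>n\<in>\<int>. quotient_integral (left_translations \<Gamma>) (chern_simons_form nil_metric s) =
    riemannian_volume (left_translations \<Gamma>) nil_metric + 16 * pi\<^sup>2 * n"
proof -
  have sm: "smooth s" and on: "\<And>p i j. nil_metric p (column i (s p)) (column j (s p)) = (if i = j then 1 else 0)"
    and dpos: "\<And>p. det (s p) > 0"
    and inv: "\<And>\<phi> p i. \<phi> \<in> left_translations \<Gamma> \<Longrightarrow> column i (s (\<phi> p)) = dd \<phi> p (column i (s p))"
    using s unfolding frame_section_def by blast+
  \<comment> \<open>The inverse of \<open>nil_frame p\<close> times \<open>s p\<close>:
    multiplication by it subtracts x times the second row from the third.\<close>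
  define h where "h p = (\<chi> i j. if i = 3 then s p$3$j - p$1 * s p$2$j else s p$i$j)" for p
  have h: "h p$1$j = s p$1$j" "h p$2$j = s p$2$j" "h p$3$j = s p$3$j - p$1 * s p$2$j" for p j
    by (simp_all add: h_def)
  have orth: "transpose (h p) ** h p = mat 1" for p
    using on[of p] by (simp add: vec_eq_iff matrix_matrix_mult_def transpose_def mat_def sum_3 h nil_metric_def column_def)
  interpret so3_quotient \<Gamma> h
  proof unfold_locales
    show "C2 UNIV (\<lambda>p. h p $ i $ j)" for i j
    proof -
      have "C2 UNIV (\<lambda>p. h p $ 1 $ j)" "C2 UNIV (\<lambda>p. h p $ 2 $ j)" "C2 UNIV (\<lambda>p. h p $ 3 $ j)"
        unfolding h by (intro C2_diff C2_mult C2_nth C2_entry[OF sm] open_UNIV)+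
      then show ?thesis using exhaust_3[of i] by auto
    qed
    show "transpose (h p) ** h p = mat 1" for p by (rule orth)
    show "det (h p) = 1" for p
    proof -
      \<comment> \<open>Orthogonality leaves determinant 1 or -1, and the orientation of the section
        decides.\<close>
      have "det (h p) * det (h p) = 1"
        using arg_cong[OF orth[of p], of det] by (simp add: det_mul det_transpose)
      moreover have "det (h p) = det (s p)" by (simp add: det_3 h algebra_simps)
      ultimately show ?thesis using dpos[of p] square_eq_1_iff[of "det (h p)"] by auto
    qed
    show "invariant h"
      unfolding invariant_def
    proof (intro ballI allI)
      fix \<gamma> p assume \<gamma>: "\<gamma> \<in> \<Gamma>"
      have e: "s (nil_mult \<gamma> p) $ k $ i = dd (nil_mult \<gamma>) p (column i (s p)) $ k" for k i
        using inv[of "nil_mult \<gamma>" i p] \<gamma> by (auto simp: left_translations_def column_def vec_eq_iff)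
      show "h (nil_mult \<gamma> p) = h p"
        by (simp add: vec_eq_iff forall_3 h e dd_nil_mult column_def algebra_simps)
    qed
  qed
  have "sec = s"
    by (simp add: fun_eq_iff vec_eq_iff forall_3 sec_nth h)
  then have cs: "chern_simons_form nil_metric s p (axis 1 1) (axis 2 1) (axis 3 1) =
      1 + 2 * tdet p + 2 * (fr 1 (tb 2 3) p + fr 2 (tb 3 1) p + fr 3 (tb 1 2) p)" for p
    using chern_simons_form_sec by simp
  have "invariant (bv k i)" for k i
    using invariantD[OF invariant_h] by (simp add: invariant_def bv_def)
  then have inv_tb: "invariant (tb k l)" for k l
    using invariantD[OF invariant_tv] unfolding invariant_def tb_def by simp
  have int_tb: "integrable lborel (\<lambda>p. indicator fdom p * fr m (tb k l) p)" for m k l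
  proof -
    have c: "continuous_on UNIV (fr m (tb k l))" by (rule C1_fr_cont[OF C1_tb])
    obtain M where "\<And>p. \<bar>fr m (tb k l) p\<bar> \<le> M"
      using bounded_invariant[OF invariant_fr[OF inv_tb] c] C1_diffD[OF C1_tb] by blast
    then show ?thesis
      using c by (intro integrable_fdom borel_measurable_continuous_onI) auto
  qed
  have int_t: "integrable lborel (\<lambda>p. indicator fdom p * tdet p)"
  proof -
    have c: "continuous_on UNIV tdet" by (rule C1_contD[OF C1_tdet])
    obtain M where "\<And>p. \<bar>tdet p\<bar> \<le> M" using bounded_invariant[OF invariant_tdet c] by blast
    then show ?thesis
      using c by (intro integrable_fdom borel_measurable_continuous_onI) auto
  qed
  have int_1: "integrable lborel (\<lambda>p. indicator fdom p :: real)"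
    using finite_fdom by (intro integrable_real_indicator) auto
  obtain n where n: "n \<in> \<int>" "(\<integral>p. indicator fdom p * tdet p \<partial>lborel) = 8 * pi\<^sup>2 * n"
    using integral_tdet by blast
  have "quotient_integral (left_translations \<Gamma>) (chern_simons_form nil_metric s) =
      (\<integral>p. indicator fdom p + 2 * (indicator fdom p * tdet p) + 2 * (indicator fdom p * fr 1 (tb 2 3) p +
        indicator fdom p * fr 2 (tb 3 1) p + indicator fdom p * fr 3 (tb 1 2) p) \<partial>lborel)"
    unfolding quotient_integral_eq cs by (intro Bochner_Integration.integral_cong) (simp_all add: algebra_simps)
  \<comment> \<open>The three \<open>tb\<close> terms are derivatives of invariant functions along
    the frame and integrate to 0.\<close>
  also have "\<dots> = (\<integral>p. indicator fdom p \<partial>lborel) + 2 * (8 * pi\<^sup>2 * n)"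
    using int_1 int_t int_tb integral_fr_eq_0[OF inv_tb C1_tb] n(2) by simp
  finally show ?thesis using n(1) by (auto simp: riemannian_volume_eq)
qed

end

lemma mod_Z_add_int: "n \<in> \<int> \<Longrightarrow> mod_Z (a + n) = mod_Z a"
proof -
  assume "n \<in> \<int>"
  then obtain k where k: "n = of_int k" by (rule Ints_cases)
  have "(\<exists>j. a + n = x + of_int j) \<longleftrightarrow> (\<exists>j. a = x + of_int j)" for x
  proof
    assume "\<exists>j. a + n = x + of_int j"
    then obtain j where "a + n = x + of_int j" by blast
    then show "\<exists>j. a = x + of_int j" by (intro exI[of _ "j - k"]) (simp add: k)
  next
    assume "\<exists>j. a = x + of_int j"
    then obtain j where "a = x + of_int j" by blast
    then show "\<exists>j. a + n = x + of_int j" by (intro exI[of _ "j + k"]) (simp add: k)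
  qed
  then show ?thesis by (simp add: mod_Z_def rcong_altdef)
qed

theorem proposition3p8:
  fixes \<Gamma> :: "(real^3) set"
  assumes "nil_lattice \<Gamma>"
  shows "chern_simons (left_translations \<Gamma>) nil_metric =
         mod_Z (- (1 / (16 * pi\<^sup>2)) * riemannian_volume (left_translations \<Gamma>) nil_metric)"
proof -
  interpret nil_quotient \<Gamma> by standard (rule assms)
  have "mod_Z (- (1 / (16 * pi\<^sup>2)) * quotient_integral (left_translations \<Gamma>) (chern_simons_form nil_metric s)) =
      mod_Z (- (1 / (16 * pi\<^sup>2)) * riemannian_volume (left_translations \<Gamma>) nil_metric)"
    if s: "frame_section (left_translations \<Gamma>) nil_metric s" for s
  proof -
    obtain n where n: "n \<in> \<int>" "quotient_integral (left_translations \<Gamma>) (chern_simons_form nil_metric s) =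
        riemannian_volume (left_translations \<Gamma>) nil_metric + 16 * pi\<^sup>2 * n"
      using chern_simons_integral[OF s] by blast
    have "- (1 / (16 * pi\<^sup>2)) * quotient_integral (left_translations \<Gamma>) (chern_simons_form nil_metric s) =
        - (1 / (16 * pi\<^sup>2)) * riemannian_volume (left_translations \<Gamma>) nil_metric + - n"
      unfolding n(2) by (simp add: field_simps)
    then show ?thesis using mod_Z_add_int[of "- n"] n(1) by (simp only: Ints_minus)
  qed
  then show ?thesis
    \<comment> \<open>All sections give the same coset, and \<open>nil_frame\<close> ensures that
      there is one.\<close>
    unfolding chern_simons_def using frame_section_nil_frame[of \<Gamma>] by blast
qed

end
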